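(* (1) For every predicate $A\in\Pi^+$ the following are equivalent: (a) $A\in\mathsf{TR}$; (b) the equation $1'\le A$ is true in every integral dense commutative relation algebra; (c) $A$ is valid in every frame $\mathfrak K=(K,R,{}^*,\mathcal I)$ satisfying $|\mathcal I|=1$, left reflection, right reflection, identity, Pasch, density and commutativity. (2) For every $A\in\Pi^+$ the following are equivalent: (a) $A\in\mathsf{KR}$; (b) $1'\le A$ is true in every integral dense symmetric relation algebra; (c) $A$ is valid in every frame $\mathfrak K=(K,R,{}^*,\mathcal I)$ satisfying $|\mathcal I|=1$, left reflection, right reflection, identity, Pasch, density and symmetry.
   Context: **Predicates and equations.** $\Pi$ is a countably infinite set of binary relation symbols containing the equality symbol $1'$; members of $\Pi$ other than $1'$ are propositional variables. $\Pi^+$ (predicates) is the absolutely free closure of $\Pi$ under the formal operators $A+B$, $\overline A$, $A;B$, $A^\smile$. An equation is a formal expression $A\doteq B$ with $A,B\in\Pi^+$; $A\le B$ denotes $A+B\doteq B$. $\mathfrak P=(\Pi^+,+,\overline{\phantom a},;,{}^\smile,1')$ is the predicate algebra. $\Xi^d=\{A\le A;A:A\in\Pi^+\}$, $\Xi^c=\{A;B\doteq B;A:A,B\in\Pi^+\}$. **Algebras.** A relation algebra is an algebra $\mathfrak A=(U,+,\overline{\phantom a},;,{}^\smile,1')$ satisfying, for all $a,b,c\in U$: $a+b=b+a$; $a+(b+c)=(a+b)+c$; $\overline{\overline a+\overline b}+\overline{\overline a+b}=a$; $a;(b;c)=(a;b);c$; $(a+b);c=a;c+b;c$; $a;1'=a$;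 $a^{\smile\smile}=a$; $(a+b)^\smile=a^\smile+b^\smile$; $(a;b)^\smile=b^\smile;a^\smile$; $a^\smile;\overline{a;b}+\overline b=\overline b$. Put $1=1'+\overline{1'}$, $0=\overline1$, and $x\le y$ iff $x+y=y$. $\mathfrak A$ is dense if $x\le x;x$ for all $x$, commutative if $x;y=y;x$ for all $x,y$, symmetric if $x^\smile=x$ for all $x$, integral if $0\ne1$ and $x;y=0$ implies $x=0$ or $y=0$. An equation $A\doteq B$ is true in $\mathfrak A$ if $h(A)=h(B)$ for every homomorphism $h\colon\mathfrak P\to\mathfrak A$. **Frames.** A frame is $\mathfrak K=(K,R,{}^*,\mathcal I)$ with $R\subseteq K^3$, ${}^*\colon K\to K$, $\mathcal I\subseteq K$. Its complex algebra $\mathfrak{Cm}(\mathfrak K)$ is $(\wp(K),\cup,\overline{\phantom a},;,{}^\smile,\mathcal I)$ with $\overline X=K\setminus X$, $X;Y=\{z:Rxyz\text{ for some }x\in X,y\in Y\}$, $X^\smile=\{z^*:z\in X\}$. $A\in\Pi^+$ is valid in $\mathfrak K$ if $\mathcal I\subseteq h(A)$ for every homomorphism $h\colon\mathfrak P\to\mathfrak{Cm}(\mathfrak K)$. Conditions (for all $v,w,x,y,z\in K$): left reflection $Rxyz\Rightarrow Rx^*zy$; right reflection $Rxyz\Rightarrow Rzy^*x$; identity $x=y\Leftrightarrow\exists u\in\mathcal I\;Rxuy$; Pasch $\exists x(Rvwx\land Rxyz)\Rightarrow\exists u(Rvuz\land Rwyu)$; density $Rxxx$; commutativity $Rxyz\Leftrightarrow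 Ryxz$; symmetry $x^*=x$. A $\mathsf{CR}^*$-frame is a frame with $\mathcal I=\{0\}$ and, for all $a,b,c,d$: $R0ab\Leftrightarrow a=b$; $\exists x(Rabx\land Rxcd)\Leftrightarrow\exists y(Racy\land Rybd)$; $Raaa$; $a^{**}=a$; $Rabc\Leftrightarrow Rac^*b^*$. A $\mathsf{KR}$-frame is a $\mathsf{CR}^*$-frame satisfying symmetry. $\mathsf{KR}=\{A\in\Pi^+:A\text{ is valid in every }\mathsf{KR}\text{-frame}\}$. **The logic $\mathsf{TR}$.** $\mathsf{TR}=\{A\in\Pi^+:\Xi^d\cup\Xi^c\vdash_4^+1'\le A\}$, where $\vdash_4^+$ is the following four-variable provability relation. Formulas of $\Phi_4^+$ are built from atomic formulas $xAy$ ($x,y\in\{v_0,v_1,v_2,v_3\}$, $A\in\Pi^+$) and equations (no free variables) by $\Rightarrow,\neg,\forall x$ with $x\in\{v_0,\dots,v_3\}$ ($\lor,\land,\Leftrightarrow,\exists$ the usual abbreviations). $[\varphi]$ is the universal closure; $S_{xy}\varphi$ interchanges $x$ and $y$ everywhere in $\varphi$ (including in quantifiers). Axioms, for $\varphi,\psi,\xi\in\Phi_4^+$, $x,y\in\{v_0,\dots,v_3\}$, $A,B\in\Pi^+$: $[(\varphi\Rightarrow\psi)\Rightarrow((\psi\Rightarrow\xi)\Rightarrow(\varphi\Rightarrow\xi))]$; $[(\neg\varphi\Rightarrow\varphi)\Rightarrow\varphi]$; $[\varphi\Rightarrow(\neg\varphi\Rightarrow\psi)]$; $[\forall x\forall y\varphi\Rightarrow\forall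 y\forall x\varphi]$; $[\forall x(\varphi\Rightarrow\psi)\Rightarrow(\forall x\varphi\Rightarrow\forall x\psi)]$; $[\forall x\varphi\Rightarrow\varphi]$; $[\varphi\Rightarrow\forall x\varphi]$ if $x$ is not free in $\varphi$; $[\exists x(x1'y)]$ if $x\ne y$; $[x1'y\Rightarrow(\varphi\Rightarrow S_{xy}\varphi)]$; $[v_0(A+B)v_1\Leftrightarrow v_0Av_1\lor v_0Bv_1]$; $[v_0\overline Av_1\Leftrightarrow\neg v_0Av_1]$; $[v_0(A;B)v_1\Leftrightarrow\exists v_2(v_0Av_2\land v_2Bv_1)]$; $[v_0A^\smile v_1\Leftrightarrow v_1Av_0]$; $A\doteq B\Leftrightarrow[v_0Av_1\Leftrightarrow v_0Bv_1]$. $\Psi\vdash_4^+\varphi$ means that $\varphi$ lies in every set containing $\Psi$ and the axioms and closed under modus ponens. *)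

theory Defs
  imports Main "HOL-Combinatorics.Transposition"
begin

section \<open>Predicates and equations\<close>

datatype predicate =
    PVar nat
  | PId                (\<open>\<^bold>1''\<close>)
  | PSum predicate predicate     (infixl \<open>\<^bold>+\<close> 65)
  | PCompl predicate        (\<open>\<^bold>- _\<close> [81] 80)
  | PComp predicate predicate    (infixl \<open>\<^bold>;\<close> 70)
  | PConv predicate         (\<open>_\<^bold>\<smile>\<close> [1000] 1000)

datatype eqn = Eqn predicate predicate  (infix \<open>\<doteq>\<close> 50)

definition ineq :: "predicate \<Rightarrow> predicate \<Rightarrow> eqn"  (infix \<open>\<^bold>\<le>\<close> 50)
  where "A \<^bold>\<le> B = (A \<^bold>+ B \<doteq> B)"

definition Xi_d :: "eqn set"
  where "Xi_d = {A \<^bold>\<le> A \<^bold>; A | A. True}"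

definition Xi_c :: "eqn set"
  where "Xi_c = {A \<^bold>; B \<doteq> B \<^bold>; A | A B. True}"


section \<open>Relation algebras\<close>

record 'u ralg =
  univ  :: "'u set"
  join  :: "'u \<Rightarrow> 'u \<Rightarrow> 'u"  (infixl \<open>\<oplus>\<index>\<close> 65)
  neg   :: "'u \<Rightarrow> 'u"        (\<open>\<sim>\<index> _\<close> [81] 80)
  semi  :: "'u \<Rightarrow> 'u \<Rightarrow> 'u"  (infixl \<open>\<odot>\<index>\<close> 70)
  conv  :: "'u \<Rightarrow> 'u"        (\<open>_\<smile>\<index>\<close> [1000] 1000)
  ident :: "'u"              (\<open>\<one>''\<index>\<close>)

locale algebra_structure =
  fixes \<AA> :: "'u ralg" (structure)
  assumes join_closed:  "a \<in> univ \<AA> \<Longrightarrow> b \<in> univ \<AA> \<Longrightarrow> a \<oplus> b \<in> univ \<AA>"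
    and   neg_closed:   "a \<in> univ \<AA> \<Longrightarrow> \<sim> a \<in> univ \<AA>"
    and   semi_closed:  "a \<in> univ \<AA> \<Longrightarrow> b \<in> univ \<AA> \<Longrightarrow> a \<odot> b \<in> univ \<AA>"
    and   conv_closed:  "a \<in> univ \<AA> \<Longrightarrow> a\<smile> \<in> univ \<AA>"
    and   ident_closed: "\<one>' \<in> univ \<AA>"

locale relation_algebra = algebra_structure +
  assumes join_comm:
    "a \<in> univ \<AA> \<Longrightarrow> b \<in> univ \<AA> \<Longrightarrow> a \<oplus> b = b \<oplus> a"
  and join_assoc:
    "a \<in> univ \<AA> \<Longrightarrow> b \<in> univ \<AA> \<Longrightarrow> c \<in> univ \<AA> \<Longrightarrow> a \<oplus> (b \<oplus> c) = (a \<oplus> b) \<oplus> c"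
  and huntington:
    "a \<in> univ \<AA> \<Longrightarrow> b \<in> univ \<AA> \<Longrightarrow> \<sim> (\<sim> a \<oplus> \<sim> b) \<oplus> \<sim> (\<sim> a \<oplus> b) = a"
  and semi_assoc:
    "a \<in> univ \<AA> \<Longrightarrow> b \<in> univ \<AA> \<Longrightarrow> c \<in> univ \<AA> \<Longrightarrow> a \<odot> (b \<odot> c) = (a \<odot> b) \<odot> c"
  and semi_distrib:
    "a \<in> univ \<AA> \<Longrightarrow> b \<in> univ \<AA> \<Longrightarrow> c \<in> univ \<AA> \<Longrightarrow> (a \<oplus> b) \<odot> c = a \<odot> c \<oplus> b \<odot> c"
  and semi_ident:
    "a \<in> univ \<AA> \<Longrightarrow> a \<odot> \<one>' = a"
  and conv_conv:
    "a \<in> univ \<AA> \<Longrightarrow> a\<smile>\<smile> = a"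
  and conv_join:
    "a \<in> univ \<AA> \<Longrightarrow> b \<in> univ \<AA> \<Longrightarrow> (a \<oplus> b)\<smile> = a\<smile> \<oplus> b\<smile>"
  and conv_semi:
    "a \<in> univ \<AA> \<Longrightarrow> b \<in> univ \<AA> \<Longrightarrow> (a \<odot> b)\<smile> = b\<smile> \<odot> a\<smile>"
  and conv_residual:
    "a \<in> univ \<AA> \<Longrightarrow> b \<in> univ \<AA> \<Longrightarrow> a\<smile> \<odot> \<sim> (a \<odot> b) \<oplus> \<sim> b = \<sim> b"

definition ra_one :: "'u ralg \<Rightarrow> 'u"
  where "ra_one \<AA> = \<one>'\<^bsub>\<AA>\<^esub> \<oplus>\<^bsub>\<AA>\<^esub> \<sim>\<^bsub>\<AA>\<^esub> \<one>'\<^bsub>\<AA>\<^esub>"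

definition ra_zero :: "'u ralg \<Rightarrow> 'u"
  where "ra_zero \<AA> = \<sim>\<^bsub>\<AA>\<^esub> ra_one \<AA>"

definition ra_le :: "'u ralg \<Rightarrow> 'u \<Rightarrow> 'u \<Rightarrow> bool"
  where "ra_le \<AA> x y \<longleftrightarrow> x \<oplus>\<^bsub>\<AA>\<^esub> y = y"

definition dense_alg :: "'u ralg \<Rightarrow> bool"
  where "dense_alg \<AA> \<longleftrightarrow> (\<forall>x\<in>univ \<AA>. ra_le \<AA> x (x \<odot>\<^bsub>\<AA>\<^esub> x))"

definition commutative_alg :: "'u ralg \<Rightarrow> bool"
  where "commutative_alg \<AA> \<longleftrightarrow> (\<forall>x\<in>univ \<AA>. \<forall>y\<in>univ \<AA>. x \<odot>\<^bsub>\<AA>\<^esub> y = y \<odot>\<^bsub>\<AA>\<^esub> x)"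

definition symmetric_alg :: "'u ralg \<Rightarrow> bool"
  where "symmetric_alg \<AA> \<longleftrightarrow> (\<forall>x\<in>univ \<AA>. x\<smile>\<^bsub>\<AA>\<^esub> = x)"

definition integral_alg :: "'u ralg \<Rightarrow> bool"
  where "integral_alg \<AA> \<longleftrightarrow> ra_zero \<AA> \<noteq> ra_one \<AA> \<and>
    (\<forall>x\<in>univ \<AA>. \<forall>y\<in>univ \<AA>.
       x \<odot>\<^bsub>\<AA>\<^esub> y = ra_zero \<AA> \<longrightarrow> x = ra_zero \<AA> \<or> y = ra_zero \<AA>)"

definition alg_hom :: "'a ralg \<Rightarrow> 'b ralg \<Rightarrow> ('a \<Rightarrow> 'b) set"
  where "alg_hom \<AA> \<BB> = {h.
    (\<forall>a\<in>univ \<AA>. h a \<in> univ \<BB>) \<and>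
    (\<forall>a\<in>univ \<AA>. \<forall>b\<in>univ \<AA>. h (a \<oplus>\<^bsub>\<AA>\<^esub> b) = h a \<oplus>\<^bsub>\<BB>\<^esub> h b) \<and>
    (\<forall>a\<in>univ \<AA>. h (\<sim>\<^bsub>\<AA>\<^esub> a) = \<sim>\<^bsub>\<BB>\<^esub> h a) \<and>
    (\<forall>a\<in>univ \<AA>. \<forall>b\<in>univ \<AA>. h (a \<odot>\<^bsub>\<AA>\<^esub> b) = h a \<odot>\<^bsub>\<BB>\<^esub> h b) \<and>
    (\<forall>a\<in>univ \<AA>. h (a\<smile>\<^bsub>\<AA>\<^esub>) = (h a)\<smile>\<^bsub>\<BB>\<^esub>) \<and>
    h \<one>'\<^bsub>\<AA>\<^esub> = \<one>'\<^bsub>\<BB>\<^esub>}"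

definition pred_alg :: "predicate ralg"  (\<open>\<PP>\<close>)
  where "\<PP> = \<lparr>univ = UNIV, join = PSum, neg = PCompl, semi = PComp, conv = PConv, ident = PId\<rparr>"

fun true_in :: "'u ralg \<Rightarrow> eqn \<Rightarrow> bool"
  where "true_in \<AA> (A \<doteq> B) \<longleftrightarrow> (\<forall>h\<in>alg_hom \<PP> \<AA>. h A = h B)"


section \<open>Frames\<close>

record 'k frame =
  points :: "'k set"
  rel    :: "('k \<times> 'k \<times> 'k) set"
  star   :: "'k \<Rightarrow> 'k"
  idents :: "'k set"

definition is_frame :: "'k frame \<Rightarrow> bool"
  where "is_frame F \<longleftrightarrow> rel F \<subseteq> points F \<times> points F \<times> points F \<and>
    star F ` points F \<subseteq> points F \<and> idents F \<subseteq> points F"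

definition Cm :: "'k frame \<Rightarrow> 'k set ralg"
  where "Cm F = \<lparr>
    univ = Pow (points F),
    join = (\<union>),
    neg = (\<lambda>X. points F - X),
    semi = (\<lambda>X Y. {z. \<exists>x\<in>X. \<exists>y\<in>Y. (x, y, z) \<in> rel F}),
    conv = (\<lambda>X. {star F z | z. z \<in> X}),
    ident = idents F\<rparr>"

definition valid_in :: "'k frame \<Rightarrow> predicate \<Rightarrow> bool"
  where "valid_in F A \<longleftrightarrow> (\<forall>h\<in>alg_hom \<PP> (Cm F). idents F \<subseteq> h A)"

definition left_reflection :: "'k frame \<Rightarrow> bool"
  where "left_reflection F \<longleftrightarrow> (\<forall>x\<in>points F. \<forall>y\<in>points F. \<forall>z\<in>points F.
    (x, y, z) \<in> rel F \<longrightarrow> (star F x, z, y) \<in> rel F)"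

definition right_reflection :: "'k frame \<Rightarrow> bool"
  where "right_reflection F \<longleftrightarrow> (\<forall>x\<in>points F. \<forall>y\<in>points F. \<forall>z\<in>points F.
    (x, y, z) \<in> rel F \<longrightarrow> (z, star F y, x) \<in> rel F)"

definition identity_cond :: "'k frame \<Rightarrow> bool"
  where "identity_cond F \<longleftrightarrow> (\<forall>x\<in>points F. \<forall>y\<in>points F.
    x = y \<longleftrightarrow> (\<exists>u\<in>idents F. (x, u, y) \<in> rel F))"

definition pasch_cond :: "'k frame \<Rightarrow> bool"
  where "pasch_cond F \<longleftrightarrow>
    (\<forall>v\<in>points F. \<forall>w\<in>points F. \<forall>y\<in>points F. \<forall>z\<in>points F.
      (\<exists>x\<in>points F. (v, w, x) \<in> rel F \<and> (x, y, z) \<in> rel F) \<longrightarrow>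
      (\<exists>u\<in>points F. (v, u, z) \<in> rel F \<and> (w, y, u) \<in> rel F))"

definition density_cond :: "'k frame \<Rightarrow> bool"
  where "density_cond F \<longleftrightarrow> (\<forall>x\<in>points F. (x, x, x) \<in> rel F)"

definition commutativity_cond :: "'k frame \<Rightarrow> bool"
  where "commutativity_cond F \<longleftrightarrow> (\<forall>x\<in>points F. \<forall>y\<in>points F. \<forall>z\<in>points F.
    (x, y, z) \<in> rel F \<longleftrightarrow> (y, x, z) \<in> rel F)"

definition symmetry_cond :: "'k frame \<Rightarrow> bool"
  where "symmetry_cond F \<longleftrightarrow> (\<forall>x\<in>points F. star F x = x)"

definition CR_star_frame :: "'k frame \<Rightarrow> bool"
  where "CR_star_frame F \<longleftrightarrow> is_frame F \<and>
    (\<exists>e\<in>points F. idents F = {e} \<and>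
      (\<forall>a\<in>points F. \<forall>b\<in>points F. (e, a, b) \<in> rel F \<longleftrightarrow> a = b)) \<and>
    (\<forall>a\<in>points F. \<forall>b\<in>points F. \<forall>c\<in>points F. \<forall>d\<in>points F.
      (\<exists>x\<in>points F. (a, b, x) \<in> rel F \<and> (x, c, d) \<in> rel F) \<longleftrightarrow>
      (\<exists>y\<in>points F. (a, c, y) \<in> rel F \<and> (y, b, d) \<in> rel F)) \<and>
    (\<forall>a\<in>points F. (a, a, a) \<in> rel F) \<and>
    (\<forall>a\<in>points F. star F (star F a) = a) \<and>
    (\<forall>a\<in>points F. \<forall>b\<in>points F. \<forall>c\<in>points F.
      (a, b, c) \<in> rel F \<longleftrightarrow> (a, star F c, star F b) \<in> rel F)"

definition KR_frame :: "'k frame \<Rightarrow> bool"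
  where "KR_frame F \<longleftrightarrow> CR_star_frame F \<and> symmetry_cond F"

text \<open>
  HOL cannot quantify over types inside a formula, so ``every frame'' and ``every relation
  algebra'' are relative to the type from which the elements are drawn; the carrier may be any
  subset of it. Failure of validity, and of truth of an equation, is witnessed in a countable
  structure, so every infinite type yields the same notions. A finite type need not, which is why
  the type argument of \<open>KR\<close> is meant to be infinite.
\<close>

definition KR :: "'k itself \<Rightarrow> predicate set"
  where "KR _ = {A. \<forall>F :: 'k frame. KR_frame F \<longrightarrow> valid_in F A}"


section \<open>Four-variable provability\<close>

datatype var = V0 | V1 | V2 | V3

datatype fm =
    Atom var predicate var
  | Equ eqn
  | FImp fm fm    (infixr \<open>\<^bold>\<rightarrow>\<close> 25)
  | FNot fm       (\<open>\<^bold>\<not> _\<close> [40] 40)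
  | FAll var fm

abbreviation FOr :: "fm \<Rightarrow> fm \<Rightarrow> fm"  (infixr \<open>\<^bold>\<or>\<close> 30)
  where "\<phi> \<^bold>\<or> \<psi> \<equiv> \<^bold>\<not> \<phi> \<^bold>\<rightarrow> \<psi>"

abbreviation FAnd :: "fm \<Rightarrow> fm \<Rightarrow> fm"  (infixr \<open>\<^bold>\<and>\<close> 35)
  where "\<phi> \<^bold>\<and> \<psi> \<equiv> \<^bold>\<not> (\<phi> \<^bold>\<rightarrow> \<^bold>\<not> \<psi>)"

abbreviation FIff :: "fm \<Rightarrow> fm \<Rightarrow> fm"  (infixr \<open>\<^bold>\<leftrightarrow>\<close> 25)
  where "\<phi> \<^bold>\<leftrightarrow> \<psi> \<equiv> (\<phi> \<^bold>\<rightarrow> \<psi>) \<^bold>\<and> (\<psi> \<^bold>\<rightarrow> \<phi>)"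

abbreviation FEx :: "var \<Rightarrow> fm \<Rightarrow> fm"
  where "FEx x \<phi> \<equiv> \<^bold>\<not> FAll x (\<^bold>\<not> \<phi>)"

primrec fv :: "fm \<Rightarrow> var set"
  where
    "fv (Atom x A y) = {x, y}"
  | "fv (Equ e) = {}"
  | "fv (\<phi> \<^bold>\<rightarrow> \<psi>) = fv \<phi> \<union> fv \<psi>"
  | "fv (\<^bold>\<not> \<phi>) = fv \<phi>"
  | "fv (FAll x \<phi>) = fv \<phi> - {x}"

text \<open>The free variables are quantified in the order of their indices, lowest outermost.\<close>

definition uclosure :: "fm \<Rightarrow> fm"
  where "uclosure \<phi> = foldr FAll (filter (\<lambda>x. x \<in> fv \<phi>) [V0, V1, V2, V3]) \<phi>"

primrec swap_vars :: "var \<Rightarrow> var \<Rightarrow> fm \<Rightarrow> fm"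
  where
    "swap_vars x y (Atom u A w) = Atom (transpose x y u) A (transpose x y w)"
  | "swap_vars x y (Equ e) = Equ e"
  | "swap_vars x y (\<phi> \<^bold>\<rightarrow> \<psi>) = (swap_vars x y \<phi> \<^bold>\<rightarrow> swap_vars x y \<psi>)"
  | "swap_vars x y (\<^bold>\<not> \<phi>) = (\<^bold>\<not> swap_vars x y \<phi>)"
  | "swap_vars x y (FAll z \<phi>) = FAll (transpose x y z) (swap_vars x y \<phi>)"

inductive_set axioms4 :: "fm set"
  where
    Ax1: "uclosure ((\<phi> \<^bold>\<rightarrow> \<psi>) \<^bold>\<rightarrow> ((\<psi> \<^bold>\<rightarrow> \<xi>) \<^bold>\<rightarrow> (\<phi> \<^bold>\<rightarrow> \<xi>))) \<in> axioms4"
  | Ax2: "uclosure ((\<^bold>\<not> \<phi> \<^bold>\<rightarrow> \<phi>) \<^bold>\<rightarrow> \<phi>) \<in> axioms4"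
  | Ax3: "uclosure (\<phi> \<^bold>\<rightarrow> (\<^bold>\<not> \<phi> \<^bold>\<rightarrow> \<psi>)) \<in> axioms4"
  | Ax4: "uclosure (FAll x (FAll y \<phi>) \<^bold>\<rightarrow> FAll y (FAll x \<phi>)) \<in> axioms4"
  | Ax5: "uclosure (FAll x (\<phi> \<^bold>\<rightarrow> \<psi>) \<^bold>\<rightarrow> (FAll x \<phi> \<^bold>\<rightarrow> FAll x \<psi>)) \<in> axioms4"
  | Ax6: "uclosure (FAll x \<phi> \<^bold>\<rightarrow> \<phi>) \<in> axioms4"
  | Ax7: "x \<notin> fv \<phi> \<Longrightarrow> uclosure (\<phi> \<^bold>\<rightarrow> FAll x \<phi>) \<in> axioms4"
  | Ax8: "x \<noteq> y \<Longrightarrow> uclosure (FEx x (Atom x \<^bold>1' y)) \<in> axioms4"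
  | Ax9: "uclosure (Atom x \<^bold>1' y \<^bold>\<rightarrow> (\<phi> \<^bold>\<rightarrow> swap_vars x y \<phi>)) \<in> axioms4"
  | Ax_sum: "uclosure (Atom V0 (A \<^bold>+ B) V1 \<^bold>\<leftrightarrow> Atom V0 A V1 \<^bold>\<or> Atom V0 B V1) \<in> axioms4"
  | Ax_compl: "uclosure (Atom V0 (\<^bold>- A) V1 \<^bold>\<leftrightarrow> \<^bold>\<not> Atom V0 A V1) \<in> axioms4"
  | Ax_comp: "uclosure (Atom V0 (A \<^bold>; B) V1 \<^bold>\<leftrightarrow> FEx V2 (Atom V0 A V2 \<^bold>\<and> Atom V2 B V1)) \<in> axioms4"
  | Ax_conv: "uclosure (Atom V0 (A\<^bold>\<smile>) V1 \<^bold>\<leftrightarrow> Atom V1 A V0) \<in> axioms4"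
  | Ax_eqn: "(Equ (A \<doteq> B) \<^bold>\<leftrightarrow> uclosure (Atom V0 A V1 \<^bold>\<leftrightarrow> Atom V0 B V1)) \<in> axioms4"

inductive prov4 :: "fm set \<Rightarrow> fm \<Rightarrow> bool"  (infix \<open>\<turnstile>\<^sub>4\<close> 15)
  for \<Psi> :: "fm set"
  where
    hyp: "\<phi> \<in> \<Psi> \<Longrightarrow> \<Psi> \<turnstile>\<^sub>4 \<phi>"
  | ax: "\<phi> \<in> axioms4 \<Longrightarrow> \<Psi> \<turnstile>\<^sub>4 \<phi>"
  | mp: "\<Psi> \<turnstile>\<^sub>4 \<phi> \<^bold>\<rightarrow> \<psi> \<Longrightarrow> \<Psi> \<turnstile>\<^sub>4 \<phi> \<Longrightarrow> \<Psi> \<turnstile>\<^sub>4 \<psi>"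

definition TR :: "predicate set"
  where "TR = {A. Equ ` (Xi_d \<union> Xi_c) \<turnstile>\<^sub>4 Equ (\<^bold>1' \<^bold>\<le> A)}"

end

theory Submission imports Defs "HOL-Library.Countable_Set" begin

text \<open>
  Everything is reduced to refutations of \<open>A\<close> at the identity point of a frame. A provable inclusion is
  valid in the frames because they carry enough four-point networks to interpret four-variable
  formulas. Conversely, a maximal consistent extension of the theory gives a Boolean preorder on
  predicates with composition and converse; so does a homomorphism into an integral dense relation
  algebra. In both cases the ultrafilters of the preorder form a frame, whose identity is a single
  point since \<open>1'\<close> is an atom by integrality. Finally, a refuting frame has a countable refuting
  subframe, and the values of the predicates in it form a countable refuting algebra, so that both
  can be moved to any infinite type.
\<close>

section \<open>Frames with one identity point\<close>

text \<open>Two obstacles shape the proof. First, a frame is not assumed to come from concrete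
  relations, so a formula cannot be evaluated by assigning elements to its variables. What remains
  possible is to assign points of the frame to pairs of variables. The Pasch condition, the frame
  form of associativity, is what this needs, and associativity is also the law whose derivation in
  the calculus takes a fourth variable. Second, the theory behind TR leaves open whether a given
  predicate is empty, so its inclusion preorder is not integral. A complete extension decides every
  such sentence, and commutativity then makes the preorder integral. No Henkin witnesses are added,
  since the ultrafilters supply all points. Moreover modus ponens is the only rule of the calculus,
  and generalization has to be derived before such extensions can be used. The symmetric half has no
  calculus: it rests on the fact that a KR-frame is an integral dense symmetric frame. Finally, the
  type \<open>predicate set\<close> of the canonical frames is uncountable while the target types
  may be countable, whence a downward Loewenheim-Skolem argument.\<close>

locale integral_frame =
  fixes F :: "'k frame" and e :: 'k
  assumes frame: "is_frame F"
    and idents: "idents F = {e}"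
    and left_refl: "left_reflection F"
    and right_refl: "right_reflection F"
    and identity: "identity_cond F"
    and pasch: "pasch_cond F"
begin

abbreviation R :: "'k \<Rightarrow> 'k \<Rightarrow> 'k \<Rightarrow> bool"
  where "R x y z \<equiv> (x, y, z) \<in> rel F"

lemma rel_points: "R x y z \<Longrightarrow> x \<in> points F \<and> y \<in> points F \<and> z \<in> points F"
  using frame unfolding is_frame_def by blast

lemma e_point [simp]: "e \<in> points F"
  using frame idents unfolding is_frame_def by blast

lemma star_point [simp]: "x \<in> points F \<Longrightarrow> star F x \<in> points F"
  using frame unfolding is_frame_def by blast

lemma rel_left: "R x y z \<Longrightarrow> R (star F x) z y"
  using left_refl rel_points unfolding left_reflection_def by blast

lemma rel_right: "R x y z \<Longrightarrow> R z (star F y) x"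
  using right_refl rel_points unfolding right_reflection_def by blast

lemma rel_ident_right: "R x e y \<longleftrightarrow> x = y \<and> x \<in> points F"
proof -
  have "x = y \<longleftrightarrow> R x e y" if "x \<in> points F" "y \<in> points F" for x y
    using identity idents that by (simp add: identity_cond_def)
  then show ?thesis
    using rel_points by blast
qed

lemma rel_pasch: "R v w x \<Longrightarrow> R x y z \<Longrightarrow> \<exists>u. R v u z \<and> R w y u"
  using pasch rel_points unfolding pasch_cond_def by meson

lemma star_star [simp]:
  assumes "x \<in> points F" shows "star F (star F x) = x"
proof -
  have "R (star F (star F x)) e x"
    using assms by (intro rel_left) (simp add: rel_ident_right)
  then show ?thesis
    by (simp add: rel_ident_right)
qed

lemma star_e [simp]: "star F e = e"
proof -
  have "R (star F e) e e"
    by (intro rel_left) (simp add: rel_ident_right)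
  then show ?thesis
    by (simp add: rel_ident_right)
qed

text \<open>Left, right and left reflection in turn reverse a triple; this is the law for the
  converse of a product.\<close>

lemma rel_star: "R x y z \<Longrightarrow> R (star F y) (star F x) (star F z)"
  by (metis rel_left rel_right)

lemma rel_ident_left: "R e x y \<longleftrightarrow> x = y \<and> x \<in> points F"
  by (metis rel_ident_right rel_points rel_star star_e star_star)

text \<open>Pasch is one inclusion of associativity. Reversing both triples by
  \<open>rel_star\<close>, applying Pasch and reversing back yields the other inclusion.\<close>

lemma rel_pasch_converse:
  assumes "R v u z" "R w y u" shows "\<exists>t. R v w t \<and> R t y z"
proof -
  obtain t where t: "R (star F y) t (star F z)" "R (star F w) (star F v) t"
    using rel_pasch[OF rel_star[OF assms(2)] rel_star[OF assms(1)]] by blast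
  have "R (star F t) y z" "R v w (star F t)"
    using rel_star[OF t(1)] rel_star[OF t(2)] rel_points[OF assms(1)] rel_points[OF assms(2)]
    by auto
  then show ?thesis by blast
qed

text \<open>The triples \<open>R (star F a) a e\<close> and \<open>R e b b\<close> meet at
  \<open>e\<close>, and Pasch re-brackets them. This is the source of integrality of the complex
  algebra.\<close>

lemma rel_serial:
  assumes "a \<in> points F" "b \<in> points F" shows "\<exists>c. R a b c"
proof -
  have "R (star F a) a e"
    using assms by (intro rel_left) (simp add: rel_ident_right)
  moreover have "R e b b"
    using assms by (simp add: rel_ident_left)
  ultimately show ?thesis
    using rel_pasch by blast
qed

end

section \<open>Soundness of the four-variable calculus\<close>

lemma var_UNIV: "UNIV = {V0, V1, V2, V3}"
  using var.exhaust by auto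

section \<open>Networks over a frame and their extension\<close>

context integral_frame
begin

text \<open>Four-variable formulas are interpreted in the four-dimensional networks over the frame: the Pasch
  condition says exactly that such networks can be amalgamated, as Ax4 and Ax7 require.\<close>

definition net :: "(var \<Rightarrow> var \<Rightarrow> 'k) \<Rightarrow> bool"
  where "net N \<longleftrightarrow> (\<forall>x. N x x = e) \<and> (\<forall>x y z. R (N x y) (N y z) (N x z))"

definition agree_off :: "var \<Rightarrow> (var \<Rightarrow> var \<Rightarrow> 'k) \<Rightarrow> (var \<Rightarrow> var \<Rightarrow> 'k) \<Rightarrow> bool"
  where "agree_off x N M \<longleftrightarrow> (\<forall>u w. u \<noteq> x \<longrightarrow> w \<noteq> x \<longrightarrow> N u w = M u w)"

lemma net_diag: "net N \<Longrightarrow> N x x = e"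
  by (simp add: net_def)

lemma net_rel: "net N \<Longrightarrow> R (N x y) (N y z) (N x z)"
  by (simp add: net_def)

lemma net_point: "net N \<Longrightarrow> N x y \<in> points F"
  using net_rel rel_points by blast

lemma net_star: "net N \<Longrightarrow> star F (N x y) = N y x"
  using rel_left[OF net_rel[of N x y x]] by (simp add: net_diag rel_ident_right)

text \<open>\<open>f s\<close> labels the edge from the new point at \<open>x\<close> to
  \<open>s\<close>; the opposite edge must carry its \<open>star\<close>, as \<open>net_star\<close>
  demands.\<close>

definition replace_point :: "(var \<Rightarrow> var \<Rightarrow> 'k) \<Rightarrow> var \<Rightarrow> (var \<Rightarrow> 'k) \<Rightarrow> var \<Rightarrow> var \<Rightarrow> 'k"
  where "replace_point N x f s t =
    (if s = x then if t = x then e else f t else if t = x then star F (f s) else N s t)"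

lemma agree_off_replace_point: "agree_off x N (replace_point N x f)"
  by (simp add: agree_off_def replace_point_def)

text \<open>Only triangles starting at \<open>x\<close> need checking: the reflections turn such a
  triple into the triangles with \<open>x\<close> in the middle or at the end, and triangles
  avoiding \<open>x\<close> come from \<open>N\<close>.\<close>

lemma net_replace_point:
  assumes N: "net N" and f: "\<And>u v. u \<noteq> x \<Longrightarrow> v \<noteq> x \<Longrightarrow> R (f u) (N u v) (f v)"
  shows "net (replace_point N x f)"
proof -
  let ?M = "replace_point N x f"
  have pt: "f u \<in> points F" if "u \<noteq> x" for u
    using f[OF that that] rel_points by blast
  have "R (?M s t) (?M t w) (?M s w)" for s t w
  proof -
    have "R (star F (f s)) (f w) (N s w)" if "s \<noteq> x" "w \<noteq> x"
      using rel_left[OF f[OF that]] .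
    moreover have "R (f t) (star F (f t)) e" if "t \<noteq> x"
      using rel_right[of e "f t" "f t"] pt[OF that] by (simp add: rel_ident_left)
    moreover have "R (N s t) (star F (f t)) (star F (f s))" if "s \<noteq> x" "t \<noteq> x"
      using rel_star[OF f[OF that(2,1)]] net_star[OF N] by simp
    ultimately show ?thesis
      using f net_rel[OF N] pt
      by (auto simp: replace_point_def rel_ident_left rel_ident_right)
  qed
  moreover have "?M s s = e" for s
    using net_diag[OF N] by (simp add: replace_point_def)
  ultimately show ?thesis
    unfolding net_def by blast
qed

lemma fourth_var: "\<exists>w :: var. w \<noteq> x \<and> w \<noteq> y \<and> w \<noteq> z"
  by (metis var.distinct)

lemma var_cases4:
  fixes x y z w t :: var
  assumes "distinct [x, y, z, w]" shows "t = x \<or> t = y \<or> t = z \<or> t = w"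
proof -
  have "{x, y, z, w} = UNIV"
    using assms by (intro card_eq_UNIV_imp_eq_UNIV) (simp_all add: var_UNIV)
  then show ?thesis
    by blast
qed

text \<open>Three triangles over the vertices other than \<open>x\<close> suffice: reading an edge
  backwards is \<open>flip\<close>, and a degenerate edge, labelled \<open>e\<close>, is
  \<open>refl\<close>.\<close>

lemma rel_triples:
  assumes N: "net N" and d: "distinct [x, y, z, w]"
    and yz: "R (f y) (N y z) (f z)" and zw: "R (f z) (N z w) (f w)"
    and yw: "R (f y) (N y w) (f w)"
    and "u \<noteq> x" "v \<noteq> x"
  shows "R (f u) (N u v) (f v)"
proof -
  have flip: "R (f t) (N t s) (f s)" if "R (f s) (N s t) (f t)" for s t
    using rel_right[OF that] net_star[OF N] by simp
  have refl: "R (f s) (N s s) (f s)" if "R (f s) (N s t) (f t)" for s t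
    using rel_points[OF that] net_diag[OF N] by (simp add: rel_ident_right)
  show ?thesis
    using var_cases4[OF d, of u] var_cases4[OF d, of v] assms flip refl by metis
qed

text \<open>This supplies the intermediate point of a composition. The one undetermined edge joins
  the new point to the fourth vertex \<open>w\<close>; Pasch, applied to
  \<open>R a b (N y z)\<close> and the triangle on \<open>y\<close>, \<open>z\<close>,
  \<open>w\<close>, provides its label \<open>u\<close>.\<close>

lemma net_extend:
  assumes N: "net N" and d: "distinct [x, y, z]" and ab: "R a b (N y z)"
  shows "\<exists>M. net M \<and> agree_off x N M \<and> M y x = a \<and> M x z = b"
proof -
  obtain w where "w \<noteq> x" "w \<noteq> y" "w \<noteq> z"
    using fourth_var by blast
  with d have w: "distinct [x, y, z, w]"
    by auto
  obtain u where u: "R a u (N y w)" "R b (N z w) u"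
    using rel_pasch[OF ab net_rel[OF N]] by blast
  \<comment> \<open>\<open>a\<close> labels the edge from \<open>y\<close> to the new point, so seen
    from the new point this edge is \<open>star F a\<close>.\<close>
  define f where "f = (\<lambda>t. if t = y then star F a else if t = z then b else u)"
  have "net (replace_point N x f)"
  proof (rule net_replace_point[OF N])
    have "f y = star F a" "f z = b" "f w = u"
      using w by (auto simp: f_def)
    then have "R (f y) (N y z) (f z)" "R (f z) (N z w) (f w)" "R (f y) (N y w) (f w)"
      using rel_left[OF ab] rel_left[OF u(1)] u(2) by simp_all
    then show "R (f s) (N s t) (f t)" if "s \<noteq> x" "t \<noteq> x" for s t
      using rel_triples[where f = f, OF N w] that by blast
  qed
  moreover have "replace_point N x f y x = a" "replace_point N x f x z = b"
    using d rel_points[OF ab] by (auto simp: replace_point_def f_def)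
  ultimately show ?thesis
    using agree_off_replace_point by blast
qed

text \<open>A move of \<open>x\<close> followed by a move of \<open>y\<close> is redone in the
  opposite order. All edges of \<open>Q\<close> are inherited except the one between the old
  \<open>x\<close> and the new \<open>y\<close>; its triangles with the remaining vertices
  \<open>z\<close> and \<open>w\<close> ask for the label \<open>k\<close> found by
  \<open>rel_pasch_converse\<close>.\<close>

lemma net_amalgamate:
  assumes N: "net N" and M: "net M" and P: "net P" and "x \<noteq> y"
    and NM: "agree_off x N M" and MP: "agree_off y M P"
  shows "\<exists>Q. net Q \<and> agree_off y N Q \<and> agree_off x Q P"
proof -
  obtain z where z: "z \<noteq> x" "z \<noteq> y"
    using fourth_var[of x y y] by auto
  obtain w where "w \<noteq> x" "w \<noteq> y" "w \<noteq> z"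
    using fourth_var by blast
  then have d: "distinct [y, x, z, w]"
    using z \<open>x \<noteq> y\<close> by auto
  have NP: "N z w = P z w" "N w z = P w z" "N z z = P z z" "N w w = P w w"
    using NM MP d by (auto simp: agree_off_def)
  obtain k where k: "R (P y z) (N z x) k" "R k (N x w) (P y w)"
    using rel_pasch_converse[OF net_rel[OF P, of y z w]] net_rel[OF N, of z x w] NP by metis
  define f where "f = (\<lambda>t. if t = x then k else P y t)"
  have "net (replace_point N y f)"
  proof (rule net_replace_point[OF N])
    have "f x = k" "f z = P y z" "f w = P y w"
      using d by (auto simp: f_def)
    then have "R (f x) (N x z) (f z)" "R (f z) (N z w) (f w)" "R (f x) (N x w) (f w)"
      using k(2) rel_right[OF k(1)] net_star[OF N] net_rel[OF P, of y z w] NP by simp_all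
    then show "R (f s) (N s t) (f t)" if "s \<noteq> y" "t \<noteq> y" for s t
      using rel_triples[where f = f, OF N d] that by blast
  qed
  moreover have "agree_off x (replace_point N y f) P"
    unfolding agree_off_def
  proof (intro allI impI)
    fix s t assume st: "s \<noteq> x" "t \<noteq> x"
    have "N s t = P s t" if "s \<noteq> y" "t \<noteq> y"
      using NM MP st that by (simp add: agree_off_def)
    then show "replace_point N y f s t = P s t"
      using st net_star[OF P] net_diag[OF P] by (auto simp: replace_point_def f_def)
  qed
  ultimately show ?thesis
    using agree_off_replace_point by blast
qed

section \<open>Satisfaction of four-variable formulas in a network\<close>

primrec sat :: "(predicate \<Rightarrow> 'k set) \<Rightarrow> (var \<Rightarrow> var \<Rightarrow> 'k) \<Rightarrow> fm \<Rightarrow> bool"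
  where
    "sat h N (Atom x A y) \<longleftrightarrow> N x y \<in> h A"
  | "sat h N (Equ E) \<longleftrightarrow> (case E of A \<doteq> B \<Rightarrow> h A = h B)"
  | "sat h N (\<phi> \<^bold>\<rightarrow> \<psi>) \<longleftrightarrow> (sat h N \<phi> \<longrightarrow> sat h N \<psi>)"
  | "sat h N (\<^bold>\<not> \<phi>) \<longleftrightarrow> \<not> sat h N \<phi>"
  | "sat h N (FAll x \<phi>) \<longleftrightarrow> (\<forall>M. net M \<longrightarrow> agree_off x N M \<longrightarrow> sat h M \<phi>)"

lemma agree_off_sym: "agree_off x N M \<Longrightarrow> agree_off x M N"
  by (simp add: agree_off_def)

lemma agree_off_refl: "agree_off x N N"
  by (simp add: agree_off_def)

lemma agree_off_trans: "agree_off x N M \<Longrightarrow> agree_off x M P \<Longrightarrow> agree_off x N P"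
  by (simp add: agree_off_def)

text \<open>For a quantified variable \<open>y\<close> other than \<open>x\<close>, a move of
  \<open>y\<close> in \<open>M\<close> has to be imitated in \<open>N\<close>.
  \<open>net_amalgamate\<close> supplies the network in which \<open>y\<close> moves first, and the
  induction hypothesis absorbs the remaining move of \<open>x\<close>.\<close>

lemma sat_fresh:
  "net N \<Longrightarrow> net M \<Longrightarrow> agree_off x N M \<Longrightarrow> x \<notin> fv \<phi> \<Longrightarrow> sat h N \<phi> \<longleftrightarrow> sat h M \<phi>"
proof (induction \<phi> arbitrary: N M)
  case (FAll y \<phi>)
  have imp: "sat h M (FAll y \<phi>)"
    if N: "net N" and M: "net M" and NM: "agree_off x N M" and sat: "sat h N (FAll y \<phi>)" for N M
  proof (cases "x = y")
    case True
    then show ?thesis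
      using NM sat by (meson agree_off_trans sat.simps(5))
  next
    case False
    have "sat h P \<phi>" if P: "net P" "agree_off y M P" for P
    proof -
      obtain Q where Q: "net Q" "agree_off y N Q" "agree_off x Q P"
        using net_amalgamate[OF N M P(1) False NM P(2)] by blast
      then have "sat h Q \<phi>"
        using sat by simp
      then show ?thesis
        using FAll.IH[OF Q(1) P(1) Q(3)] FAll.prems(4) False by simp
    qed
    then show ?thesis
      by simp
  qed
  show ?case
    using imp FAll.prems(1-3) agree_off_sym by blast
next
  case (FImp \<phi> \<psi>)
  then show ?case
    by (metis UnCI fv.simps(3) sat.simps(3))
next
  case (FNot \<phi>)
  then show ?case
    by (metis fv.simps(4) sat.simps(4))
qed (auto simp: agree_off_def)

abbreviation swap_net :: "var \<Rightarrow> var \<Rightarrow> (var \<Rightarrow> var \<Rightarrow> 'k) \<Rightarrow> var \<Rightarrow> var \<Rightarrow> 'k"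
  where "swap_net x y N \<equiv> \<lambda>u w. N (transpose x y u) (transpose x y w)"

lemma net_swap: "net N \<Longrightarrow> net (swap_net x y N)"
  by (simp add: net_def)

lemma agree_off_swap: "agree_off z N M \<Longrightarrow> agree_off (transpose x y z) (swap_net x y N) (swap_net x y M)"
  unfolding agree_off_def by (metis transpose_involutory)

lemma sat_swap: "sat h N (swap_vars x y \<phi>) \<longleftrightarrow> sat h (swap_net x y N) \<phi>"
proof (induction \<phi> arbitrary: N)
  case (FAll z \<phi>)
  have "(\<forall>M. net M \<longrightarrow> agree_off (transpose x y z) N M \<longrightarrow> sat h (swap_net x y M) \<phi>) \<longleftrightarrow>
    (\<forall>M. net M \<longrightarrow> agree_off z (swap_net x y N) M \<longrightarrow> sat h M \<phi>)" (is "?l \<longleftrightarrow> ?r")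
  proof
    assume ?l
    show ?r
    proof (intro allI impI)
      fix M assume M: "net M" "agree_off z (swap_net x y N) M"
      have "sat h (swap_net x y (swap_net x y M)) \<phi>"
        using \<open>?l\<close>[rule_format, of "swap_net x y M"] net_swap[OF M(1), of x y]
          agree_off_swap[OF M(2), of x y] by simp
      then show "sat h M \<phi>" by simp
    qed
  next
    assume ?r
    then show ?l
      using net_swap agree_off_swap[where z = "transpose x y z" and x = x and y = y] by auto
  qed
  then show ?case
    using FAll.IH by simp
qed auto

text \<open>A label \<open>e\<close> identifies two vertices: in each triangle over that edge the
  other two labels coincide. This is the soundness of Ax9.\<close>

lemma swap_net_ident:
  assumes N: "net N" and "N x y = e" shows "swap_net x y N = N"
proof -
  have xy: "N x z = N y z" for z
    using net_rel[OF N, of x y z] assms(2) by (simp add: rel_ident_left)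
  then have left: "N (transpose x y u) z = N u z" for u z
    by (simp add: transpose_def)
  then have "N z (transpose x y u) = N z u" for u z
    by (metis net_star[OF N])
  then show ?thesis
    using left by presburger
qed

text \<open>Needed for Ax_eqn: equality of values concerns all points, while a formula sees only
  points labelling an edge. \<open>rel_serial\<close> gives a triangle with the prescribed
  edge.\<close>

lemma net_all_pairs:
  assumes N: "net N" and k: "k \<in> points F"
  shows "\<exists>M. net M \<and> agree_off V1 N M \<and> M V0 V1 = k"
proof -
  obtain b where "R (star F k) (N V0 V2) b"
    using rel_serial net_point[OF N] k by (meson star_point)
  then have "R k b (N V0 V2)"
    using rel_left k by fastforce
  then show ?thesis
    using net_extend[OF N, of V1 V0 V2 k b] by auto
qed

lemma sat_uclosure:
  assumes "\<And>N. net N \<Longrightarrow> sat h N \<phi>" "net N" shows "sat h N (uclosure \<phi>)"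
proof -
  have "\<forall>N. net N \<longrightarrow> sat h N (foldr FAll s \<phi>)" for s
    by (induction s) (auto simp: assms(1))
  then show ?thesis
    using assms(2) by (simp add: uclosure_def)
qed

lemma alg_hom_Cm:
  "h \<in> alg_hom \<PP> (Cm F) \<longleftrightarrow>
    (\<forall>A. h A \<subseteq> points F) \<and> (\<forall>A B. h (A \<^bold>+ B) = h A \<union> h B) \<and> (\<forall>A. h (\<^bold>- A) = points F - h A) \<and>
    (\<forall>A B. h (A \<^bold>; B) = {z. \<exists>x\<in>h A. \<exists>y\<in>h B. R x y z}) \<and>
    (\<forall>A. h (A\<^bold>\<smile>) = star F ` h A) \<and> h \<^bold>1' = {e}"
  unfolding alg_hom_def by (simp add: pred_alg_def Cm_def idents Setcompr_eq_image)

lemma sat_axiom: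
  assumes h: "h \<in> alg_hom \<PP> (Cm F)" and "\<phi> \<in> axioms4" "net N"
  shows "sat h N \<phi>"
  using assms(2,3)
proof (induction arbitrary: N)
  case (Ax4 x y \<phi>)
  have "sat h P \<phi>" if "sat h N (FAll x (FAll y \<phi>))" "net N" "net M" "agree_off y N M"
    "net P" "agree_off x M P" for N M P
  proof (cases "x = y")
    case True
    then show ?thesis
      using that agree_off_trans[of x N M P] agree_off_refl[of x P] by auto
  next
    case False
    then show ?thesis
      using net_amalgamate[of N M P y x] that by auto
  qed
  then show ?case
    using Ax4 by (intro sat_uclosure; simp; blast)
next
  case (Ax7 x \<phi>)
  then show ?case
    using sat_fresh[where h = h] by (intro sat_uclosure; simp; blast)
next
  case (Ax8 x y)
  have "\<exists>M. net M \<and> agree_off x N M \<and> M x y = e" if N: "net N" for N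
  proof (intro exI conjI)
    \<comment> \<open>Witness: \<open>x\<close> becomes a second copy of \<open>y\<close>, with the
      edges of \<open>y\<close> to all other vertices.\<close>
    show "net (replace_point N x (N y))"
      using net_replace_point[OF N] net_rel[OF N] by blast
  qed (use Ax8 net_diag[OF N] agree_off_replace_point in \<open>auto simp: replace_point_def\<close>)
  then show ?case
    using Ax8 h by (intro sat_uclosure) (auto simp: alg_hom_Cm)
next
  case (Ax9 x y \<phi>)
  then show ?case
    using h by (intro sat_uclosure; simp add: alg_hom_Cm sat_swap swap_net_ident)
next
  case (Ax_compl A)
  then show ?case
    using h by (intro sat_uclosure) (auto simp: alg_hom_Cm net_point)
next
  case (Ax_comp A B)
  have "N V0 V1 \<in> h (A \<^bold>; B) \<longleftrightarrow> (\<exists>M. net M \<and> agree_off V2 N M \<and> M V0 V2 \<in> h A \<and> M V2 V1 \<in> h B)"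
    (is "_ \<longleftrightarrow> ?r") if N: "net N" for N
  proof
    assume "N V0 V1 \<in> h (A \<^bold>; B)"
    then obtain a b where "a \<in> h A" "b \<in> h B" "R a b (N V0 V1)"
      using h by (auto simp: alg_hom_Cm)
    then show ?r
      using net_extend[OF N, of V2 V0 V1 a b] by auto
  next
    assume ?r
    then obtain M where M: "net M" "agree_off V2 N M" "M V0 V2 \<in> h A" "M V2 V1 \<in> h B"
      by blast
    have "R (M V0 V2) (M V2 V1) (N V0 V1)"
      using net_rel[OF M(1), of V0 V2 V1] M(2) by (simp add: agree_off_def)
    then show "N V0 V1 \<in> h (A \<^bold>; B)"
      using M h by (auto simp: alg_hom_Cm)
  qed
  then show ?case
    using Ax_comp by (intro sat_uclosure) auto
next
  case (Ax_conv A)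
  have "N V0 V1 \<in> h (A\<^bold>\<smile>) \<longleftrightarrow> N V1 V0 \<in> h A" if N: "net N" for N
  proof
    assume "N V0 V1 \<in> h (A\<^bold>\<smile>)"
    then obtain a where "N V0 V1 = star F a" "a \<in> h A"
      using h by (auto simp: alg_hom_Cm)
    moreover from \<open>a \<in> h A\<close> have "a \<in> points F"
      using h by (auto simp: alg_hom_Cm)
    ultimately show "N V1 V0 \<in> h A"
      using net_star[OF N, of V0 V1] by simp
  next
    assume "N V1 V0 \<in> h A"
    then show "N V0 V1 \<in> h (A\<^bold>\<smile>)"
      using net_star[OF N, of V1 V0, symmetric] h by (auto simp: alg_hom_Cm)
  qed
  then show ?case
    using Ax_conv by (intro sat_uclosure) auto
next
  case (Ax_eqn A B)
  have "h A = h B" if all: "\<forall>M. net M \<longrightarrow> agree_off V0 N M \<longrightarrow>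
      (\<forall>P. net P \<longrightarrow> agree_off V1 M P \<longrightarrow> (P V0 V1 \<in> h A) = (P V0 V1 \<in> h B))"
  proof -
    have "k \<in> h A \<longleftrightarrow> k \<in> h B" if "k \<in> points F" for k
      using net_all_pairs[OF Ax_eqn that] all Ax_eqn agree_off_refl by blast
    moreover have "h A \<subseteq> points F" "h B \<subseteq> points F"
      using h by (auto simp: alg_hom_Cm)
    ultimately show ?thesis
      by blast
  qed
  then have "h A = h B \<longleftrightarrow> (\<forall>M. net M \<longrightarrow> agree_off V0 N M \<longrightarrow>
      (\<forall>P. net P \<longrightarrow> agree_off V1 M P \<longrightarrow> P V0 V1 \<in> h A \<longleftrightarrow> P V0 V1 \<in> h B))"
    by blast
  moreover have "sat h N (Equ (A \<doteq> B) \<^bold>\<leftrightarrow> \<phi>) \<longleftrightarrow> (h A = h B \<longleftrightarrow> sat h N \<phi>)" for \<phi>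
    by auto
  moreover have "sat h P (\<phi> \<^bold>\<leftrightarrow> \<psi>) \<longleftrightarrow> (sat h P \<phi> \<longleftrightarrow> sat h P \<psi>)" for \<phi> \<psi> P
    by auto
  ultimately show ?case
    by (simp add: uclosure_def del: sat.simps(3,4))
next
  case (Ax6 x \<phi>)
  then show ?case
    by (intro sat_uclosure) (auto intro: agree_off_refl)
next
  case (Ax_sum A B)
  then show ?case
    using h by (intro sat_uclosure) (auto simp: alg_hom_Cm)
qed (rule sat_uclosure; simp)+

lemma prov4_sound:
  assumes "\<Psi> \<turnstile>\<^sub>4 \<phi>" and h: "h \<in> alg_hom \<PP> (Cm F)"
    and "\<And>\<psi> N. \<psi> \<in> \<Psi> \<Longrightarrow> net N \<Longrightarrow> sat h N \<psi>"
  shows "net N \<Longrightarrow> sat h N \<phi>"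
  using assms(1)
proof (induction arbitrary: N)
  case (ax \<phi>)
  then show ?case
    using sat_axiom[OF h] by blast
qed (use assms(3) in auto)

lemma TR_valid:
  assumes "A \<in> TR" and "density_cond F" and "commutativity_cond F"
  shows "valid_in F A"
  unfolding valid_in_def
proof
  fix h assume h: "h \<in> alg_hom \<PP> (Cm F)"
  \<comment> \<open>Equations do not look at the network, so any one will do; the degenerate network
    always exists.\<close>
  have net: "net (\<lambda>_ _. e)"
    by (simp add: net_def rel_ident_left)
  have "sat h N \<psi>" if "\<psi> \<in> Equ ` (Xi_d \<union> Xi_c)" for \<psi> N
  proof -
    from that consider B where "\<psi> = Equ (B \<^bold>\<le> B \<^bold>; B)" | B C where "\<psi> = Equ (B \<^bold>; C \<doteq> C \<^bold>; B)"
      by (auto simp: Xi_d_def Xi_c_def)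
    then show ?thesis
    proof cases
      case 1
      have "h B \<subseteq> h (B \<^bold>; B)"
      proof -
        have "h B \<subseteq> points F" "h (B \<^bold>; B) = {z. \<exists>x\<in>h B. \<exists>y\<in>h B. R x y z}"
          using h by (simp_all add: alg_hom_Cm)
        then show ?thesis
          using assms(2) unfolding density_cond_def by blast
      qed
      then show ?thesis
        using 1 h by (auto simp: ineq_def alg_hom_Cm)
    next
      case 2
      have "R x y z \<longleftrightarrow> R y x z" for x y z
        using assms(3) rel_points unfolding commutativity_cond_def by blast
      moreover have "h (B \<^bold>; C) = {z. \<exists>x\<in>h B. \<exists>y\<in>h C. R x y z}"
        "h (C \<^bold>; B) = {z. \<exists>x\<in>h C. \<exists>y\<in>h B. R x y z}"
        using h by (simp_all add: alg_hom_Cm)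
      ultimately have "h (B \<^bold>; C) = h (C \<^bold>; B)"
        by blast
      then show ?thesis
        using 2 by simp
    qed
  qed
  then have "sat h (\<lambda>_ _. e) (Equ (\<^bold>1' \<^bold>\<le> A))"
    using prov4_sound[OF _ h _ net] assms(1) unfolding TR_def by blast
  then show "idents F \<subseteq> h A"
    using h by (auto simp: ineq_def alg_hom_Cm idents)
qed

end

text \<open>The conditions of (c) shared by both halves of the theorem.\<close>

definition integral_dense_frame :: "'k frame \<Rightarrow> bool"
  where "integral_dense_frame F \<longleftrightarrow> is_frame F \<and> card (idents F) = 1 \<and> left_reflection F \<and>
    right_reflection F \<and> identity_cond F \<and> pasch_cond F \<and> density_cond F"

section \<open>The canonical frame of a relational entailment\<close>

abbreviation PMeet :: "predicate \<Rightarrow> predicate \<Rightarrow> predicate"  (infixl \<open>\<^bold>\<sqinter>\<close> 68)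
  where "A \<^bold>\<sqinter> B \<equiv> \<^bold>- (\<^bold>- A \<^bold>+ \<^bold>- B)"

abbreviation PBot :: predicate  (\<open>\<^bold>\<bottom>\<close>)
  where "\<^bold>\<bottom> \<equiv> \<^bold>- (\<^bold>1' \<^bold>+ \<^bold>- \<^bold>1')"

text \<open>The laws that both sources, provability and a homomorphism, can supply. Predicates are
  terms, so laws hold up to mutual entailment and no quotient is formed. The stated inclusion of
  associativity is the one behind Pasch for ultrafilters.\<close>

locale entailment =
  fixes le :: "predicate \<Rightarrow> predicate \<Rightarrow> bool"  (infix \<open>\<sqsubseteq>\<close> 50)
  assumes le_refl: "A \<sqsubseteq> A"
    and le_trans: "A \<sqsubseteq> B \<Longrightarrow> B \<sqsubseteq> C \<Longrightarrow> A \<sqsubseteq> C"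
    and sum_ub1: "A \<sqsubseteq> A \<^bold>+ B"
    and sum_ub2: "B \<sqsubseteq> A \<^bold>+ B"
    and sum_lub: "A \<sqsubseteq> C \<Longrightarrow> B \<sqsubseteq> C \<Longrightarrow> A \<^bold>+ B \<sqsubseteq> C"
    and meet_lb1: "A \<^bold>\<sqinter> B \<sqsubseteq> A"
    and meet_lb2: "A \<^bold>\<sqinter> B \<sqsubseteq> B"
    and meet_glb: "C \<sqsubseteq> A \<Longrightarrow> C \<sqsubseteq> B \<Longrightarrow> C \<sqsubseteq> A \<^bold>\<sqinter> B"
    and by_cases: "C \<^bold>\<sqinter> A \<sqsubseteq> B \<Longrightarrow> C \<^bold>\<sqinter> \<^bold>- A \<sqsubseteq> B \<Longrightarrow> C \<sqsubseteq> B"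
    and contradiction: "A \<^bold>\<sqinter> \<^bold>- A \<sqsubseteq> B"
    and comp_mono: "A \<sqsubseteq> A' \<Longrightarrow> B \<sqsubseteq> B' \<Longrightarrow> A \<^bold>; B \<sqsubseteq> A' \<^bold>; B'"
    and comp_sum_left: "(A \<^bold>+ B) \<^bold>; C \<sqsubseteq> A \<^bold>; C \<^bold>+ B \<^bold>; C"
    and comp_sum_right: "A \<^bold>; (B \<^bold>+ C) \<sqsubseteq> A \<^bold>; B \<^bold>+ A \<^bold>; C"
    and comp_bot_left: "\<^bold>\<bottom> \<^bold>; A \<sqsubseteq> \<^bold>\<bottom>"
    and comp_bot_right: "A \<^bold>; \<^bold>\<bottom> \<sqsubseteq> \<^bold>\<bottom>"
    and comp_assoc: "(A \<^bold>; B) \<^bold>; C \<sqsubseteq> A \<^bold>; (B \<^bold>; C)"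
    and comp_ident1: "A \<^bold>; \<^bold>1' \<sqsubseteq> A"
    and comp_ident2: "A \<sqsubseteq> A \<^bold>; \<^bold>1'"
    and ident_comp: "\<^bold>1' \<^bold>; A \<sqsubseteq> A"
    and conv_mono: "A \<sqsubseteq> B \<Longrightarrow> A\<^bold>\<smile> \<sqsubseteq> B\<^bold>\<smile>"
    and conv_conv1: "A\<^bold>\<smile>\<^bold>\<smile> \<sqsubseteq> A"
    and conv_conv2: "A \<sqsubseteq> A\<^bold>\<smile>\<^bold>\<smile>"
    and residual_left: "A\<^bold>\<smile> \<^bold>; \<^bold>- (A \<^bold>; B) \<sqsubseteq> \<^bold>- B"
    and residual_right: "\<^bold>- (A \<^bold>; B) \<^bold>; B\<^bold>\<smile> \<sqsubseteq> \<^bold>- A"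
    and integral: "A \<^bold>; B \<sqsubseteq> \<^bold>\<bottom> \<Longrightarrow> A \<sqsubseteq> \<^bold>\<bottom> \<or> B \<sqsubseteq> \<^bold>\<bottom>"
    and dense: "A \<sqsubseteq> A \<^bold>; A"
begin

lemma meet_mono: "A \<sqsubseteq> A' \<Longrightarrow> B \<sqsubseteq> B' \<Longrightarrow> A \<^bold>\<sqinter> B \<sqsubseteq> A' \<^bold>\<sqinter> B'"
  by (meson le_trans meet_glb meet_lb1 meet_lb2)

lemma sum_mono: "A \<sqsubseteq> A' \<Longrightarrow> B \<sqsubseteq> B' \<Longrightarrow> A \<^bold>+ B \<sqsubseteq> A' \<^bold>+ B'"
  by (meson le_trans sum_lub sum_ub1 sum_ub2)

lemma meet_commute: "A \<^bold>\<sqinter> B \<sqsubseteq> B \<^bold>\<sqinter> A"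
  by (simp add: meet_glb meet_lb1 meet_lb2)

lemma bot_least: "\<^bold>\<bottom> \<sqsubseteq> C"
proof -
  have "\<^bold>\<bottom> \<^bold>\<sqinter> X \<sqsubseteq> C" if "X \<sqsubseteq> \<^bold>1' \<^bold>+ \<^bold>- \<^bold>1'" for X
    by (meson contradiction le_trans le_refl meet_commute meet_mono that)
  then show ?thesis
    using by_cases sum_ub1 sum_ub2 by blast
qed

lemma excluded_middle: "C \<sqsubseteq> A \<^bold>+ \<^bold>- A"
  by (meson by_cases le_trans meet_lb2 sum_ub1 sum_ub2)

lemma compl_compl: "A \<sqsubseteq> \<^bold>- (\<^bold>- A)"
  by (meson by_cases contradiction meet_lb2)

section \<open>Filters and ultrafilters of predicates\<close>

definition filt :: "predicate set \<Rightarrow> bool"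
  where "filt p \<longleftrightarrow> p \<noteq> {} \<and> (\<forall>A\<in>p. \<forall>B. A \<sqsubseteq> B \<longrightarrow> B \<in> p) \<and> (\<forall>A\<in>p. \<forall>B\<in>p. A \<^bold>\<sqinter> B \<in> p)"

definition ultra :: "predicate set \<Rightarrow> bool"
  where "ultra p \<longleftrightarrow> filt p \<and> (\<forall>A. \<^bold>- A \<in> p \<longleftrightarrow> A \<notin> p)"

lemma filt_up: "filt p \<Longrightarrow> A \<in> p \<Longrightarrow> A \<sqsubseteq> B \<Longrightarrow> B \<in> p"
  unfolding filt_def by blast

lemma filt_meet: "filt p \<Longrightarrow> A \<in> p \<Longrightarrow> B \<in> p \<Longrightarrow> A \<^bold>\<sqinter> B \<in> p"
  unfolding filt_def by blast

lemma filt_top: "filt p \<Longrightarrow> A \<^bold>+ \<^bold>- A \<in> p"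
  unfolding filt_def using excluded_middle by blast

lemma ultra_filt: "ultra p \<Longrightarrow> filt p"
  by (simp add: ultra_def)

lemma ultra_compl: "ultra p \<Longrightarrow> \<^bold>- A \<in> p \<longleftrightarrow> A \<notin> p"
  by (simp add: ultra_def)

lemma ultra_bot: "ultra p \<Longrightarrow> \<^bold>\<bottom> \<notin> p"
  by (simp add: filt_top ultra_compl ultra_filt)

lemma ultra_sum: 
  assumes p: "ultra p" shows "A \<^bold>+ B \<in> p \<longleftrightarrow> A \<in> p \<or> B \<in> p"
proof
  assume sum: "A \<^bold>+ B \<in> p"
  show "A \<in> p \<or> B \<in> p"
  proof (rule ccontr)
    assume "\<not> (A \<in> p \<or> B \<in> p)"
    then have "\<^bold>- A \<^bold>\<sqinter> \<^bold>- B \<in> p"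
      using p by (intro filt_meet ultra_filt) (simp_all add: ultra_compl)
    moreover have "\<^bold>- (\<^bold>- A) \<^bold>+ \<^bold>- (\<^bold>- B) \<in> p"
      using filt_up[OF ultra_filt[OF p] sum] sum_mono compl_compl by blast
    ultimately show False
      using p by (simp add: ultra_compl)
  qed
next
  show "A \<in> p \<or> B \<in> p \<Longrightarrow> A \<^bold>+ B \<in> p"
    using filt_up[OF ultra_filt[OF p]] sum_ub1 sum_ub2 by blast
qed

lemma ultra_maximal:
  assumes "ultra p" "ultra q" "p \<subseteq> q" shows "p = q"
  using assms ultra_compl by blast

lemma filt_principal: "filt {B. A \<sqsubseteq> B}"
  unfolding filt_def by (blast intro: le_refl le_trans meet_glb)

text \<open>Prime filter theorem. Filters may be improper, so properness is enforced by the ideal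
  \<open>Z\<close>. A filter maximal among those disjoint from \<open>Z\<close> decides every
  \<open>A\<close>: otherwise adjoining \<open>A\<close> and adjoining its complement both reach
  \<open>Z\<close>, and \<open>by_cases\<close> puts the sum of the two elements of \<open>Z\<close>
  into the filter.\<close>

lemma ultrafilter_separation:
  assumes F: "filt F" and "\<^bold>\<bottom> \<in> Z"
    and down: "\<And>A B. B \<in> Z \<Longrightarrow> A \<sqsubseteq> B \<Longrightarrow> A \<in> Z"
    and sum: "\<And>A B. A \<in> Z \<Longrightarrow> B \<in> Z \<Longrightarrow> A \<^bold>+ B \<in> Z"
    and FZ: "F \<inter> Z = {}"
  shows "\<exists>p. ultra p \<and> F \<subseteq> p \<and> p \<inter> Z = {}"
proof -
  define \<F> where "\<F> = {G. filt G \<and> F \<subseteq> G \<and> G \<inter> Z = {}}"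
  have "\<exists>G\<in>\<F>. \<forall>X\<in>\<F>. G \<subseteq> X \<longrightarrow> X = G"
  proof (rule subset_Zorn_nonempty)
    show "\<F> \<noteq> {}"
      using F FZ by (auto simp: \<F>_def)
    fix C assume C: "C \<noteq> {}" "subset.chain \<F> C"
    have sub: "C \<subseteq> \<F>" and tot: "\<And>X Y. X \<in> C \<Longrightarrow> Y \<in> C \<Longrightarrow> X \<subseteq> Y \<or> Y \<subseteq> X"
      using C(2) by (auto simp: subset_chain_def)
    have "filt (\<Union> C)"
      unfolding filt_def
    proof (intro conjI ballI allI impI)
      show "\<Union> C \<noteq> {}"
        using C(1) sub F unfolding \<F>_def filt_def by blast
      show "B \<in> \<Union> C" if "A \<in> \<Union> C" "A \<sqsubseteq> B" for A B
        using sub that unfolding \<F>_def filt_def by blast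
      fix A B assume "A \<in> \<Union> C" "B \<in> \<Union> C"
      then obtain X where "X \<in> C" "A \<in> X" "B \<in> X"
        using tot by blast
      then show "A \<^bold>\<sqinter> B \<in> \<Union> C"
        using sub unfolding \<F>_def filt_def by blast
    qed
    then show "\<Union> C \<in> \<F>"
      using C(1) sub unfolding \<F>_def by blast
  qed
  then obtain G where "G \<in> \<F>" and maximal: "\<forall>X\<in>\<F>. G \<subseteq> X \<longrightarrow> X = G"
    by blast
  then have G: "filt G" "F \<subseteq> G" "G \<inter> Z = {}"
    by (auto simp: \<F>_def)
  have max: "X = G" if "filt X" "X \<inter> Z = {}" "G \<subseteq> X" for X
    using maximal that order_trans[OF G(2) that(3)] by (simp add: \<F>_def)
  have ext: "\<exists>B\<in>G. \<exists>D\<in>Z. B \<^bold>\<sqinter> A \<sqsubseteq> D" if "A \<notin> G" for A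
  proof (rule ccontr)
    assume no: "\<not> ?thesis"
    \<comment> \<open>The filter generated by \<open>G\<close> and \<open>A\<close>.\<close>
    define X where "X = {D. \<exists>B\<in>G. B \<^bold>\<sqinter> A \<sqsubseteq> D}"
    have "filt X"
      unfolding filt_def
    proof (intro conjI ballI allI impI)
      show "X \<noteq> {}"
        using G(1) le_refl unfolding X_def filt_def by blast
      show "D' \<in> X" if "D \<in> X" "D \<sqsubseteq> D'" for D D'
        using that unfolding X_def by (blast intro: le_trans)
      fix D D' assume "D \<in> X" "D' \<in> X"
      then obtain B B' where B: "B \<in> G" "B' \<in> G" "B \<^bold>\<sqinter> A \<sqsubseteq> D" "B' \<^bold>\<sqinter> A \<sqsubseteq> D'"
        unfolding X_def by blast
      have "(B \<^bold>\<sqinter> B') \<^bold>\<sqinter> A \<sqsubseteq> D \<^bold>\<sqinter> D'"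
        by (meson B(3,4) le_refl le_trans meet_glb meet_lb1 meet_lb2 meet_mono)
      then show "D \<^bold>\<sqinter> D' \<in> X"
        using filt_meet[OF G(1) B(1,2)] unfolding X_def by blast
    qed
    moreover have "X \<inter> Z = {}"
      using no unfolding X_def by blast
    moreover have "G \<subseteq> X"
      using meet_lb1 unfolding X_def by blast
    ultimately have "X = G"
      using max by blast
    moreover have "A \<in> X"
      using G(1) meet_lb2 unfolding X_def filt_def by blast
    ultimately show False
      using that by blast
  qed
  have "A \<in> G \<or> \<^bold>- A \<in> G" for A
  proof (rule ccontr)
    assume "\<not> ?thesis"
    then obtain B D B' D' where B: "B \<in> G" "D \<in> Z" "B \<^bold>\<sqinter> A \<sqsubseteq> D"
      "B' \<in> G" "D' \<in> Z" "B' \<^bold>\<sqinter> \<^bold>- A \<sqsubseteq> D'"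
      using ext by meson
    have "B \<^bold>\<sqinter> B' \<sqsubseteq> D \<^bold>+ D'"
    proof (rule by_cases)
      show "(B \<^bold>\<sqinter> B') \<^bold>\<sqinter> A \<sqsubseteq> D \<^bold>+ D'"
        by (meson B(3) le_refl le_trans meet_lb1 meet_mono sum_ub1)
      show "(B \<^bold>\<sqinter> B') \<^bold>\<sqinter> \<^bold>- A \<sqsubseteq> D \<^bold>+ D'"
        by (meson B(6) le_refl le_trans meet_lb2 meet_mono sum_ub2)
    qed
    then show False
      using B G filt_meet filt_up sum by (meson disjoint_iff)
  qed
  moreover have "\<not> (A \<in> G \<and> \<^bold>- A \<in> G)" for A
    using filt_meet[OF G(1), of A "\<^bold>- A"] filt_up[OF G(1)] contradiction \<open>\<^bold>\<bottom> \<in> Z\<close> G(3) by blast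
  ultimately have "ultra G"
    using G(1) unfolding ultra_def by blast
  then show ?thesis
    using G by blast
qed

lemma ultrafilter_exists:
  assumes "\<not> A \<sqsubseteq> B" shows "\<exists>p. ultra p \<and> A \<in> p \<and> B \<notin> p"
proof -
  have "\<exists>p. ultra p \<and> {C. A \<sqsubseteq> C} \<subseteq> p \<and> p \<inter> {C. C \<sqsubseteq> B} = {}"
    using assms bot_least le_trans sum_lub
    by (intro ultrafilter_separation filt_principal) blast+
  then show ?thesis
    using le_refl by blast
qed

text \<open>\<open>Z\<close> collects the predicates excluded from the right factor by
  \<open>p\<close> and \<open>r\<close>. It is an ideal because composition distributes over sums
  and \<open>r\<close> is prime, so an ultrafilter extending \<open>F\<close> can avoid it.\<close>

lemma extend_right:
  assumes p: "filt p" and r: "ultra r" and F: "filt F"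
    and pFr: "\<And>A B. A \<in> p \<Longrightarrow> B \<in> F \<Longrightarrow> A \<^bold>; B \<in> r"
  shows "\<exists>q. ultra q \<and> F \<subseteq> q \<and> (\<forall>A\<in>p. \<forall>B\<in>q. A \<^bold>; B \<in> r)"
proof -
  define Z where "Z = {B. \<exists>A\<in>p. A \<^bold>; B \<notin> r}"
  have up: "A \<in> r \<Longrightarrow> A \<sqsubseteq> B \<Longrightarrow> B \<in> r" for A B
    using filt_up ultra_filt r by blast
  have "\<exists>q. ultra q \<and> F \<subseteq> q \<and> q \<inter> Z = {}"
  proof (rule ultrafilter_separation[OF F])
    show "\<^bold>\<bottom> \<in> Z"
      using p ultra_bot[OF r] comp_bot_right up unfolding Z_def filt_def by blast
    show "A \<in> Z" if "B \<in> Z" "A \<sqsubseteq> B" for A B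
      using that comp_mono[OF le_refl] up unfolding Z_def by blast
    show "A \<^bold>+ B \<in> Z" if AB: "A \<in> Z" "B \<in> Z" for A B
    proof -
      obtain C D where C: "C \<in> p" "C \<^bold>; A \<notin> r" and D: "D \<in> p" "D \<^bold>; B \<notin> r"
        using AB unfolding Z_def by blast
      have "(C \<^bold>\<sqinter> D) \<^bold>; (A \<^bold>+ B) \<sqsubseteq> C \<^bold>; A \<^bold>+ D \<^bold>; B"
        using comp_sum_right comp_mono[OF meet_lb1 le_refl] comp_mono[OF meet_lb2 le_refl]
          sum_mono le_trans by meson
      then have "(C \<^bold>\<sqinter> D) \<^bold>; (A \<^bold>+ B) \<notin> r"
        using up ultra_sum[OF r] C(2) D(2) by blast
      then show ?thesis
        using filt_meet[OF p C(1) D(1)] unfolding Z_def by blast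
    qed
    show "F \<inter> Z = {}"
      using pFr unfolding Z_def by blast
  qed
  then show ?thesis
    unfolding Z_def by blast
qed

lemma extend_left:
  assumes p: "filt p" and r: "ultra r" and F: "filt F"
    and Fpr: "\<And>A B. A \<in> F \<Longrightarrow> B \<in> p \<Longrightarrow> A \<^bold>; B \<in> r"
  shows "\<exists>q. ultra q \<and> F \<subseteq> q \<and> (\<forall>A\<in>q. \<forall>B\<in>p. A \<^bold>; B \<in> r)"
proof -
  define Z where "Z = {A. \<exists>B\<in>p. A \<^bold>; B \<notin> r}"
  have up: "A \<in> r \<Longrightarrow> A \<sqsubseteq> B \<Longrightarrow> B \<in> r" for A B
    using filt_up ultra_filt r by blast
  have "\<exists>q. ultra q \<and> F \<subseteq> q \<and> q \<inter> Z = {}"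
  proof (rule ultrafilter_separation[OF F])
    show "\<^bold>\<bottom> \<in> Z"
      using p ultra_bot[OF r] comp_bot_left up unfolding Z_def filt_def by blast
    show "A \<in> Z" if "B \<in> Z" "A \<sqsubseteq> B" for A B
      using that comp_mono[OF _ le_refl] up unfolding Z_def by blast
    show "A \<^bold>+ B \<in> Z" if AB: "A \<in> Z" "B \<in> Z" for A B
    proof -
      obtain C D where C: "C \<in> p" "A \<^bold>; C \<notin> r" and D: "D \<in> p" "B \<^bold>; D \<notin> r"
        using AB unfolding Z_def by blast
      have "(A \<^bold>+ B) \<^bold>; (C \<^bold>\<sqinter> D) \<sqsubseteq> A \<^bold>; C \<^bold>+ B \<^bold>; D"
        using comp_sum_left comp_mono[OF le_refl meet_lb1] comp_mono[OF le_refl meet_lb2]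
          sum_mono le_trans by meson
      then have "(A \<^bold>+ B) \<^bold>; (C \<^bold>\<sqinter> D) \<notin> r"
        using up ultra_sum[OF r] C(2) D(2) by blast
      then show ?thesis
        using filt_meet[OF p C(1) D(1)] unfolding Z_def by blast
    qed
    show "F \<inter> Z = {}"
      using Fpr unfolding Z_def by blast
  qed
  then show ?thesis
    unfolding Z_def by blast
qed

section \<open>The Jonsson-Tarski frame of ultrafilters\<close>

definition canonical_frame :: "predicate set frame"
  where "canonical_frame = \<lparr>
    points = {p. ultra p},
    rel = {(p, q, r). ultra p \<and> ultra q \<and> ultra r \<and> (\<forall>A\<in>p. \<forall>B\<in>q. A \<^bold>; B \<in> r)},
    star = (\<lambda>p. {A. A\<^bold>\<smile> \<in> p}),
    idents = {p. ultra p \<and> \<^bold>1' \<in> p}\<rparr>"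

abbreviation CR :: "predicate set \<Rightarrow> predicate set \<Rightarrow> predicate set \<Rightarrow> bool"
  where "CR p q r \<equiv> (p, q, r) \<in> rel canonical_frame"

lemma points_canonical [simp]: "p \<in> points canonical_frame \<longleftrightarrow> ultra p"
  by (simp add: canonical_frame_def)

lemma star_canonical [simp]: "A \<in> star canonical_frame p \<longleftrightarrow> A\<^bold>\<smile> \<in> p"
  by (simp add: canonical_frame_def)

lemma idents_canonical: "p \<in> idents canonical_frame \<longleftrightarrow> ultra p \<and> \<^bold>1' \<in> p"
  by (simp add: canonical_frame_def)

lemma rel_canonical:
  "CR p q r \<longleftrightarrow> ultra p \<and> ultra q \<and> ultra r \<and> (\<forall>A B. A \<in> p \<longrightarrow> B \<in> q \<longrightarrow> A \<^bold>; B \<in> r)"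
  by (auto simp: canonical_frame_def)

text \<open>The factors are found one after the other: the principal filter of \<open>B\<close> is
  enlarged to an ultrafilter \<open>q\<close> against the principal filter of \<open>A\<close>, and
  then the latter is enlarged against the finished \<open>q\<close>.\<close>

lemma rel_canonical_exists:
  assumes r: "ultra r" and "A \<^bold>; B \<in> r"
  shows "\<exists>p q. CR p q r \<and> A \<in> p \<and> B \<in> q"
proof -
  have "\<exists>q. ultra q \<and> {C. B \<sqsubseteq> C} \<subseteq> q \<and> (\<forall>D\<in>{C. A \<sqsubseteq> C}. \<forall>C\<in>q. D \<^bold>; C \<in> r)"
    using assms comp_mono filt_up ultra_filt
    by (intro extend_right filt_principal r) blast
  then obtain q where q: "ultra q" "B \<in> q" "\<And>C D. A \<sqsubseteq> D \<Longrightarrow> C \<in> q \<Longrightarrow> D \<^bold>; C \<in> r"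
    using le_refl by blast
  then have "\<exists>p. ultra p \<and> {C. A \<sqsubseteq> C} \<subseteq> p \<and> (\<forall>D\<in>p. \<forall>C\<in>q. D \<^bold>; C \<in> r)"
    by (intro extend_left filt_principal r ultra_filt) blast+
  then show ?thesis
    using q(1,2) r le_refl unfolding rel_canonical by blast
qed

text \<open>Monotone and involutive up to mutual entailment, converse preserves meets and
  complements; \<open>flip\<close> and \<open>flip'\<close> say that it is its own adjoint.\<close>

lemma ultra_star:
  assumes p: "ultra p" shows "ultra (star canonical_frame p)"
proof -
  have up: "A \<in> p \<Longrightarrow> A \<sqsubseteq> B \<Longrightarrow> B \<in> p" for A B
    using filt_up ultra_filt p by blast
  have flip: "A \<sqsubseteq> B\<^bold>\<smile>" if "A\<^bold>\<smile> \<sqsubseteq> B" for A B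
    by (rule le_trans[OF conv_conv2 conv_mono[OF that]])
  have flip': "A\<^bold>\<smile> \<sqsubseteq> B" if "A \<sqsubseteq> B\<^bold>\<smile>" for A B
    by (rule le_trans[OF conv_mono[OF that] conv_conv1])
  have meet: "(A \<^bold>\<sqinter> B)\<^bold>\<smile> \<in> p" if "A\<^bold>\<smile> \<in> p" "B\<^bold>\<smile> \<in> p" for A B
  proof -
    have "(A\<^bold>\<smile> \<^bold>\<sqinter> B\<^bold>\<smile>)\<^bold>\<smile> \<sqsubseteq> A \<^bold>\<sqinter> B"
      by (rule meet_glb; rule flip', rule meet_lb1 meet_lb2)
    then have "A\<^bold>\<smile> \<^bold>\<sqinter> B\<^bold>\<smile> \<sqsubseteq> (A \<^bold>\<sqinter> B)\<^bold>\<smile>"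
      by (rule flip)
    then show ?thesis
      using filt_meet[OF ultra_filt[OF p] that] up by blast
  qed
  have total: "A\<^bold>\<smile> \<^bold>+ (\<^bold>- A)\<^bold>\<smile> \<in> p" for A
  proof -
    have "A \<^bold>+ \<^bold>- A \<sqsubseteq> (A\<^bold>\<smile> \<^bold>+ (\<^bold>- A)\<^bold>\<smile>)\<^bold>\<smile>"
      by (rule sum_lub; rule flip, rule sum_ub1 sum_ub2)
    then have "(\<^bold>1' \<^bold>+ \<^bold>- \<^bold>1')\<^bold>\<smile> \<sqsubseteq> (A\<^bold>\<smile> \<^bold>+ (\<^bold>- A)\<^bold>\<smile>)\<^bold>\<smile>"
      by (rule le_trans[OF excluded_middle])
    then have "\<^bold>1' \<^bold>+ \<^bold>- \<^bold>1' \<sqsubseteq> A\<^bold>\<smile> \<^bold>+ (\<^bold>- A)\<^bold>\<smile>"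
      by (rule le_trans[OF flip conv_conv1])
    then show ?thesis
      using filt_top[OF ultra_filt[OF p]] up by blast
  qed
  have "(\<^bold>- A)\<^bold>\<smile> \<in> p \<longleftrightarrow> A\<^bold>\<smile> \<notin> p" for A
  proof
    assume 1: "(\<^bold>- A)\<^bold>\<smile> \<in> p"
    show "A\<^bold>\<smile> \<notin> p"
    proof
      assume "A\<^bold>\<smile> \<in> p"
      from meet[OF this 1] have "\<^bold>\<bottom> \<in> p"
        using up flip' contradiction by blast
      then show False
        using ultra_bot[OF p] by blast
    qed
  qed (use total ultra_sum[OF p] in blast)
  moreover have "filt (star canonical_frame p)"
    unfolding filt_def using meet up conv_mono filt_top[OF ultra_filt[OF p]] total ultra_sum[OF p]
    by (metis empty_iff star_canonical)
  ultimately show ?thesis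
    unfolding ultra_def by simp
qed

lemma star_star_canonical:
  assumes p: "ultra p" shows "star canonical_frame (star canonical_frame p) = p"
  using filt_up[OF ultra_filt[OF p]] conv_conv1 conv_conv2 by (auto simp: set_eq_iff)

text \<open>A product of two parts of 1' lies below each of them, here below \<open>A\<close> and
  below its complement, hence it is empty; integrality makes one part empty.\<close>

lemma ident_atom: "\<^bold>1' \<sqsubseteq> A \<or> \<^bold>1' \<sqsubseteq> \<^bold>- A"
proof -
  have "(\<^bold>1' \<^bold>\<sqinter> A) \<^bold>; (\<^bold>1' \<^bold>\<sqinter> \<^bold>- A) \<sqsubseteq> A" "(\<^bold>1' \<^bold>\<sqinter> A) \<^bold>; (\<^bold>1' \<^bold>\<sqinter> \<^bold>- A) \<sqsubseteq> \<^bold>- A"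
    by (meson comp_mono comp_ident1 ident_comp meet_lb1 meet_lb2 le_trans)+
  then have "(\<^bold>1' \<^bold>\<sqinter> A) \<^bold>; (\<^bold>1' \<^bold>\<sqinter> \<^bold>- A) \<sqsubseteq> \<^bold>\<bottom>"
    by (meson contradiction le_trans meet_glb)
  then consider "\<^bold>1' \<^bold>\<sqinter> A \<sqsubseteq> \<^bold>\<bottom>" | "\<^bold>1' \<^bold>\<sqinter> \<^bold>- A \<sqsubseteq> \<^bold>\<bottom>"
    using integral by blast
  then show ?thesis
    by (metis bot_least by_cases le_trans meet_lb2)
qed

lemma idents_canonical_unique:
  assumes "p \<in> idents canonical_frame" "q \<in> idents canonical_frame" shows "p = q"
proof (rule ultra_maximal)
  show p: "ultra p" and q: "ultra q"
    using assms idents_canonical by blast+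
  show "p \<subseteq> q"
  proof
    fix A assume "A \<in> p"
    then have "\<not> \<^bold>1' \<sqsubseteq> \<^bold>- A"
      using assms(1) filt_up ultra_compl ultra_filt unfolding idents_canonical by blast
    then show "A \<in> q"
      using ident_atom assms(2) filt_up ultra_filt unfolding idents_canonical by blast
  qed
qed

lemma rel_canonical_ident:
  assumes "u \<in> idents canonical_frame" "CR p u q" shows "p = q"
proof (rule ultra_maximal)
  show "p \<subseteq> q"
    using assms filt_up ultra_filt comp_ident1 unfolding idents_canonical rel_canonical by blast
qed (use assms in \<open>simp_all add: rel_canonical\<close>)

lemma rel_canonical_ident_exists:
  assumes p: "ultra p" shows "\<exists>u\<in>idents canonical_frame. CR p u p"
proof -
  \<comment> \<open>Every ultrafilter contains the top predicate composed with 1'. Splitting that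
    product gives an identity point \<open>u\<close>, and the other factor is then \<open>p\<close>
    itself.\<close>
  have "(\<^bold>1' \<^bold>+ \<^bold>- \<^bold>1') \<^bold>; \<^bold>1' \<in> p"
    using p comp_ident2 filt_top filt_up ultra_filt by blast
  then obtain q u where "CR q u p" "\<^bold>1' \<in> u"
    using rel_canonical_exists p by blast
  moreover from this have "u \<in> idents canonical_frame"
    by (simp add: idents_canonical rel_canonical)
  ultimately show ?thesis
    using rel_canonical_ident by blast
qed

text \<open>\<open>G\<close> is the filter generated by products of members of \<open>w\<close> and
  \<open>y\<close>, so every ultrafilter containing it is related to them. \<open>comp_assoc\<close>
  makes \<open>G\<close> compatible with \<open>v\<close> and \<open>z\<close>, and
  \<open>extend_right\<close> enlarges it to a point.\<close>

lemma rel_canonical_pasch: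
  assumes vwx: "CR v w x" and xyz: "CR x y z"
  shows "\<exists>u. CR v u z \<and> CR w y u"
proof -
  define G where "G = {D. \<exists>B\<in>w. \<exists>C\<in>y. B \<^bold>; C \<sqsubseteq> D}"
  have u: "ultra v" "ultra w" "ultra x" "ultra y" "ultra z"
    using assms by (auto simp: rel_canonical)
  have "filt G"
    unfolding filt_def
  proof (intro conjI ballI allI impI)
    show "G \<noteq> {}"
      using u(2,4)[THEN ultra_filt] le_refl unfolding G_def filt_def by blast
    show "B \<in> G" if "A \<in> G" "A \<sqsubseteq> B" for A B
      using that le_trans unfolding G_def by blast
    fix D D' assume "D \<in> G" "D' \<in> G"
    then obtain B C B' C' where B: "B \<in> w" "C \<in> y" "B \<^bold>; C \<sqsubseteq> D" "B' \<in> w" "C' \<in> y" "B' \<^bold>; C' \<sqsubseteq> D'"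
      unfolding G_def by blast
    have "(B \<^bold>\<sqinter> B') \<^bold>; (C \<^bold>\<sqinter> C') \<sqsubseteq> D \<^bold>\<sqinter> D'"
      using B(3,6) comp_mono meet_lb1 meet_lb2 le_trans by (meson meet_glb)
    then show "D \<^bold>\<sqinter> D' \<in> G"
      using B u filt_meet ultra_filt unfolding G_def by blast
  qed
  moreover have "A \<^bold>; D \<in> z" if "A \<in> v" "D \<in> G" for A D
  proof -
    obtain B C where B: "B \<in> w" "C \<in> y" "B \<^bold>; C \<sqsubseteq> D"
      using \<open>D \<in> G\<close> unfolding G_def by blast
    have "(A \<^bold>; B) \<^bold>; C \<in> z"
      using assms \<open>A \<in> v\<close> B unfolding rel_canonical by blast
    moreover have "(A \<^bold>; B) \<^bold>; C \<sqsubseteq> A \<^bold>; D"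
      using comp_assoc comp_mono[OF le_refl B(3)] le_trans by blast
    ultimately show ?thesis
      using filt_up ultra_filt u(5) by blast
  qed
  ultimately obtain q where "ultra q" "G \<subseteq> q" "\<forall>A\<in>v. \<forall>D\<in>q. A \<^bold>; D \<in> z"
    using extend_right[OF ultra_filt[OF u(1)] u(5)] by blast
  moreover from this have "CR w y q"
    unfolding rel_canonical G_def using u le_refl by blast
  ultimately show ?thesis
    unfolding rel_canonical using u by blast
qed

text \<open>The residual law contraposed: if a product of \<open>A\<close> and \<open>C\<close> were
  missing from \<open>q\<close>, its complement would be there, and \<open>residual_left\<close>
  would put the complement of \<open>C\<close> into \<open>r\<close>.\<close>

lemma rel_canonical_left:
  assumes "CR p q r" shows "CR (star canonical_frame p) r q"
proof -
  have u: "ultra p" "ultra q" "ultra r"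
    using assms by (auto simp: rel_canonical)
  have "A \<^bold>; C \<in> q" if "A\<^bold>\<smile> \<in> p" "C \<in> r" for A C
  proof (rule ccontr)
    assume "A \<^bold>; C \<notin> q"
    then have "A\<^bold>\<smile> \<^bold>; \<^bold>- (A \<^bold>; C) \<in> r"
      using assms u that(1) by (simp add: rel_canonical ultra_compl)
    then show False
      using residual_left filt_up ultra_filt ultra_compl u(3) that(2) by blast
  qed
  then show ?thesis
    using u ultra_star by (simp add: rel_canonical)
qed

lemma rel_canonical_right:
  assumes "CR p q r" shows "CR r (star canonical_frame q) p"
proof -
  have u: "ultra p" "ultra q" "ultra r"
    using assms by (auto simp: rel_canonical)
  have "C \<^bold>; A \<in> p" if "A\<^bold>\<smile> \<in> q" "C \<in> r" for A C
  proof (rule ccontr)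
    assume "C \<^bold>; A \<notin> p"
    then have "\<^bold>- (C \<^bold>; A) \<^bold>; A\<^bold>\<smile> \<in> r"
      using assms u that(1) by (simp add: rel_canonical ultra_compl)
    then show False
      using residual_right filt_up ultra_filt ultra_compl u(3) that(2) by blast
  qed
  then show ?thesis
    using u ultra_star by (simp add: rel_canonical)
qed

lemma canonical_integral_dense:
  assumes "\<not> \<^bold>1' \<sqsubseteq> A" shows "integral_dense_frame canonical_frame"
proof -
  \<comment> \<open>The failing inclusion guarantees consistency, hence an ultrafilter containing
    1'.\<close>
  obtain e where "e \<in> idents canonical_frame"
    using ultrafilter_exists[OF assms] idents_canonical by blast
  then have "idents canonical_frame = {e}"
    using idents_canonical_unique by blast
  then have "card (idents canonical_frame) = 1"
    by simp
  moreover have "is_frame canonical_frame"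
    unfolding is_frame_def using ultra_star rel_canonical idents_canonical points_canonical
    by auto
  moreover have "left_reflection canonical_frame" "right_reflection canonical_frame"
    unfolding left_reflection_def right_reflection_def
    using rel_canonical_left rel_canonical_right by blast+
  moreover have "identity_cond canonical_frame"
    unfolding identity_cond_def using rel_canonical_ident rel_canonical_ident_exists by auto
  moreover have "pasch_cond canonical_frame"
    unfolding pasch_cond_def using rel_canonical_pasch rel_canonical by (meson points_canonical)
  moreover have "density_cond canonical_frame"
  proof -
    have "A \<^bold>; B \<in> p" if "ultra p" "A \<in> p" "B \<in> p" for A B p
    proof -
      \<comment> \<open>A triple with all entries \<open>p\<close> involves two different members of
        \<open>p\<close>, so density is applied to their meet.\<close>
      have "A \<^bold>\<sqinter> B \<sqsubseteq> A \<^bold>; B"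
        by (rule le_trans[OF dense comp_mono[OF meet_lb1 meet_lb2]])
      then show ?thesis
        using filt_meet filt_up ultra_filt that by blast
    qed
    then show ?thesis
      by (simp add: density_cond_def rel_canonical)
  qed
  ultimately show ?thesis
    by (simp add: integral_dense_frame_def)
qed

text \<open>The Stone map. Its deep case is composition, where \<open>rel_canonical_exists\<close>
  splits an ultrafilter containing a product.\<close>

lemma canonical_hom: "(\<lambda>A. {p. ultra p \<and> A \<in> p}) \<in> alg_hom \<PP> (Cm canonical_frame)"
proof -
  have comp: "{p. ultra p \<and> A \<^bold>; B \<in> p} =
    {r. \<exists>p\<in>{p. ultra p \<and> A \<in> p}. \<exists>q\<in>{p. ultra p \<and> B \<in> p}. CR p q r}" for A B
  proof (intro equalityI subsetI)
    fix r assume "r \<in> {p. ultra p \<and> A \<^bold>; B \<in> p}"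
    then obtain p q where "CR p q r" "A \<in> p" "B \<in> q"
      using rel_canonical_exists by blast
    moreover from this have "ultra p" "ultra q"
      by (simp_all add: rel_canonical)
    ultimately show "r \<in> {r. \<exists>p\<in>{p. ultra p \<and> A \<in> p}. \<exists>q\<in>{p. ultra p \<and> B \<in> p}. CR p q r}"
      by blast
  qed (auto simp: rel_canonical)
  have conv: "{p. ultra p \<and> A\<^bold>\<smile> \<in> p} = star canonical_frame ` {p. ultra p \<and> A \<in> p}" for A
  proof (intro equalityI subsetI)
    fix p assume "p \<in> {p. ultra p \<and> A\<^bold>\<smile> \<in> p}"
    then have "star canonical_frame p \<in> {p. ultra p \<and> A \<in> p}"
      "p = star canonical_frame (star canonical_frame p)"
      using ultra_star star_star_canonical by simp_all
    then show "p \<in> star canonical_frame ` {p. ultra p \<and> A \<in> p}"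
      by blast
  next
    fix p assume "p \<in> star canonical_frame ` {p. ultra p \<and> A \<in> p}"
    then obtain q where "p = star canonical_frame q" "ultra q" "A \<in> q"
      by blast
    then show "p \<in> {p. ultra p \<and> A\<^bold>\<smile> \<in> p}"
      using ultra_star filt_up ultra_filt conv_conv2 by auto
  qed
  show ?thesis
    unfolding alg_hom_def mem_Collect_eq
  proof (intro conjI ballI)
    fix A B
    show "{p. ultra p \<and> A \<odot>\<^bsub>\<PP>\<^esub> B \<in> p} =
      {p. ultra p \<and> A \<in> p} \<odot>\<^bsub>Cm canonical_frame\<^esub> {p. ultra p \<and> B \<in> p}"
      using comp by (simp add: pred_alg_def Cm_def)
    show "{p. ultra p \<and> A\<smile>\<^bsub>\<PP>\<^esub> \<in> p} = {p. ultra p \<and> A \<in> p}\<smile>\<^bsub>Cm canonical_frame\<^esub>"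
      using conv by (simp add: pred_alg_def Cm_def Setcompr_eq_image)
    show "{p. ultra p \<and> A \<oplus>\<^bsub>\<PP>\<^esub> B \<in> p} =
      {p. ultra p \<and> A \<in> p} \<oplus>\<^bsub>Cm canonical_frame\<^esub> {p. ultra p \<and> B \<in> p}"
      using ultra_sum by (auto simp: pred_alg_def Cm_def)
    show "{p. ultra p \<and> \<sim>\<^bsub>\<PP>\<^esub> A \<in> p} = \<sim>\<^bsub>Cm canonical_frame\<^esub> {p. ultra p \<and> A \<in> p}"
      using ultra_compl by (auto simp: pred_alg_def Cm_def)
    show "{p. ultra p \<and> A \<in> p} \<in> univ (Cm canonical_frame)"
      by (auto simp: Cm_def)
    show "{p. ultra p \<and> \<one>'\<^bsub>\<PP>\<^esub> \<in> p} = \<one>'\<^bsub>Cm canonical_frame\<^esub>"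
      by (auto simp: pred_alg_def Cm_def idents_canonical)
  qed
qed

lemma canonical_not_valid:
  assumes "\<not> \<^bold>1' \<sqsubseteq> A" shows "\<not> valid_in canonical_frame A"
proof -
  obtain e where "ultra e" "\<^bold>1' \<in> e" "A \<notin> e"
    using ultrafilter_exists[OF assms] by blast
  then have "\<not> idents canonical_frame \<subseteq> {p. ultra p \<and> A \<in> p}"
    by (auto simp: idents_canonical)
  then show ?thesis
    unfolding valid_in_def by (blast dest: bspec[OF _ canonical_hom])
qed

lemma canonical_commutative:
  assumes "\<And>A B. A \<^bold>; B \<sqsubseteq> B \<^bold>; A" shows "commutativity_cond canonical_frame"
proof -
  have "CR q p r" if pqr: "CR p q r" for p q r
  proof -
    have "ultra r"
      using pqr by (simp add: rel_canonical)
    then have "B \<^bold>; A \<in> r" if "A \<in> p" "B \<in> q" for A B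
      using that pqr filt_up[OF ultra_filt _ assms] by (simp add: rel_canonical)
    then show ?thesis
      using pqr by (simp add: rel_canonical)
  qed
  then show ?thesis
    unfolding commutativity_cond_def by blast
qed

lemma canonical_symmetric:
  assumes "\<And>A. A \<sqsubseteq> A\<^bold>\<smile>" shows "symmetry_cond canonical_frame"
proof -
  have "A\<^bold>\<smile> \<sqsubseteq> A" for A
    by (rule le_trans[OF conv_mono[OF assms] conv_conv1])
  then have "A\<^bold>\<smile> \<in> p \<longleftrightarrow> A \<in> p" if "ultra p" for A p
    using filt_up[OF ultra_filt[OF that]] assms by blast
  then show ?thesis
    by (auto simp: symmetry_cond_def set_eq_iff)
qed

end

section \<open>Relation algebras\<close>

context relation_algebra
begin

declare join_closed [simp] neg_closed [simp] semi_closed [simp] conv_closed [simp]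
  ident_closed [simp] conv_conv [simp]

abbreviation le :: "'a \<Rightarrow> 'a \<Rightarrow> bool"  (infix \<open>\<preceq>\<close> 50)
  where "a \<preceq> b \<equiv> ra_le \<AA> a b"

abbreviation top_elem :: 'a  (\<open>\<top>\<close>)
  where "\<top> \<equiv> ra_one \<AA>"

abbreviation bot_elem :: 'a  (\<open>\<bottom>\<close>)
  where "\<bottom> \<equiv> ra_zero \<AA>"

lemma top_closed [simp]: "\<top> \<in> univ \<AA>" and bot_closed [simp]: "\<bottom> \<in> univ \<AA>"
  by (simp_all add: ra_one_def ra_zero_def)

section \<open>Boolean algebra from Huntington's equation\<close>

lemma join_left_comm:
  assumes "a \<in> univ \<AA>" "b \<in> univ \<AA>" "c \<in> univ \<AA>"
  shows "a \<oplus> (b \<oplus> c) = b \<oplus> (a \<oplus> c)"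
  using assms join_assoc join_comm by metis

lemmas join_ac = join_assoc[symmetric] join_comm join_left_comm

text \<open>Huntington's equation cuts \<open>a\<close>, \<open>\<sim> a\<close>, \<open>b\<close>
  and \<open>\<sim> b\<close> each into two of the four pieces \<open>p\<close>, \<open>q\<close>,
  \<open>r\<close>, \<open>s\<close>, so both joins are the join of all four.\<close>

lemma join_neg:
  assumes a: "a \<in> univ \<AA>" shows "a \<oplus> \<sim> a = \<top>"
proof -
  have "a \<oplus> \<sim> a = b \<oplus> \<sim> b" if b: "b \<in> univ \<AA>" for b
  proof -
    define p q r s where "p = \<sim> (\<sim> a \<oplus> \<sim> (\<sim> b))" and "q = \<sim> (\<sim> a \<oplus> \<sim> b)"
      and "r = \<sim> (\<sim> (\<sim> a) \<oplus> \<sim> (\<sim> b))" and "s = \<sim> (\<sim> (\<sim> a) \<oplus> \<sim> b)"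
    note defs = p_def q_def r_def s_def
    have [simp]: "p \<in> univ \<AA>" "q \<in> univ \<AA>" "r \<in> univ \<AA>" "s \<in> univ \<AA>"
      using a b by (simp_all add: defs)
    have "p \<oplus> q = a" "r \<oplus> s = \<sim> a"
      using huntington[of a "\<sim> b"] huntington[of "\<sim> a" "\<sim> b"] a b by (simp_all add: defs)
    moreover have "s \<oplus> q = b" "r \<oplus> p = \<sim> b"
      using huntington[of b "\<sim> a"] huntington[of "\<sim> b" "\<sim> a"] a b
      by (simp_all add: defs join_comm)
    ultimately have "a \<oplus> \<sim> a = (p \<oplus> q) \<oplus> (r \<oplus> s)" "b \<oplus> \<sim> b = (s \<oplus> q) \<oplus> (r \<oplus> p)"
      by simp_all
    then show ?thesis
      by (simp add: join_ac)
  qed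
  from this[OF ident_closed] show ?thesis
    by (simp add: ra_one_def)
qed

lemma neg_join: "a \<in> univ \<AA> \<Longrightarrow> \<sim> a \<oplus> a = \<top>"
  by (simp add: join_comm join_neg)

text \<open>Huntington's equation, applied to \<open>\<sim> (\<sim> a)\<close> and to
  \<open>a\<close>, presents both as the same element joined with \<open>\<bottom>\<close>.\<close>

lemma neg_neg [simp]:
  assumes a: "a \<in> univ \<AA>" shows "\<sim> (\<sim> a) = a"
proof -
  have "\<bottom> \<oplus> \<sim> (\<sim> (\<sim> (\<sim> a)) \<oplus> \<sim> a) = \<sim> (\<sim> a)"
    using huntington[of "\<sim> (\<sim> a)" "\<sim> a"] a
    by (simp add: neg_join join_neg ra_zero_def[symmetric] join_comm)
  moreover have "\<sim> (\<sim> (\<sim> (\<sim> a)) \<oplus> \<sim> a) \<oplus> \<bottom> = a"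
    using huntington[of a "\<sim> (\<sim> a)"] a
    by (simp add: join_neg ra_zero_def[symmetric] join_comm)
  ultimately show ?thesis
    using a by (simp add: join_comm)
qed

lemma neg_top: "\<sim> \<top> = \<bottom>" and neg_bot: "\<sim> \<bottom> = \<top>"
  by (simp_all add: ra_zero_def)

text \<open>\<open>double\<close> almost says this. It helps to show first that
  \<open>\<top>\<close> and then that \<open>\<bottom>\<close> is idempotent; since
  \<open>double\<close> writes every \<open>a\<close> as a join with \<open>\<bottom>\<close>, a
  second \<open>\<bottom>\<close> is absorbed.\<close>

lemma join_bot:
  assumes a: "a \<in> univ \<AA>" shows "a \<oplus> \<bottom> = a"
proof -
  have double: "\<sim> (\<sim> b \<oplus> \<sim> b) \<oplus> \<bottom> = b" if "b \<in> univ \<AA>" for b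
    using huntington[OF that that] that by (simp add: neg_join neg_top)
  have top: "\<top> \<oplus> \<bottom> = \<top>"
    using join_neg[of \<top>] by (simp add: neg_top)
  have "\<top> = (\<top> \<oplus> \<top>) \<oplus> \<sim> (\<top> \<oplus> \<top>)"
    by (simp add: join_neg)
  then have "\<top> \<oplus> \<bottom> = (\<top> \<oplus> \<top>) \<oplus> (\<sim> (\<top> \<oplus> \<top>) \<oplus> \<bottom>)"
    by (metis bot_closed join_assoc join_closed neg_closed top_closed)
  also have "\<dots> = \<top> \<oplus> (\<top> \<oplus> \<bottom>)"
    using double[of \<bottom>] by (simp add: neg_bot join_assoc[symmetric])
  finally have "\<top> \<oplus> \<top> = \<top>"
    by (simp add: top)
  then have "\<bottom> \<oplus> \<bottom> = \<bottom>"
    using double[of \<bottom>] by (simp add: neg_bot neg_top)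
  then show ?thesis
    using double[OF a] a by (metis bot_closed join_assoc join_closed neg_closed)
qed

lemma join_idem [simp]:
  assumes a: "a \<in> univ \<AA>" shows "a \<oplus> a = a"
proof -
  have "\<sim> (a \<oplus> a) = \<sim> a"
    using huntington[of "\<sim> a" "\<sim> a"] a by (simp add: join_neg neg_top join_bot)
  then show ?thesis
    using a by (metis join_closed neg_neg)
qed

lemma le_refl: "a \<in> univ \<AA> \<Longrightarrow> a \<preceq> a"
  by (simp add: ra_le_def)

lemma le_trans:
  "a \<in> univ \<AA> \<Longrightarrow> b \<in> univ \<AA> \<Longrightarrow> c \<in> univ \<AA> \<Longrightarrow> a \<preceq> b \<Longrightarrow> b \<preceq> c \<Longrightarrow> a \<preceq> c"
  unfolding ra_le_def by (metis join_assoc)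

lemma le_antisym: "a \<in> univ \<AA> \<Longrightarrow> b \<in> univ \<AA> \<Longrightarrow> a \<preceq> b \<Longrightarrow> b \<preceq> a \<Longrightarrow> a = b"
  unfolding ra_le_def by (metis join_comm)

lemma le_join1: "a \<in> univ \<AA> \<Longrightarrow> b \<in> univ \<AA> \<Longrightarrow> a \<preceq> a \<oplus> b"
  by (simp add: ra_le_def join_assoc)

lemma le_join2: "a \<in> univ \<AA> \<Longrightarrow> b \<in> univ \<AA> \<Longrightarrow> b \<preceq> a \<oplus> b"
  using le_join1[of b a] by (simp add: join_comm)

lemma join_least:
  "a \<in> univ \<AA> \<Longrightarrow> b \<in> univ \<AA> \<Longrightarrow> c \<in> univ \<AA> \<Longrightarrow> a \<preceq> c \<Longrightarrow> b \<preceq> c \<Longrightarrow> a \<oplus> b \<preceq> c"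
  unfolding ra_le_def by (metis join_assoc)

lemma bot_le: "a \<in> univ \<AA> \<Longrightarrow> \<bottom> \<preceq> a"
  using join_bot[of a] by (simp add: ra_le_def join_comm)

lemma le_top: "a \<in> univ \<AA> \<Longrightarrow> a \<preceq> \<top>"
  using le_join1[of a "\<sim> a"] by (simp add: join_neg)

lemma neg_antitone:
  assumes "a \<in> univ \<AA>" "b \<in> univ \<AA>" "a \<preceq> b" shows "\<sim> b \<preceq> \<sim> a"
proof -
  have "\<sim> (a \<oplus> \<sim> b) \<oplus> \<sim> b = \<sim> a"
    using huntington[of "\<sim> a" b] assms by (simp add: ra_le_def)
  then show ?thesis
    using le_join2[of "\<sim> (a \<oplus> \<sim> b)" "\<sim> b"] assms by simp
qed

lemma meet_le1:
  assumes "a \<in> univ \<AA>" "b \<in> univ \<AA>" shows "\<sim> (\<sim> a \<oplus> \<sim> b) \<preceq> a"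
  using le_join1[of "\<sim> (\<sim> a \<oplus> \<sim> b)" "\<sim> (\<sim> a \<oplus> b)"] assms by (simp add: huntington)

lemma meet_le2:
  assumes "a \<in> univ \<AA>" "b \<in> univ \<AA>" shows "\<sim> (\<sim> a \<oplus> \<sim> b) \<preceq> b"
  using meet_le1[of b a] assms by (simp add: join_comm)

lemma meet_greatest:
  assumes "a \<in> univ \<AA>" "b \<in> univ \<AA>" "c \<in> univ \<AA>" "c \<preceq> a" "c \<preceq> b"
  shows "c \<preceq> \<sim> (\<sim> a \<oplus> \<sim> b)"
  using assms neg_antitone[of "\<sim> a \<oplus> \<sim> b" "\<sim> c"] join_least[of "\<sim> a" "\<sim> b" "\<sim> c"]
    neg_antitone[of c] by simp

lemma meet_neg: "a \<in> univ \<AA> \<Longrightarrow> \<sim> (\<sim> a \<oplus> a) = \<bottom>"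
  by (simp add: neg_join neg_top)

lemma le_by_cases:
  assumes "a \<in> univ \<AA>" "b \<in> univ \<AA>" "c \<in> univ \<AA>"
    and "\<sim> (\<sim> c \<oplus> \<sim> a) \<preceq> b" "\<sim> (\<sim> c \<oplus> a) \<preceq> b"
  shows "c \<preceq> b"
  using join_least[of "\<sim> (\<sim> c \<oplus> \<sim> a)" "\<sim> (\<sim> c \<oplus> a)" b] huntington[of c a] assms by simp

lemma neg_le_of_join_top:
  assumes "a \<in> univ \<AA>" "b \<in> univ \<AA>" "a \<oplus> b = \<top>" shows "\<sim> a \<preceq> b"
proof (rule le_by_cases[of b])
  show "\<sim> (\<sim> (\<sim> a) \<oplus> \<sim> b) \<preceq> b"
    using assms by (intro meet_le2) simp_all
qed (use assms in \<open>simp_all add: neg_top bot_le\<close>)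

section \<open>Converse and relative product\<close>

lemma conv_le:
  assumes "a \<in> univ \<AA>" "b \<in> univ \<AA>" "a \<preceq> b" shows "a\<smile> \<preceq> b\<smile>"
  using assms by (metis conv_join ra_le_def)

lemma conv_top: "\<top>\<smile> = \<top>"
  using conv_le[of "\<top>\<smile>" \<top>] le_top by (intro le_antisym) simp_all

text \<open>The converses of complementary elements join to \<open>\<top>\<close>, which gives one
  inclusion for every element; taken at \<open>a\<smile>\<close> and followed by converse, it gives
  the other.\<close>

lemma conv_neg:
  assumes a: "a \<in> univ \<AA>" shows "(\<sim> a)\<smile> = \<sim> (a\<smile>)"
proof (rule le_antisym)
  have le: "\<sim> (b\<smile>) \<preceq> (\<sim> b)\<smile>" if b: "b \<in> univ \<AA>" for b
    using b by (intro neg_le_of_join_top) (simp_all add: conv_join[symmetric] join_neg conv_top)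
  from le[OF a] show "\<sim> (a\<smile>) \<preceq> (\<sim> a)\<smile>" .
  show "(\<sim> a)\<smile> \<preceq> \<sim> (a\<smile>)"
    using conv_le[OF _ _ le[of "a\<smile>"]] a by simp
qed (use a in simp_all)

lemma conv_bot: "\<bottom>\<smile> = \<bottom>"
  by (simp add: conv_neg conv_top ra_zero_def)

lemma conv_ident: "\<one>'\<smile> = \<one>'"
  by (metis conv_conv conv_semi conv_closed ident_closed semi_ident)

text \<open>The axioms on \<open>\<odot>\<close> are one-sided; taking converses reverses them, here
  and for left distributivity and \<open>residual_le_right\<close>.\<close>

lemma ident_semi:
  assumes "a \<in> univ \<AA>" shows "\<one>' \<odot> a = a"
proof -
  have "(\<one>' \<odot> a)\<smile> = a\<smile>"
    using assms by (simp add: conv_semi conv_ident semi_ident)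
  then show ?thesis
    using assms by (metis conv_conv ident_closed semi_closed)
qed

lemma semi_distrib_left:
  assumes "a \<in> univ \<AA>" "b \<in> univ \<AA>" "c \<in> univ \<AA>"
  shows "c \<odot> (a \<oplus> b) = c \<odot> a \<oplus> c \<odot> b"
proof -
  have "(c \<odot> (a \<oplus> b))\<smile> = (c \<odot> a \<oplus> c \<odot> b)\<smile>"
    using assms by (simp add: conv_semi conv_join semi_distrib)
  then show ?thesis
    using assms by (metis conv_conv join_closed semi_closed)
qed

lemma semi_le:
  assumes "a \<in> univ \<AA>" "a' \<in> univ \<AA>" "b \<in> univ \<AA>" "b' \<in> univ \<AA>" "a \<preceq> a'" "b \<preceq> b'"
  shows "a \<odot> b \<preceq> a' \<odot> b'"
proof -
  have "a \<odot> b \<oplus> a' \<odot> b = a' \<odot> b" "a' \<odot> b \<oplus> a' \<odot> b' = a' \<odot> b'"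
    using assms semi_distrib[of a a' b] semi_distrib_left[of b b' a'] by (simp_all add: ra_le_def)
  then show ?thesis
    using le_trans[of "a \<odot> b" "a' \<odot> b" "a' \<odot> b'"] assms by (simp add: ra_le_def)
qed

lemma residual_le:
  assumes "a \<in> univ \<AA>" "b \<in> univ \<AA>" shows "a\<smile> \<odot> \<sim> (a \<odot> b) \<preceq> \<sim> b"
  using conv_residual[OF assms] by (simp add: ra_le_def)

lemma residual_le_right:
  assumes "a \<in> univ \<AA>" "b \<in> univ \<AA>" shows "\<sim> (a \<odot> b) \<odot> b\<smile> \<preceq> \<sim> a"
  using conv_le[OF _ _ residual_le[of "b\<smile>" "a\<smile>"]] assms
  by (simp add: conv_semi conv_neg)

text \<open>Enlarging \<open>\<bottom>\<close> to the complement of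
  \<open>a\<smile> \<odot> \<top>\<close> brings the residual law into play, whose bound is the
  complement of \<open>\<top>\<close>.\<close>

lemma semi_bot:
  assumes "a \<in> univ \<AA>" shows "a \<odot> \<bottom> \<preceq> \<bottom>"
proof (rule le_trans)
  show "a \<odot> \<bottom> \<preceq> a \<odot> \<sim> (a\<smile> \<odot> \<top>)"
    using assms by (intro semi_le) (simp_all add: le_refl bot_le)
  show "a \<odot> \<sim> (a\<smile> \<odot> \<top>) \<preceq> \<bottom>"
    using residual_le[of "a\<smile>" \<top>] assms by (simp add: neg_top)
qed (use assms in simp_all)

lemma bot_semi:
  assumes "a \<in> univ \<AA>" shows "\<bottom> \<odot> a \<preceq> \<bottom>"
  using conv_le[OF _ _ semi_bot[of "a\<smile>"]] assms by (simp add: conv_semi conv_bot)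

lemma hom_entailment:
  assumes h: "h \<in> alg_hom \<PP> \<AA>" and "integral_alg \<AA>" "dense_alg \<AA>"
  shows "entailment (\<lambda>A B. h A \<preceq> h B)"
proof
  have [simp]: "h A \<in> univ \<AA>" "h (A \<^bold>+ B) = h A \<oplus> h B" "h (\<^bold>- A) = \<sim> h A"
    "h (A \<^bold>; B) = h A \<odot> h B" "h (A\<^bold>\<smile>) = (h A)\<smile>" "h \<^bold>1' = \<one>'" for A B
    using h by (simp_all add: alg_hom_def pred_alg_def)
  have [simp]: "\<sim> (\<one>' \<oplus> \<sim> \<one>') = \<bottom>"
    by (simp add: ra_zero_def ra_one_def)
  fix A A' B B' C
  show "h A \<preceq> h A"
    by (simp add: le_refl)
  show "h A \<preceq> h B \<Longrightarrow> h B \<preceq> h C \<Longrightarrow> h A \<preceq> h C"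
    by (rule le_trans[of _ "h B"]) simp_all
  show "h A \<preceq> h (A \<^bold>+ B)" "h B \<preceq> h (A \<^bold>+ B)"
    by (simp_all add: le_join1 le_join2)
  show "h A \<preceq> h C \<Longrightarrow> h B \<preceq> h C \<Longrightarrow> h (A \<^bold>+ B) \<preceq> h C"
    by (simp add: join_least)
  show "h (A \<^bold>\<sqinter> B) \<preceq> h A" "h (A \<^bold>\<sqinter> B) \<preceq> h B"
    by (simp_all add: meet_le1 meet_le2)
  show "h C \<preceq> h A \<Longrightarrow> h C \<preceq> h B \<Longrightarrow> h C \<preceq> h (A \<^bold>\<sqinter> B)"
    by (simp add: meet_greatest)
  show "h (C \<^bold>\<sqinter> A) \<preceq> h B \<Longrightarrow> h (C \<^bold>\<sqinter> \<^bold>- A) \<preceq> h B \<Longrightarrow> h C \<preceq> h B"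
    by (rule le_by_cases[of "h A"]) simp_all
  show "h (A \<^bold>\<sqinter> \<^bold>- A) \<preceq> h B"
    by (simp add: meet_neg bot_le)
  show "h A \<preceq> h A' \<Longrightarrow> h B \<preceq> h B' \<Longrightarrow> h (A \<^bold>; B) \<preceq> h (A' \<^bold>; B')"
    by (simp add: semi_le)
  show "h ((A \<^bold>+ B) \<^bold>; C) \<preceq> h (A \<^bold>; C \<^bold>+ B \<^bold>; C)"
    by (simp add: semi_distrib le_refl)
  show "h (A \<^bold>; (B \<^bold>+ C)) \<preceq> h (A \<^bold>; B \<^bold>+ A \<^bold>; C)"
    by (simp add: semi_distrib_left le_refl)
  show "h (\<^bold>\<bottom> \<^bold>; A) \<preceq> h \<^bold>\<bottom>" "h (A \<^bold>; \<^bold>\<bottom>) \<preceq> h \<^bold>\<bottom>"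
    by (simp_all add: semi_bot bot_semi)
  show "h ((A \<^bold>; B) \<^bold>; C) \<preceq> h (A \<^bold>; (B \<^bold>; C))"
    by (simp add: semi_assoc le_refl)
  show "h (A \<^bold>; \<^bold>1') \<preceq> h A" "h A \<preceq> h (A \<^bold>; \<^bold>1')" "h (\<^bold>1' \<^bold>; A) \<preceq> h A"
    by (simp_all add: semi_ident ident_semi le_refl)
  show "h A \<preceq> h B \<Longrightarrow> h (A\<^bold>\<smile>) \<preceq> h (B\<^bold>\<smile>)"
    by (simp add: conv_le)
  show "h (A\<^bold>\<smile>\<^bold>\<smile>) \<preceq> h A" "h A \<preceq> h (A\<^bold>\<smile>\<^bold>\<smile>)"
    by (simp_all add: le_refl)
  show "h (A\<^bold>\<smile> \<^bold>; \<^bold>- (A \<^bold>; B)) \<preceq> h (\<^bold>- B)"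
    by (simp add: residual_le)
  show "h (\<^bold>- (A \<^bold>; B) \<^bold>; B\<^bold>\<smile>) \<preceq> h (\<^bold>- A)"
    by (simp add: residual_le_right)
  have bot: "a = \<bottom>" if "a \<preceq> \<bottom>" "a \<in> univ \<AA>" for a
    using that bot_le by (intro le_antisym) simp_all
  show "h A \<preceq> h \<^bold>\<bottom> \<or> h B \<preceq> h \<^bold>\<bottom>" if "h (A \<^bold>; B) \<preceq> h \<^bold>\<bottom>"
  proof -
    have "h A \<odot> h B = \<bottom>"
      using bot[of "h A \<odot> h B"] that by simp
    then have "h A = \<bottom> \<or> h B = \<bottom>"
      using assms(2) \<open>\<And>A. h A \<in> univ \<AA>\<close> unfolding integral_alg_def by blast
    then show ?thesis
      using le_refl[of \<bottom>] by auto
  qed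
  show "h A \<preceq> h (A \<^bold>; A)"
    using assms(3) by (simp add: dense_alg_def)
qed

end

text \<open>The ultrafilters consist of predicates, compared by their values under \<open>h\<close>,
  rather than of elements of the algebra; so the frame lives on the same type whatever the
  algebra.\<close>

lemma algebra_refutation_frame:
  assumes ra: "relation_algebra \<AA>" "integral_alg \<AA>" "dense_alg \<AA>"
    and "\<not> true_in \<AA> (\<^bold>1' \<^bold>\<le> A)"
  shows "\<exists>F :: predicate set frame. integral_dense_frame F \<and> \<not> valid_in F A \<and>
    (commutative_alg \<AA> \<longrightarrow> commutativity_cond F) \<and> (symmetric_alg \<AA> \<longrightarrow> symmetry_cond F)"
proof -
  interpret relation_algebra \<AA> by fact
  obtain h where h: "h \<in> alg_hom \<PP> \<AA>" and "h (\<^bold>1' \<^bold>+ A) \<noteq> h A"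
    using assms(4) by (auto simp: ineq_def)
  have hom: "h A \<in> univ \<AA>" "h (A \<^bold>+ B) = h A \<oplus>\<^bsub>\<AA>\<^esub> h B" "h (A \<^bold>; B) = h A \<odot>\<^bsub>\<AA>\<^esub> h B"
    "h (A\<^bold>\<smile>) = (h A)\<smile>\<^bsub>\<AA>\<^esub>"
    for A B
    using h by (simp_all add: alg_hom_def pred_alg_def)
  interpret entailment "\<lambda>A B. ra_le \<AA> (h A) (h B)"
    using hom_entailment[OF h ra(2,3)] .
  have not_le: "\<not> ra_le \<AA> (h \<^bold>1') (h A)"
    using \<open>h (\<^bold>1' \<^bold>+ A) \<noteq> h A\<close> by (simp add: ra_le_def hom)
  show ?thesis
  proof (intro exI conjI impI)
    show "integral_dense_frame canonical_frame" "\<not> valid_in canonical_frame A"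
      using not_le by (rule canonical_integral_dense canonical_not_valid)+
    show "commutativity_cond canonical_frame" if "commutative_alg \<AA>"
      using that relation_algebra.le_refl[OF ra(1)]
      by (intro canonical_commutative) (simp add: commutative_alg_def hom)
    show "symmetry_cond canonical_frame" if "symmetric_alg \<AA>"
      using that relation_algebra.le_refl[OF ra(1)]
      by (intro canonical_symmetric) (simp add: symmetric_alg_def hom)
  qed
qed

section \<open>Completeness of the four-variable calculus\<close>

primrec idx :: "var \<Rightarrow> nat"
  where "idx V0 = 0" | "idx V1 = 1" | "idx V2 = 2" | "idx V3 = 3"

definition close :: "var list \<Rightarrow> fm \<Rightarrow> fm"
  where "close s \<phi> = foldr FAll s \<phi>"

lemma close_simps [simp]:
  "close [] \<phi> = \<phi>" "close (x # s) \<phi> = FAll x (close s \<phi>)" "close (s @ t) \<phi> = close s (close t \<phi>)"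
  by (simp_all add: close_def)

text \<open>The closure binds the largest free variable innermost; hence the sorted prefixes and the
  peeling from their end in what follows.\<close>

lemma uclosure_max:
  assumes "x \<in> fv \<phi>" "\<forall>y\<in>fv \<phi>. idx y \<le> idx x"
  shows "uclosure \<phi> = uclosure (FAll x \<phi>)"
proof -
  have "y \<notin> fv \<phi>" if "idx y > idx x" for y
    using assms(2) that by force
  then show ?thesis
    using assms(1) by (cases x) (auto simp: uclosure_def)
qed

lemma uclosure_sentence: "fv \<phi> = {} \<Longrightarrow> uclosure \<phi> = \<phi>"
  by (simp add: uclosure_def)

text \<open>The axioms are closures over exactly the free variables, so modus ponens under a fixed prefix of
  quantifiers needs closures padded with vacuous quantifiers; both are proved together, along the prefix.\<close>

lemma prov4_close:
  assumes "sorted_wrt (\<lambda>x y. idx x < idx y) s"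
  shows "(\<forall>\<phi>. fv \<phi> \<subseteq> set s \<longrightarrow> prov4 \<Psi> (uclosure \<phi>) \<longrightarrow> prov4 \<Psi> (close s \<phi>)) \<and>
    (\<forall>\<phi> \<psi>. fv \<phi> \<subseteq> set s \<longrightarrow> fv \<psi> \<subseteq> set s \<longrightarrow> prov4 \<Psi> (close s (\<phi> \<^bold>\<rightarrow> \<psi>)) \<longrightarrow>
      prov4 \<Psi> (close s \<phi>) \<longrightarrow> prov4 \<Psi> (close s \<psi>))"
  using assms
proof (induction s rule: rev_induct)
  case Nil
  then show ?case
    using uclosure_sentence mp by fastforce
next
  case (snoc x s)
  have idx: "\<forall>y\<in>set s. idx y < idx x" and sorted: "sorted_wrt (\<lambda>x y. idx x < idx y) s"
    using snoc.prems by (auto simp: sorted_wrt_append)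
  have ext: "\<Psi> \<turnstile>\<^sub>4 close s \<phi>" if "fv \<phi> \<subseteq> set s" "\<Psi> \<turnstile>\<^sub>4 uclosure \<phi>" for \<phi>
    using snoc.IH[OF sorted, THEN conjunct1] that by simp
  have step: "\<Psi> \<turnstile>\<^sub>4 close s \<psi>"
    if "\<Psi> \<turnstile>\<^sub>4 close s \<phi>" "fv \<phi> \<subseteq> set s" "fv \<psi> \<subseteq> set s" "\<Psi> \<turnstile>\<^sub>4 close s (\<phi> \<^bold>\<rightarrow> \<psi>)" for \<phi> \<psi>
    by (rule snoc.IH[OF sorted, THEN conjunct2, rule_format, OF that(2,3,4,1)])
  show ?case
  proof (intro conjI allI impI)
    fix \<phi> assume \<phi>: "fv \<phi> \<subseteq> set (s @ [x])" "\<Psi> \<turnstile>\<^sub>4 uclosure \<phi>"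
    have "\<Psi> \<turnstile>\<^sub>4 close s (FAll x \<phi>)"
    proof (cases "x \<in> fv \<phi>")
      case True
      have "\<forall>y\<in>fv \<phi>. idx y \<le> idx x"
        using \<phi>(1) idx by fastforce
      note max = uclosure_max[OF True this]
      show ?thesis
        by (rule ext) (use \<phi> max in auto)
    next
      case False
      then have fv: "fv \<phi> \<subseteq> set s"
        using \<phi>(1) by auto
      show ?thesis
        by (rule step[OF ext[OF fv \<phi>(2)] fv _ ext[OF _ ax[OF Ax7[OF False]]]]) (use fv in auto)
    qed
    then show "\<Psi> \<turnstile>\<^sub>4 close (s @ [x]) \<phi>"
      by simp
  next
    fix \<phi> \<psi> assume fv: "fv \<phi> \<subseteq> set (s @ [x])" "fv \<psi> \<subseteq> set (s @ [x])"
      and imp: "\<Psi> \<turnstile>\<^sub>4 close (s @ [x]) (\<phi> \<^bold>\<rightarrow> \<psi>)" and hyp: "\<Psi> \<turnstile>\<^sub>4 close (s @ [x]) \<phi>"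
    have fvs: "fv (FAll x \<phi>) \<subseteq> set s" "fv (FAll x \<psi>) \<subseteq> set s"
      using fv by auto
    have "\<Psi> \<turnstile>\<^sub>4 close s (FAll x (\<phi> \<^bold>\<rightarrow> \<psi>))"
      using imp by simp
    then have imp': "\<Psi> \<turnstile>\<^sub>4 close s (FAll x \<phi> \<^bold>\<rightarrow> FAll x \<psi>)"
      by (rule step[OF _ _ _ ext[OF _ ax[OF Ax5]]]) (use fvs in auto)
    have "\<Psi> \<turnstile>\<^sub>4 close s (FAll x \<phi>)"
      using hyp by simp
    then have "\<Psi> \<turnstile>\<^sub>4 close s (FAll x \<psi>)"
      by (rule step[OF _ fvs imp'])
    then show "\<Psi> \<turnstile>\<^sub>4 close (s @ [x]) \<psi>"
      by simp
  qed
qed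

lemmas prov4_close_ext = prov4_close[THEN conjunct1, rule_format]
lemmas prov4_close_mp = prov4_close[THEN conjunct2, rule_format]

lemma prov4_close_step:
  assumes "\<Psi> \<turnstile>\<^sub>4 close s \<phi>" "uclosure (\<phi> \<^bold>\<rightarrow> \<psi>) \<in> axioms4"
    and "sorted_wrt (\<lambda>x y. idx x < idx y) s" "fv \<phi> \<subseteq> set s" "fv \<psi> \<subseteq> set s"
  shows "\<Psi> \<turnstile>\<^sub>4 close s \<psi>"
  using assms(4,5)
  by (intro prov4_close_mp[OF assms(3) _ _ prov4_close_ext[OF assms(3) _ ax[OF assms(2)]] assms(1)])
    auto

text \<open>With all four variables bound, every formula becomes a sentence, on which modus ponens
  and generalization act uniformly.\<close>

abbreviation full :: "fm \<Rightarrow> fm"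
  where "full \<phi> \<equiv> close [V0, V1, V2, V3] \<phi>"

lemma fv_close: "fv (close s \<phi>) = fv \<phi> - set s"
  by (induction s) auto

lemma fv_full: "fv (full \<phi>) = {}"
  using var_UNIV unfolding fv_close by auto

text \<open>Ax4 moves the quantifier on \<open>x\<close> inwards through the prefix until it stands
  next to the formula, and Ax7 refills the vacated place with a vacuous quantifier.\<close>

lemma prov4_full_gen:
  assumes "\<Psi> \<turnstile>\<^sub>4 full \<phi>" shows "\<Psi> \<turnstile>\<^sub>4 full (FAll x \<phi>)"
proof -
  have sub: "X \<subseteq> set s" if "set s \<union> t = UNIV" "X \<inter> t = {}" for X t and s :: "var list"
    using that by blast
  show ?thesis
  proof (cases x)
    case V0
    have "\<Psi> \<turnstile>\<^sub>4 close [] (FAll V0 (FAll V1 (FAll V2 (FAll V3 \<phi>))))"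
      using assms by simp
    then have "\<Psi> \<turnstile>\<^sub>4 close [] (FAll V1 (FAll V0 (FAll V2 (FAll V3 \<phi>))))"
      by (rule prov4_close_step[OF _ Ax4]) (use var_UNIV in auto)
    then have "\<Psi> \<turnstile>\<^sub>4 close [V1] (FAll V0 (FAll V2 (FAll V3 \<phi>)))"
      by simp
    then have "\<Psi> \<turnstile>\<^sub>4 close [V1] (FAll V2 (FAll V0 (FAll V3 \<phi>)))"
      by (rule prov4_close_step[OF _ Ax4]) (use var_UNIV in auto)
    then have "\<Psi> \<turnstile>\<^sub>4 close [V1, V2] (FAll V0 (FAll V3 \<phi>))"
      by simp
    then have "\<Psi> \<turnstile>\<^sub>4 close [V1, V2] (FAll V3 (FAll V0 \<phi>))"
      by (rule prov4_close_step[OF _ Ax4]) (use var_UNIV in auto)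
    then have "\<Psi> \<turnstile>\<^sub>4 close [] (FAll V1 (FAll V2 (FAll V3 (FAll V0 \<phi>))))"
      by simp
    then have "\<Psi> \<turnstile>\<^sub>4 close [] (FAll V0 (FAll V1 (FAll V2 (FAll V3 (FAll V0 \<phi>)))))"
      by (rule prov4_close_step[OF _ Ax7]) (use var_UNIV in auto)
    then show ?thesis
      by (simp add: V0)
  next
    case V1
    have "\<Psi> \<turnstile>\<^sub>4 close [V0] (FAll V1 (FAll V2 (FAll V3 \<phi>)))"
      using assms by simp
    then have "\<Psi> \<turnstile>\<^sub>4 close [V0] (FAll V2 (FAll V1 (FAll V3 \<phi>)))"
      by (rule prov4_close_step[OF _ Ax4]) (use var_UNIV in auto)
    then have "\<Psi> \<turnstile>\<^sub>4 close [V0, V2] (FAll V1 (FAll V3 \<phi>))"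
      by simp
    then have "\<Psi> \<turnstile>\<^sub>4 close [V0, V2] (FAll V3 (FAll V1 \<phi>))"
      by (rule prov4_close_step[OF _ Ax4]) (use var_UNIV in auto)
    then have "\<Psi> \<turnstile>\<^sub>4 close [V0] (FAll V2 (FAll V3 (FAll V1 \<phi>)))"
      by simp
    then have "\<Psi> \<turnstile>\<^sub>4 close [V0] (FAll V1 (FAll V2 (FAll V3 (FAll V1 \<phi>))))"
      by (rule prov4_close_step[OF _ Ax7]) (use var_UNIV in auto)
    then show ?thesis
      by (simp add: V1)
  next
    case V2
    have "\<Psi> \<turnstile>\<^sub>4 close [V0, V1] (FAll V2 (FAll V3 \<phi>))"
      using assms by simp
    then have "\<Psi> \<turnstile>\<^sub>4 close [V0, V1] (FAll V3 (FAll V2 \<phi>))"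
      by (rule prov4_close_step[OF _ Ax4]) (use var_UNIV in auto)
    then have "\<Psi> \<turnstile>\<^sub>4 close [V0, V1] (FAll V2 (FAll V3 (FAll V2 \<phi>)))"
      by (rule prov4_close_step[OF _ Ax7]) (use var_UNIV in auto)
    then show ?thesis
      by (simp add: V2)
  next
    case V3
    have "\<Psi> \<turnstile>\<^sub>4 close [V0, V1, V2] (FAll V3 \<phi>)"
      using assms by simp
    then have "\<Psi> \<turnstile>\<^sub>4 close [V0, V1, V2] (FAll V3 (FAll V3 \<phi>))"
      by (rule prov4_close_step[OF _ Ax7]) (use var_UNIV in auto)
    then show ?thesis
      by (simp add: V3)
  qed
qed

lemma subset_vars: "X \<subseteq> set [V0, V1, V2, V3]"
  using var_UNIV by auto

lemma prov4_full_ext: "\<Psi> \<turnstile>\<^sub>4 uclosure \<phi> \<Longrightarrow> \<Psi> \<turnstile>\<^sub>4 full \<phi>"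
  by (rule prov4_close_ext[OF _ subset_vars]) simp

lemma prov4_full_mp:
  assumes "\<Psi> \<turnstile>\<^sub>4 full (\<phi> \<^bold>\<rightarrow> \<psi>)" "\<Psi> \<turnstile>\<^sub>4 full \<phi>" shows "\<Psi> \<turnstile>\<^sub>4 full \<psi>"
  by (rule prov4_close_mp[OF _ subset_vars subset_vars assms]) simp

lemma prov4_full_sentence:
  assumes "fv \<phi> = {}" shows "prov4 \<Psi> (full \<phi>) \<longleftrightarrow> prov4 \<Psi> \<phi>"
proof
  assume "\<Psi> \<turnstile>\<^sub>4 \<phi>"
  then show "\<Psi> \<turnstile>\<^sub>4 full \<phi>"
    using prov4_full_ext[of \<Psi> \<phi>] uclosure_sentence[OF assms] by simp
next
  have elim: "\<Psi> \<turnstile>\<^sub>4 \<psi>" if "\<Psi> \<turnstile>\<^sub>4 FAll x \<psi>" "fv \<psi> = {}" for x \<psi>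
  proof (rule mp[OF ax that(1)])
    show "(FAll x \<psi> \<^bold>\<rightarrow> \<psi>) \<in> axioms4"
      using Ax6[of x \<psi>] that(2) by (simp add: uclosure_sentence)
  qed
  assume "\<Psi> \<turnstile>\<^sub>4 full \<phi>"
  then show "\<Psi> \<turnstile>\<^sub>4 \<phi>"
    using assms by (auto dest!: elim)
qed

text \<open>Open formulas count as theorems and generalization as a rule. This covers provability
  and, later, the complete extension read off from a valuation.\<close>

locale theory4 =
  fixes G :: "fm \<Rightarrow> bool"
  assumes ax: "uclosure \<phi> \<in> axioms4 \<Longrightarrow> G \<phi>"
    and mp: "G (\<phi> \<^bold>\<rightarrow> \<psi>) \<Longrightarrow> G \<phi> \<Longrightarrow> G \<psi>"
    and gen: "G \<phi> \<Longrightarrow> G (FAll x \<phi>)"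

lemma theory4_prov4: "theory4 (\<lambda>\<phi>. \<Psi> \<turnstile>\<^sub>4 full \<phi>)"
proof
  show "\<Psi> \<turnstile>\<^sub>4 full \<phi>" if "uclosure \<phi> \<in> axioms4" for \<phi>
    using that by (intro prov4_full_ext ax)
  show "\<Psi> \<turnstile>\<^sub>4 full \<psi>" if "\<Psi> \<turnstile>\<^sub>4 full (\<phi> \<^bold>\<rightarrow> \<psi>)" "\<Psi> \<turnstile>\<^sub>4 full \<phi>" for \<phi> \<psi>
    using that by (rule prov4_full_mp)
  show "\<Psi> \<turnstile>\<^sub>4 full (FAll x \<phi>)" if "\<Psi> \<turnstile>\<^sub>4 full \<phi>" for \<phi> x
    using that by (rule prov4_full_gen)
qed

context theory4
begin

text \<open>Ax1 to Ax3 are the axioms of Lukasiewicz; K and S are derived from them in his way.\<close>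

lemma luk1: "G ((\<phi> \<^bold>\<rightarrow> \<psi>) \<^bold>\<rightarrow> ((\<psi> \<^bold>\<rightarrow> \<xi>) \<^bold>\<rightarrow> (\<phi> \<^bold>\<rightarrow> \<xi>)))"
  by (rule ax[OF Ax1])

lemma luk2: "G ((\<^bold>\<not> \<phi> \<^bold>\<rightarrow> \<phi>) \<^bold>\<rightarrow> \<phi>)"
  by (rule ax[OF Ax2])

lemma luk3: "G (\<phi> \<^bold>\<rightarrow> (\<^bold>\<not> \<phi> \<^bold>\<rightarrow> \<psi>))"
  by (rule ax[OF Ax3])

lemma syl: "G (\<phi> \<^bold>\<rightarrow> \<psi>) \<Longrightarrow> G (\<psi> \<^bold>\<rightarrow> \<xi>) \<Longrightarrow> G (\<phi> \<^bold>\<rightarrow> \<xi>)"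
  by (rule mp[OF mp[OF luk1]])

lemma luk4: "G ((\<phi> \<^bold>\<rightarrow> \<^bold>\<not> \<psi>) \<^bold>\<rightarrow> (((\<phi> \<^bold>\<rightarrow> \<chi>) \<^bold>\<rightarrow> \<theta>) \<^bold>\<rightarrow> (\<psi> \<^bold>\<rightarrow> \<theta>)))"
proof -
  have "G ((\<phi> \<^bold>\<rightarrow> \<^bold>\<not> \<psi>) \<^bold>\<rightarrow> (\<psi> \<^bold>\<rightarrow> (\<phi> \<^bold>\<rightarrow> \<chi>)))"
    by (rule syl[OF luk1 mp[OF luk1 luk3]])
  then show ?thesis
    by (rule syl[OF _ luk1])
qed

lemma luk5: "G (\<phi> \<^bold>\<rightarrow> (((\<^bold>\<not> \<phi> \<^bold>\<rightarrow> \<psi>) \<^bold>\<rightarrow> \<chi>) \<^bold>\<rightarrow> (\<theta> \<^bold>\<rightarrow> \<chi>)))"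
  by (rule syl[OF luk3 luk4])

lemma luk6: "G ((((\<^bold>\<not> \<phi> \<^bold>\<rightarrow> \<phi>) \<^bold>\<rightarrow> \<phi>) \<^bold>\<rightarrow> \<psi>) \<^bold>\<rightarrow> \<psi>)"
proof -
  \<comment> \<open>K is not yet available: this weakening of an instance of Ax2 comes from
    \<open>luk5\<close>, detached by that instance and by Ax2 applied to that instance.\<close>
  have "G (\<^bold>\<not> \<psi> \<^bold>\<rightarrow> ((\<^bold>\<not> \<phi> \<^bold>\<rightarrow> \<phi>) \<^bold>\<rightarrow> \<phi>))"
    by (rule mp[OF mp[OF luk5 luk2] luk2])
  then show ?thesis
    by (rule syl[OF mp[OF luk1] luk2])
qed

lemma imp_K: "G (\<phi> \<^bold>\<rightarrow> (\<psi> \<^bold>\<rightarrow> \<phi>))"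
  by (rule syl[OF luk5 luk6])

lemma imp_contract: "G ((\<phi> \<^bold>\<rightarrow> (\<phi> \<^bold>\<rightarrow> \<psi>)) \<^bold>\<rightarrow> (\<phi> \<^bold>\<rightarrow> \<psi>))"
proof -
  have "G (\<^bold>\<not> (\<phi> \<^bold>\<rightarrow> \<psi>) \<^bold>\<rightarrow> ((\<phi> \<^bold>\<rightarrow> \<psi>) \<^bold>\<rightarrow> \<psi>))"
    by (rule syl[OF syl[OF imp_K luk4] luk6])
  then have "G ((((\<phi> \<^bold>\<rightarrow> \<psi>) \<^bold>\<rightarrow> \<psi>) \<^bold>\<rightarrow> (\<phi> \<^bold>\<rightarrow> \<psi>)) \<^bold>\<rightarrow> (\<phi> \<^bold>\<rightarrow> \<psi>))"
    by (rule syl[OF mp[OF luk1] luk2])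
  then show ?thesis
    by (rule syl[OF luk1])
qed

lemma imp_swap: "G ((\<phi> \<^bold>\<rightarrow> (\<psi> \<^bold>\<rightarrow> \<chi>)) \<^bold>\<rightarrow> (\<psi> \<^bold>\<rightarrow> (\<phi> \<^bold>\<rightarrow> \<chi>)))"
proof -
  have "G (\<psi> \<^bold>\<rightarrow> ((\<psi> \<^bold>\<rightarrow> \<chi>) \<^bold>\<rightarrow> \<chi>))"
    by (rule syl[OF syl[OF imp_K luk1] imp_contract])
  then show ?thesis
    by (rule syl[OF luk1 mp[OF luk1]])
qed

lemma imp_mono: "G ((\<phi> \<^bold>\<rightarrow> \<psi>) \<^bold>\<rightarrow> ((\<chi> \<^bold>\<rightarrow> \<phi>) \<^bold>\<rightarrow> (\<chi> \<^bold>\<rightarrow> \<psi>)))"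
  by (rule mp[OF imp_swap luk1])

lemma imp_S: "G ((\<phi> \<^bold>\<rightarrow> (\<psi> \<^bold>\<rightarrow> \<chi>)) \<^bold>\<rightarrow> ((\<phi> \<^bold>\<rightarrow> \<psi>) \<^bold>\<rightarrow> (\<phi> \<^bold>\<rightarrow> \<chi>)))"
  by (rule syl[OF imp_swap syl[OF imp_mono mp[OF imp_mono imp_contract]]])

lemma imp_refl: "G (\<phi> \<^bold>\<rightarrow> \<phi>)"
  by (rule mp[OF mp[OF imp_S imp_K] imp_K])

lemma not_not_elim: "G (\<^bold>\<not> (\<^bold>\<not> \<phi>) \<^bold>\<rightarrow> \<phi>)"
  by (rule syl[OF mp[OF imp_swap luk3] luk2])

lemma contrapos_elim: "G ((\<^bold>\<not> \<psi> \<^bold>\<rightarrow> \<^bold>\<not> \<phi>) \<^bold>\<rightarrow> (\<phi> \<^bold>\<rightarrow> \<psi>))"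
  by (rule syl[OF luk4 mp[OF mp[OF imp_swap imp_refl] luk2]])

lemma contrapos_intro: "G ((\<phi> \<^bold>\<rightarrow> \<psi>) \<^bold>\<rightarrow> (\<^bold>\<not> \<psi> \<^bold>\<rightarrow> \<^bold>\<not> \<phi>))"
  by (rule syl[OF mp[OF luk1 not_not_elim]
        syl[OF mp[OF imp_mono mp[OF contrapos_elim not_not_elim]] contrapos_elim]])

lemma imp_cases: "G ((\<phi> \<^bold>\<rightarrow> \<psi>) \<^bold>\<rightarrow> ((\<^bold>\<not> \<phi> \<^bold>\<rightarrow> \<psi>) \<^bold>\<rightarrow> \<psi>))"
  by (rule syl[OF contrapos_intro syl[OF luk1 mp[OF imp_mono luk2]]])

text \<open>Propositional valuations that make all theorems true. Atoms, equations and quantified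
  formulas all act as propositional variables; no witnesses for existential formulas are
  demanded.\<close>

definition val :: "fm set \<Rightarrow> bool"
  where "val M \<longleftrightarrow> (\<forall>\<phi>. G \<phi> \<longrightarrow> \<phi> \<in> M) \<and> (\<forall>\<phi> \<psi>. (\<phi> \<^bold>\<rightarrow> \<psi>) \<in> M \<longleftrightarrow> (\<phi> \<in> M \<longrightarrow> \<psi> \<in> M)) \<and>
    (\<forall>\<phi>. (\<^bold>\<not> \<phi>) \<in> M \<longleftrightarrow> \<phi> \<notin> M)"

lemma val_thm: "val M \<Longrightarrow> G \<phi> \<Longrightarrow> \<phi> \<in> M"
  and val_imp [simp]: "val M \<Longrightarrow> (\<phi> \<^bold>\<rightarrow> \<psi>) \<in> M \<longleftrightarrow> (\<phi> \<in> M \<longrightarrow> \<psi> \<in> M)"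
  and val_not [simp]: "val M \<Longrightarrow> (\<^bold>\<not> \<phi>) \<in> M \<longleftrightarrow> \<phi> \<notin> M"
  unfolding val_def by blast+

text \<open>Lindenbaum's lemma. Maximality is relative to omitting \<open>\<phi>\<close>, so
  \<open>ded\<close> first shows that every formula outside \<open>S\<close> implies
  \<open>\<phi>\<close> in \<open>S\<close>; by \<open>imp_cases\<close> a formula and its negation
  cannot both be outside.\<close>

lemma val_exists:
  assumes "\<not> G \<phi>" shows "\<exists>M. val M \<and> \<phi> \<notin> M"
proof -
  define \<F> where "\<F> = {S. (\<forall>\<psi>. G \<psi> \<longrightarrow> \<psi> \<in> S) \<and>
    (\<forall>\<psi> \<chi>. (\<psi> \<^bold>\<rightarrow> \<chi>) \<in> S \<longrightarrow> \<psi> \<in> S \<longrightarrow> \<chi> \<in> S) \<and> \<phi> \<notin> S}"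
  have "\<exists>S\<in>\<F>. \<forall>X\<in>\<F>. S \<subseteq> X \<longrightarrow> X = S"
  proof (rule subset_Zorn_nonempty)
    have "{\<psi>. G \<psi>} \<in> \<F>"
      using assms mp unfolding \<F>_def by blast
    then show "\<F> \<noteq> {}"
      by blast
    fix C assume C: "C \<noteq> {}" "subset.chain \<F> C"
    have sub: "\<And>X. X \<in> C \<Longrightarrow> X \<in> \<F>" and tot: "\<And>X Y. X \<in> C \<Longrightarrow> Y \<in> C \<Longrightarrow> X \<subseteq> Y \<or> Y \<subseteq> X"
      using C(2) by (auto simp: subset_chain_def)
    show "\<Union> C \<in> \<F>"
      unfolding \<F>_def
    proof (intro CollectI conjI allI impI)
      show "\<psi> \<in> \<Union> C" if "G \<psi>" for \<psi>
        using C(1) sub that unfolding \<F>_def by blast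
      show "\<phi> \<notin> \<Union> C"
        using sub unfolding \<F>_def by blast
      fix \<psi> \<chi> assume "(\<psi> \<^bold>\<rightarrow> \<chi>) \<in> \<Union> C" "\<psi> \<in> \<Union> C"
      then obtain X where "X \<in> C" "(\<psi> \<^bold>\<rightarrow> \<chi>) \<in> X" "\<psi> \<in> X"
        using tot by blast
      then show "\<chi> \<in> \<Union> C"
        using sub unfolding \<F>_def by blast
    qed
  qed
  then obtain S where "S \<in> \<F>" and maximal: "\<forall>X\<in>\<F>. S \<subseteq> X \<longrightarrow> X = S"
    by blast
  then have thmS: "\<And>\<psi>. G \<psi> \<Longrightarrow> \<psi> \<in> S" and mpS: "\<And>\<psi> \<chi>. (\<psi> \<^bold>\<rightarrow> \<chi>) \<in> S \<Longrightarrow> \<psi> \<in> S \<Longrightarrow> \<chi> \<in> S"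
    and "\<phi> \<notin> S"
    by (auto simp: \<F>_def)
  have ded: "(\<psi> \<^bold>\<rightarrow> \<phi>) \<in> S" if "\<psi> \<notin> S" for \<psi>
  proof (rule ccontr)
    assume no: "(\<psi> \<^bold>\<rightarrow> \<phi>) \<notin> S"
    \<comment> \<open>The deduction theorem in set form: \<open>X\<close> is what \<open>S\<close>
      yields from \<open>\<psi>\<close>, closed under modus ponens by \<open>imp_S\<close>.\<close>
    define X where "X = {\<chi>. (\<psi> \<^bold>\<rightarrow> \<chi>) \<in> S}"
    have "\<chi> \<in> X" if "G \<chi>" for \<chi>
      using thmS[OF mp[OF imp_K that]] by (simp add: X_def)
    moreover have "\<xi> \<in> X" if "(\<chi> \<^bold>\<rightarrow> \<xi>) \<in> X" "\<chi> \<in> X" for \<chi> \<xi>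
      using mpS[OF mpS[OF thmS[OF imp_S]]] that by (simp add: X_def)
    ultimately have "X \<in> \<F>"
      using no unfolding \<F>_def X_def by blast
    moreover have "S \<subseteq> X"
      using mpS[OF thmS[OF imp_K]] unfolding X_def by blast
    ultimately have "X = S"
      using maximal by blast
    moreover have "\<psi> \<in> X"
      using thmS[OF imp_refl] unfolding X_def by blast
    ultimately show False
      using that by blast
  qed
  have neg: "(\<^bold>\<not> \<psi>) \<in> S \<longleftrightarrow> \<psi> \<notin> S" for \<psi>
  proof
    show "(\<^bold>\<not> \<psi>) \<in> S \<Longrightarrow> \<psi> \<notin> S"
      using mpS[OF mpS[OF thmS[OF luk3[of \<psi> \<phi>]]]] \<open>\<phi> \<notin> S\<close> by blast
    assume "\<psi> \<notin> S"
    show "(\<^bold>\<not> \<psi>) \<in> S"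
    proof (rule ccontr)
      assume "(\<^bold>\<not> \<psi>) \<notin> S"
      then show False
        using mpS[OF mpS[OF thmS[OF imp_cases]]] ded \<open>\<psi> \<notin> S\<close> \<open>(\<^bold>\<not> \<psi>) \<notin> S\<close> \<open>\<phi> \<notin> S\<close> by blast
    qed
  qed
  have "(\<psi> \<^bold>\<rightarrow> \<chi>) \<in> S \<longleftrightarrow> (\<psi> \<in> S \<longrightarrow> \<chi> \<in> S)" for \<psi> \<chi>
    using mpS thmS[OF imp_K] thmS[OF mp[OF imp_swap luk3]] neg by blast
  then have "val S"
    unfolding val_def using thmS neg by blast
  then show ?thesis
    using \<open>\<phi> \<notin> S\<close> by blast
qed

text \<open>Propositional completeness: from here on, theorems can be established by evaluation in
  all valuations.\<close>

lemma valI: "(\<And>M. val M \<Longrightarrow> \<phi> \<in> M) \<Longrightarrow> G \<phi>"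
  using val_exists by blast


section \<open>Quantifier prefixes and sentences in a valuation\<close>

lemma gen_close: "G \<phi> \<Longrightarrow> G (close s \<phi>)"
  by (induction s) (simp_all add: gen)

lemma all_mono:
  assumes "G (\<phi> \<^bold>\<rightarrow> \<psi>)" shows "G (FAll x \<phi> \<^bold>\<rightarrow> FAll x \<psi>)"
  by (rule mp[OF ax[OF Ax5] gen[OF assms]])

lemma close_mono:
  assumes "G (\<phi> \<^bold>\<rightarrow> \<psi>)" shows "G (close s \<phi> \<^bold>\<rightarrow> close s \<psi>)"
  using assms by (induction s) (simp_all add: all_mono)

lemma close_imp: "G (close s (\<phi> \<^bold>\<rightarrow> \<psi>) \<^bold>\<rightarrow> (close s \<phi> \<^bold>\<rightarrow> close s \<psi>))"
proof (induction s)
  case Nil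
  then show ?case
    by (simp add: imp_refl)
next
  case (Cons x s)
  show ?case
    unfolding close_simps by (rule syl[OF all_mono[OF Cons] ax[OF Ax5]])
qed

lemma close_elim: "G (close s \<phi> \<^bold>\<rightarrow> \<phi>)"
proof (induction s)
  case Nil
  then show ?case
    by (simp add: imp_refl)
next
  case (Cons x s)
  show ?case
    unfolding close_simps by (rule syl[OF ax[OF Ax6] Cons])
qed

lemma close_vacuous: "fv \<phi> = {} \<Longrightarrow> G (\<phi> \<^bold>\<rightarrow> close s \<phi>)"
proof (induction s)
  case Nil
  then show ?case
    by (simp add: imp_refl)
next
  case (Cons x s)
  show ?case
    unfolding close_simps
    by (rule syl[OF Cons.IH[OF Cons.prems] ax[OF Ax7]]) (simp add: fv_close Cons.prems)
qed

lemma full_gen: "G (full \<phi> \<^bold>\<rightarrow> full (FAll x \<phi>))"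
proof -
  have "G (full \<phi> \<^bold>\<rightarrow> FAll x \<phi>)"
    by (rule syl[OF ax[OF Ax7[of x]] all_mono[OF close_elim]]) (use fv_full in blast)
  then show ?thesis
    by (rule syl[OF close_vacuous[OF fv_full] close_mono])
qed

text \<open>A valuation need not be closed under generalization. Reading every formula as its full
  closure looks at sentences only, and these do form a theory.\<close>

lemma val_theory4:
  assumes M: "val M" shows "theory4 (\<lambda>\<phi>. full \<phi> \<in> M)"
proof
  show "full \<phi> \<in> M" if "uclosure \<phi> \<in> axioms4" for \<phi>
    using that by (intro val_thm[OF M] gen_close ax)
  show "full \<psi> \<in> M" if "full (\<phi> \<^bold>\<rightarrow> \<psi>) \<in> M" "full \<phi> \<in> M" for \<phi> \<psi>
    using val_thm[OF M close_imp] that unfolding val_imp[OF M] by blast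
  show "full (FAll x \<phi>) \<in> M" if "full \<phi> \<in> M" for \<phi> x
    using val_thm[OF M full_gen] that unfolding val_imp[OF M] by blast
qed

lemma val_full_sentence:
  assumes M: "val M" and "fv \<phi> = {}" shows "full \<phi> \<in> M \<longleftrightarrow> \<phi> \<in> M"
  using val_thm[OF M close_vacuous[OF assms(2)]] val_thm[OF M close_elim]
  unfolding val_imp[OF M] by blast

section \<open>Existential quantifiers and renaming of variables\<close>

lemma ex_intro: "G (\<phi> \<^bold>\<rightarrow> FEx x \<phi>)"
proof (rule valI)
  fix M assume M: "val M"
  show "(\<phi> \<^bold>\<rightarrow> FEx x \<phi>) \<in> M"
    using val_thm[OF M ax[OF Ax6[of x "\<^bold>\<not> \<phi>"]]] M by auto
qed

lemma ex_elim:
  assumes "G (\<phi> \<^bold>\<rightarrow> \<chi>)" "x \<notin> fv \<chi>" shows "G (FEx x \<phi> \<^bold>\<rightarrow> \<chi>)"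
proof (rule valI)
  fix M assume M: "val M"
  have "G (\<^bold>\<not> \<chi> \<^bold>\<rightarrow> FAll x (\<^bold>\<not> \<phi>))"
    using assms by (intro syl[OF ax[OF Ax7] all_mono[OF mp[OF contrapos_intro]]]) simp_all
  then show "(FEx x \<phi> \<^bold>\<rightarrow> \<chi>) \<in> M"
    using val_thm[OF M] M by fastforce
qed

text \<open>Ax9 gives the renamed formula under the assumption that \<open>x\<close> equals
  \<open>y\<close>; as \<open>x\<close> is not free in it, Ax8 discharges the assumption.\<close>

lemma swap_fresh:
  assumes "G \<phi>" "x \<noteq> y" "x \<notin> fv (swap_vars x y \<phi>)" shows "G (swap_vars x y \<phi>)"
proof -
  have "G (Atom x \<^bold>1' y \<^bold>\<rightarrow> swap_vars x y \<phi>)"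
    by (rule mp[OF mp[OF imp_swap ax[OF Ax9]] assms(1)])
  then have "G (FEx x (Atom x \<^bold>1' y) \<^bold>\<rightarrow> swap_vars x y \<phi>)"
    using assms(3) by (rule ex_elim)
  then show ?thesis
    using ax[OF Ax8[OF assms(2)]] by (rule mp)
qed

text \<open>Two of the four variables are not free in \<open>Q x y z\<close>, so \<open>swap_fresh\<close> moves the arguments into
  any other position one at a time.\<close>

lemma rename:
  assumes swap: "\<And>a b x y z. swap_vars a b (Q x y z) =
      Q (transpose a b x) (transpose a b y) (transpose a b z)"
    and fv: "\<And>x y z. distinct [x, y, z] \<Longrightarrow> fv (Q x y z) \<subseteq> {x, y}"
    and G: "G (Q u v w)" "distinct [u, v, w]" and d: "distinct [x, y, z]"
  shows "G (Q x y z)"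
proof -
  define D where "D = (\<lambda>x y z. distinct [x, y, z] \<and> G (Q x y z))"
  have D_swap: "D (transpose a b x) (transpose a b y) (transpose a b z)"
    if "D x y z" "a \<noteq> b" "b \<notin> {x, y}" for a b x y z
  proof -
    have "distinct [transpose a b x, transpose a b y, transpose a b z]"
      using that(1) inj_transpose[of a b] by (simp add: D_def inj_eq)
    moreover from this have "a \<notin> fv (Q (transpose a b x) (transpose a b y) (transpose a b z))"
      using fv[of "transpose a b x" "transpose a b y" "transpose a b z"] that(2,3)
      by (auto simp: transpose_def split: if_splits)
    ultimately show ?thesis
      using that swap_fresh[of "Q x y z" a b] swap by (simp add: D_def)
  qed
  have 1: "D z y x" if "D x y z" for x y z
    using D_swap[OF that, of x z] that by (auto simp: D_def transpose_def)
  have 2: "D x z y" if "D x y z" for x y z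
    using D_swap[OF that, of y z] that by (auto simp: D_def transpose_def)
  have 3: "D x y t" if "D x y z" "t \<notin> {x, y}" for x y z t
    using D_swap[OF that(1), of z t] that by (cases "t = z") (auto simp: D_def transpose_def)
  have "D u v w"
    using G by (simp add: D_def)
  then obtain y1 z1 where D1: "D x y1 z1"
    using 1 2 3[of u v w x] by blast
  then obtain z2 where "D x y z2"
    using 2 3[of x y1 z1 y] d by (metis distinct_length_2_or_more insertE singletonD)
  then show ?thesis
    using 3[of x y z2 z] d by (auto simp: D_def)
qed

lemma distinct_extend: "x \<noteq> y \<Longrightarrow> \<exists>z. distinct [x, y, z :: var]"
  by (cases x; cases y) (auto intro: exI[of _ V0] exI[of _ V1] exI[of _ V2])

lemma rename2:
  assumes swap: "\<And>a b x y. swap_vars a b (Q x y) = Q (transpose a b x) (transpose a b y)"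
    and fv: "\<And>x y. x \<noteq> y \<Longrightarrow> fv (Q x y) \<subseteq> {x, y}"
    and G: "G (Q u v)" "u \<noteq> v" and d: "x \<noteq> y"
  shows "G (Q x y)"
proof -
  obtain w z where "distinct [u, v, w]" "distinct [x, y, z]"
    using distinct_extend G(2) d by blast
  then show ?thesis
    using rename[of "\<lambda>x y z. Q x y" u v w x y z] swap fv G(1) by simp
qed

text \<open>The axioms on predicates mention V0 and V1 as end points only; renaming carries them to
  any two distinct variables. The same is done below for the other operators.\<close>

lemma val_sum:
  assumes M: "val M" and "x \<noteq> y"
  shows "Atom x (A \<^bold>+ B) y \<in> M \<longleftrightarrow> Atom x A y \<in> M \<or> Atom x B y \<in> M"
proof -
  have "G (Atom x (A \<^bold>+ B) y \<^bold>\<leftrightarrow> Atom x A y \<^bold>\<or> Atom x B y)"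
    by (rule rename2[where Q = "\<lambda>x y. Atom x (A \<^bold>+ B) y \<^bold>\<leftrightarrow> Atom x A y \<^bold>\<or> Atom x B y",
          OF _ _ ax[OF Ax_sum] _ \<open>x \<noteq> y\<close>]) auto
  from val_thm[OF M this] show ?thesis
    using M by auto
qed

lemma val_compl:
  assumes M: "val M" and "x \<noteq> y"
  shows "Atom x (\<^bold>- A) y \<in> M \<longleftrightarrow> Atom x A y \<notin> M"
proof -
  have "G (Atom x (\<^bold>- A) y \<^bold>\<leftrightarrow> \<^bold>\<not> Atom x A y)"
    by (rule rename2[where Q = "\<lambda>x y. Atom x (\<^bold>- A) y \<^bold>\<leftrightarrow> \<^bold>\<not> Atom x A y",
          OF _ _ ax[OF Ax_compl] _ \<open>x \<noteq> y\<close>]) auto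
  from val_thm[OF M this] show ?thesis
    using M by auto
qed

lemma val_conv:
  assumes M: "val M" and "x \<noteq> y"
  shows "Atom x (A\<^bold>\<smile>) y \<in> M \<longleftrightarrow> Atom y A x \<in> M"
proof -
  have "G (Atom x (A\<^bold>\<smile>) y \<^bold>\<leftrightarrow> Atom y A x)"
    by (rule rename2[where Q = "\<lambda>x y. Atom x (A\<^bold>\<smile>) y \<^bold>\<leftrightarrow> Atom y A x",
          OF _ _ ax[OF Ax_conv] _ \<open>x \<noteq> y\<close>]) auto
  from val_thm[OF M this] show ?thesis
    using M by auto
qed

lemma val_comp:
  assumes M: "val M" and d: "distinct [x, y, z]"
  shows "Atom x (A \<^bold>; B) y \<in> M \<longleftrightarrow> FEx z (Atom x A z \<^bold>\<and> Atom z B y) \<in> M"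
proof -
  have "G (Atom x (A \<^bold>; B) y \<^bold>\<leftrightarrow> FEx z (Atom x A z \<^bold>\<and> Atom z B y))"
    by (rule rename[where Q = "\<lambda>x y z. Atom x (A \<^bold>; B) y \<^bold>\<leftrightarrow> FEx z (Atom x A z \<^bold>\<and> Atom z B y)",
          OF _ _ ax[OF Ax_comp] _ d]) auto
  from val_thm[OF M this] show ?thesis
    using M by auto
qed

lemma comp_intro:
  assumes M: "val M" and "distinct [x, y, z]" "Atom x A z \<in> M" "Atom z B y \<in> M"
  shows "Atom x (A \<^bold>; B) y \<in> M"
  using assms val_thm[OF M ex_intro[of "Atom x A z \<^bold>\<and> Atom z B y" z]]
    val_comp[OF M, of x y z A B] by simp

text \<open>A valuation has no witness for \<open>z\<close>. The argument is therefore made in an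
  arbitrary valuation \<open>N\<close>, unrelated to \<open>M\<close>, and \<open>ex_elim\<close>
  brings it back; any further fact known in \<open>M\<close> has to be built into
  \<open>\<chi>\<close>.\<close>

lemma comp_elim:
  assumes M: "val M" and "Atom x (A \<^bold>; B) y \<in> M" and d: "distinct [x, y, z]"
    and "\<And>N. val N \<Longrightarrow> Atom x A z \<in> N \<Longrightarrow> Atom z B y \<in> N \<Longrightarrow> \<chi> \<in> N" and "z \<notin> fv \<chi>"
  shows "\<chi> \<in> M"
proof -
  have "G (Atom x A z \<^bold>\<and> Atom z B y \<^bold>\<rightarrow> \<chi>)"
    using assms(4) by (intro valI) auto
  from val_thm[OF M ex_elim[OF this assms(5)]] show ?thesis
    using M assms(2) val_comp[OF M d] by simp
qed

section \<open>Provable inclusion of predicates\<close>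

definition entails :: "predicate \<Rightarrow> predicate \<Rightarrow> bool"  (infix \<open>\<sqsubseteq>\<close> 50)
  where "A \<sqsubseteq> B \<longleftrightarrow> G (Atom V0 A V1 \<^bold>\<rightarrow> Atom V0 B V1)"

lemma entailsI: "(\<And>M. val M \<Longrightarrow> Atom V0 A V1 \<in> M \<Longrightarrow> Atom V0 B V1 \<in> M) \<Longrightarrow> A \<sqsubseteq> B"
  unfolding entails_def by (rule valI) simp

lemma entailsD:
  assumes "A \<sqsubseteq> B" and M: "val M" and "x \<noteq> y" "Atom x A y \<in> M" shows "Atom x B y \<in> M"
proof -
  have "G (Atom x A y \<^bold>\<rightarrow> Atom x B y)"
    by (rule rename2[where Q = "\<lambda>x y. Atom x A y \<^bold>\<rightarrow> Atom x B y",
          OF _ _ assms(1)[unfolded entails_def] _ \<open>x \<noteq> y\<close>]) auto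
  then show ?thesis
    using val_thm[OF M] M assms(4) by fastforce
qed

text \<open>Ax_eqn ties an equation, itself an atomic sentence, to its relational meaning; so the
  hypotheses and the goal of TR become entailments.\<close>

lemma G_equ: "G (Equ (A \<doteq> B)) \<longleftrightarrow> A \<sqsubseteq> B \<and> B \<sqsubseteq> A"
proof -
  let ?iff = "Atom V0 A V1 \<^bold>\<leftrightarrow> Atom V0 B V1"
  have eqn: "Equ (A \<doteq> B) \<in> M \<longleftrightarrow> FAll V0 (FAll V1 ?iff) \<in> M" if M: "val M" for M
  proof -
    have "G (Equ (A \<doteq> B) \<^bold>\<leftrightarrow> uclosure ?iff)"
      by (rule ax) (use Ax_eqn[of A B] in \<open>simp add: uclosure_def\<close>)
    from val_thm[OF M this] show ?thesis
      using M by (auto simp: uclosure_def)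
  qed
  have "G (Equ (A \<doteq> B)) \<longleftrightarrow> G ?iff"
  proof
    assume "G (Equ (A \<doteq> B))"
    then have "G (FAll V0 (FAll V1 ?iff))"
      using eqn val_thm by (intro valI) blast
    then show "G ?iff"
      by (rule mp[OF syl[OF ax[OF Ax6] ax[OF Ax6]]])
  next
    assume "G ?iff"
    then have "G (FAll V0 (FAll V1 ?iff))"
      by (intro gen)
    then show "G (Equ (A \<doteq> B))"
      using eqn val_thm by (intro valI) blast
  qed
  also have "\<dots> \<longleftrightarrow> A \<sqsubseteq> B \<and> B \<sqsubseteq> A"
  proof
    assume iff: "G ?iff"
    have "Atom V0 A V1 \<in> M \<longleftrightarrow> Atom V0 B V1 \<in> M" if M: "val M" for M
      using val_thm[OF M iff] M by auto
    then show "A \<sqsubseteq> B \<and> B \<sqsubseteq> A"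
      by (intro conjI entailsI) simp_all
  next
    assume "A \<sqsubseteq> B \<and> B \<sqsubseteq> A"
    then have "Atom V0 A V1 \<in> M \<longleftrightarrow> Atom V0 B V1 \<in> M" if "val M" for M
      using entailsD[OF _ that, of _ _ V0 V1] by blast
    then show "G ?iff"
      by (intro valI) simp
  qed
  finally show ?thesis .
qed

lemma G_ineq: "G (Equ (A \<^bold>\<le> B)) \<longleftrightarrow> A \<sqsubseteq> B"
proof -
  have "A \<^bold>+ B \<sqsubseteq> B \<longleftrightarrow> A \<sqsubseteq> B"
  proof
    assume le: "A \<^bold>+ B \<sqsubseteq> B"
    show "A \<sqsubseteq> B"
      by (rule entailsI, rule entailsD[OF le]) (simp_all add: val_sum)
  next
    assume le: "A \<sqsubseteq> B"
    show "A \<^bold>+ B \<sqsubseteq> B"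
    proof (rule entailsI)
      fix M assume M: "val M" "Atom V0 (A \<^bold>+ B) V1 \<in> M"
      then show "Atom V0 B V1 \<in> M"
        using entailsD[OF le M(1), of V0 V1] by (auto simp: val_sum)
    qed
  qed
  moreover have "B \<sqsubseteq> A \<^bold>+ B"
    by (rule entailsI) (simp add: val_sum)
  ultimately show ?thesis
    by (simp add: ineq_def G_equ)
qed

end

text \<open>The extension consists of the formulas whose full closure holds in a valuation omitting
  \<open>\<phi>\<close>; being two-valued, the valuation decides every sentence.\<close>

lemma (in theory4) complete_extension:
  assumes "fv \<phi> = {}" "\<not> G \<phi>"
  obtains H where "theory4 H" "\<And>\<psi>. G \<psi> \<Longrightarrow> H \<psi>" "\<not> H \<phi>"
    "\<And>\<psi>. fv \<psi> = {} \<Longrightarrow> H \<psi> \<or> H (\<^bold>\<not> \<psi>)"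
proof -
  obtain M where M: "val M" "\<phi> \<notin> M"
    using val_exists assms(2) by blast
  show thesis
  proof (rule that[of "\<lambda>\<psi>. full \<psi> \<in> M"])
    show "theory4 (\<lambda>\<psi>. full \<psi> \<in> M)"
      using M(1) by (rule val_theory4)
    show "full \<psi> \<in> M" if "G \<psi>" for \<psi>
      using that by (intro val_thm[OF M(1)] gen_close)
    show "full \<phi> \<notin> M"
      using M assms(1) val_full_sentence by blast
    show "full \<psi> \<in> M \<or> full (\<^bold>\<not> \<psi>) \<in> M" if "fv \<psi> = {}" for \<psi>
      using val_full_sentence[OF M(1)] val_not[OF M(1)] that by (metis fv.simps(4))
  qed
qed

section \<open>Integrality of a complete commutative theory\<close>

locale complete_commutative_dense = theory4 +
  assumes complete: "fv \<phi> = {} \<Longrightarrow> G \<phi> \<or> G (\<^bold>\<not> \<phi>)"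
    and comp_commute: "G (Equ (A \<^bold>; B \<doteq> B \<^bold>; A))"
    and comp_dense: "G (Equ (A \<^bold>\<le> A \<^bold>; A))"
begin

lemma entails_trans [trans]: "A \<sqsubseteq> B \<Longrightarrow> B \<sqsubseteq> C \<Longrightarrow> A \<sqsubseteq> C"
  unfolding entails_def by (rule syl)

lemma entails_commute: "A \<^bold>; B \<sqsubseteq> B \<^bold>; A"
  using comp_commute by (simp add: G_equ)

lemma entails_comp_mono:
  assumes "A \<sqsubseteq> A'" "B \<sqsubseteq> B'" shows "A \<^bold>; B \<sqsubseteq> A' \<^bold>; B'"
proof (rule entailsI)
  fix M assume M: "val M" "Atom V0 (A \<^bold>; B) V1 \<in> M"
  then show "Atom V0 (A' \<^bold>; B') V1 \<in> M"
  proof (rule comp_elim[where z = V2])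
    fix N assume N: "val N" "Atom V0 A V2 \<in> N" "Atom V2 B V1 \<in> N"
    show "Atom V0 (A' \<^bold>; B') V1 \<in> N"
      by (rule comp_intro[OF N(1), where z = V2])
        (use N entailsD[OF assms(1) N(1)] entailsD[OF assms(2) N(1)] in simp_all)
  qed simp_all
qed

text \<open>The fourth variable is used here and in the reverse inclusion: \<open>V2\<close> and
  \<open>V3\<close> are the two intermediate points.\<close>

lemma entails_assoc1: "(A \<^bold>; B) \<^bold>; C \<sqsubseteq> A \<^bold>; (B \<^bold>; C)"
proof (rule entailsI)
  fix M assume "val M" "Atom V0 ((A \<^bold>; B) \<^bold>; C) V1 \<in> M"
  then show "Atom V0 (A \<^bold>; (B \<^bold>; C)) V1 \<in> M"
  proof (rule comp_elim[where z = V2])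
    fix N assume N: "val N" "Atom V0 (A \<^bold>; B) V2 \<in> N" "Atom V2 C V1 \<in> N"
    \<comment> \<open>The elimination of \<open>V3\<close> moves to an unrelated valuation, so
      \<open>Atom V2 C V1\<close> travels along as an antecedent; \<open>V3\<close> is not free in
      it.\<close>
    have "(Atom V2 C V1 \<^bold>\<rightarrow> Atom V0 (A \<^bold>; (B \<^bold>; C)) V1) \<in> N"
    proof (rule comp_elim[OF N(1,2), where z = V3])
      fix L assume L: "val L" "Atom V0 A V3 \<in> L" "Atom V3 B V2 \<in> L"
      have "Atom V0 (A \<^bold>; (B \<^bold>; C)) V1 \<in> L" if "Atom V2 C V1 \<in> L"
        by (rule comp_intro[OF L(1), where z = V3])
          (use L that comp_intro[OF L(1), of V3 V1 V2 B C] in simp_all)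
      then show "(Atom V2 C V1 \<^bold>\<rightarrow> Atom V0 (A \<^bold>; (B \<^bold>; C)) V1) \<in> L"
        using L(1) by simp
    qed simp_all
    then show "Atom V0 (A \<^bold>; (B \<^bold>; C)) V1 \<in> N"
      using N by simp
  qed simp_all
qed

lemma entails_assoc2: "A \<^bold>; (B \<^bold>; C) \<sqsubseteq> (A \<^bold>; B) \<^bold>; C"
proof (rule entailsI)
  fix M assume "val M" "Atom V0 (A \<^bold>; (B \<^bold>; C)) V1 \<in> M"
  then show "Atom V0 ((A \<^bold>; B) \<^bold>; C) V1 \<in> M"
  proof (rule comp_elim[where z = V2])
    fix N assume N: "val N" "Atom V0 A V2 \<in> N" "Atom V2 (B \<^bold>; C) V1 \<in> N"
    have "(Atom V0 A V2 \<^bold>\<rightarrow> Atom V0 ((A \<^bold>; B) \<^bold>; C) V1) \<in> N"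
    proof (rule comp_elim[OF N(1,3), where z = V3])
      fix L assume L: "val L" "Atom V2 B V3 \<in> L" "Atom V3 C V1 \<in> L"
      have "Atom V0 ((A \<^bold>; B) \<^bold>; C) V1 \<in> L" if "Atom V0 A V2 \<in> L"
        by (rule comp_intro[OF L(1), where z = V3])
          (use L that comp_intro[OF L(1), of V0 V3 V2 A B] in simp_all)
      then show "(Atom V0 A V2 \<^bold>\<rightarrow> Atom V0 ((A \<^bold>; B) \<^bold>; C) V1) \<in> L"
        using L(1) by simp
    qed simp_all
    then show "Atom V0 ((A \<^bold>; B) \<^bold>; C) V1 \<in> N"
      using N by simp
  qed simp_all
qed

lemma val_top: "val M \<Longrightarrow> x \<noteq> y \<Longrightarrow> Atom x (\<^bold>1' \<^bold>+ \<^bold>- \<^bold>1') y \<in> M"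
  by (simp add: val_sum val_compl)

lemma ident_replace:
  assumes M: "val M" and "Atom x \<^bold>1' y \<in> M" "\<phi> \<in> M" shows "swap_vars x y \<phi> \<in> M"
  using val_thm[OF M ax[OF Ax9[of x y \<phi>]]] assms by simp

text \<open>The sentence that \<open>A\<close> is empty is decided, and negatively, since
  \<open>A\<close> is not below bottom. Stated with \<open>V2\<close> and \<open>V3\<close>,
  nonemptiness provides a pair that the top predicate connects to any \<open>V0\<close> and
  \<open>V1\<close>.\<close>

lemma nonempty_generates_top:
  assumes "\<not> A \<sqsubseteq> \<^bold>\<bottom>"
  shows "\<^bold>1' \<^bold>+ \<^bold>- \<^bold>1' \<sqsubseteq> (\<^bold>1' \<^bold>+ \<^bold>- \<^bold>1') \<^bold>; (A \<^bold>; (\<^bold>1' \<^bold>+ \<^bold>- \<^bold>1'))" 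
    (is "?T \<sqsubseteq> ?T \<^bold>; (A \<^bold>; ?T)")
proof -
  let ?\<sigma> = "FAll V2 (FAll V3 (\<^bold>\<not> Atom V2 A V3))"
  have "\<not> G ?\<sigma>"
  proof
    assume "G ?\<sigma>"
    then have "G (\<^bold>\<not> Atom V2 A V3)"
      by (rule mp[OF syl[OF ax[OF Ax6] ax[OF Ax6]]])
    then have "G (\<^bold>\<not> Atom V0 A V1)"
      by (rule rename2[where Q = "\<lambda>x y. \<^bold>\<not> Atom x A y", rotated 2]) auto
    then have "A \<sqsubseteq> \<^bold>\<bottom>"
      using val_thm by (intro entailsI) fastforce
    then show False
      using assms by blast
  qed
  then have "G (\<^bold>\<not> ?\<sigma>)"
    using complete[of ?\<sigma>] by auto
  \<comment> \<open>Contraposed, so that \<open>V3\<close> and \<open>V2\<close>, which do not occur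
    in the antecedent, can be generalized in the conclusion.\<close>
  have "G (\<^bold>\<not> Atom V0 (?T \<^bold>; (A \<^bold>; ?T)) V1 \<^bold>\<rightarrow> \<^bold>\<not> Atom V2 A V3)"
  proof (rule valI)
    fix M assume M: "val M"
    have "Atom V0 (?T \<^bold>; (A \<^bold>; ?T)) V1 \<in> M" if "Atom V2 A V3 \<in> M"
      by (rule comp_intro[OF M, where z = V2])
        (use that comp_intro[OF M, of V2 V1 V3 A ?T] val_top[OF M] in simp_all)
    then show "(\<^bold>\<not> Atom V0 (?T \<^bold>; (A \<^bold>; ?T)) V1 \<^bold>\<rightarrow> \<^bold>\<not> Atom V2 A V3) \<in> M"
      using M by auto
  qed
  then have "G (\<^bold>\<not> Atom V0 (?T \<^bold>; (A \<^bold>; ?T)) V1 \<^bold>\<rightarrow> FAll V3 (\<^bold>\<not> Atom V2 A V3))"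
    by (rule syl[OF ax[OF Ax7] all_mono, rotated]) simp
  then have "G (\<^bold>\<not> Atom V0 (?T \<^bold>; (A \<^bold>; ?T)) V1 \<^bold>\<rightarrow> ?\<sigma>)"
    by (rule syl[OF ax[OF Ax7] all_mono, rotated]) simp
  then have "Atom V0 (?T \<^bold>; (A \<^bold>; ?T)) V1 \<in> M" if "val M" for M
    using val_thm[OF that] \<open>G (\<^bold>\<not> ?\<sigma>)\<close> that by (metis val_imp val_not)
  then show ?thesis
    by (intro entailsI)
qed

text \<open>Commutativity improves T <= T;(C;T) to T <= T;C for nonempty C. If A and B are both
  nonempty, then T <= T;A <= (T;B);A <= T;(A;B), and the last product is empty.\<close>

lemma entails_integral:
  assumes AB: "A \<^bold>; B \<sqsubseteq> \<^bold>\<bottom>" shows "A \<sqsubseteq> \<^bold>\<bottom> \<or> B \<sqsubseteq> \<^bold>\<bottom>"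
proof (rule ccontr)
  define T where "T = \<^bold>1' \<^bold>+ \<^bold>- \<^bold>1'"
  have refl: "C \<sqsubseteq> C" for C
    by (simp add: entailsI)
  have top: "C \<sqsubseteq> T" for C
    unfolding T_def by (rule entailsI) (simp add: val_top)
  assume "\<not> (A \<sqsubseteq> \<^bold>\<bottom> \<or> B \<sqsubseteq> \<^bold>\<bottom>)"
  have full: "T \<sqsubseteq> T \<^bold>; C" if "\<not> C \<sqsubseteq> \<^bold>\<bottom>" for C
  proof -
    have "T \<sqsubseteq> T \<^bold>; (C \<^bold>; T)"
      using nonempty_generates_top[OF that] by (simp add: T_def)
    also have "T \<^bold>; (C \<^bold>; T) \<sqsubseteq> T \<^bold>; (T \<^bold>; C)"
      by (intro entails_comp_mono refl entails_commute)
    also have "\<dots> \<sqsubseteq> (T \<^bold>; T) \<^bold>; C"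
      by (rule entails_assoc2)
    also have "\<dots> \<sqsubseteq> T \<^bold>; C"
      by (intro entails_comp_mono refl top)
    finally show ?thesis .
  qed
  have "T \<sqsubseteq> T \<^bold>; A"
    using full \<open>\<not> (A \<sqsubseteq> \<^bold>\<bottom> \<or> B \<sqsubseteq> \<^bold>\<bottom>)\<close> by blast
  also have "\<dots> \<sqsubseteq> (T \<^bold>; B) \<^bold>; A"
    using full \<open>\<not> (A \<sqsubseteq> \<^bold>\<bottom> \<or> B \<sqsubseteq> \<^bold>\<bottom>)\<close> by (intro entails_comp_mono refl) blast
  also have "\<dots> \<sqsubseteq> T \<^bold>; (B \<^bold>; A)"
    by (rule entails_assoc1)
  also have "\<dots> \<sqsubseteq> T \<^bold>; (A \<^bold>; B)"
    by (intro entails_comp_mono refl entails_commute)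
  also have "\<dots> \<sqsubseteq> T \<^bold>; \<^bold>\<bottom>"
    by (intro entails_comp_mono refl AB)
  also have "\<dots> \<sqsubseteq> \<^bold>\<bottom>"
  proof (rule entailsI)
    fix M assume "val M" "Atom V0 (T \<^bold>; \<^bold>\<bottom>) V1 \<in> M"
    then show "Atom V0 \<^bold>\<bottom> V1 \<in> M"
    proof (rule comp_elim[where z = V2])
      fix N assume "val N" "Atom V2 \<^bold>\<bottom> V1 \<in> N"
      then show "Atom V0 \<^bold>\<bottom> V1 \<in> N"
        using val_top[of N V2 V1] by (simp add: val_compl)
    qed simp_all
  qed
  finally have "T \<sqsubseteq> \<^bold>\<bottom>" .
  then show False
    using entails_trans[OF top] \<open>\<not> (A \<sqsubseteq> \<^bold>\<bottom> \<or> B \<sqsubseteq> \<^bold>\<bottom>)\<close> by blast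
qed

lemma entailment: "entailment (\<sqsubseteq>)"
proof
  fix A A' B B' C
  show "A \<sqsubseteq> B \<Longrightarrow> B \<sqsubseteq> C \<Longrightarrow> A \<sqsubseteq> C"
    by (rule entails_trans)
  show "A \<sqsubseteq> A" "A \<sqsubseteq> A \<^bold>+ B" "B \<sqsubseteq> A \<^bold>+ B" "A \<^bold>\<sqinter> B \<sqsubseteq> A" "A \<^bold>\<sqinter> B \<sqsubseteq> B" "A \<^bold>\<sqinter> \<^bold>- A \<sqsubseteq> B"
    by (rule entailsI; simp add: val_sum val_compl)+
  show "A \<^bold>+ B \<sqsubseteq> C" if "A \<sqsubseteq> C" "B \<sqsubseteq> C"
  proof (rule entailsI)
    fix M assume "val M" "Atom V0 (A \<^bold>+ B) V1 \<in> M"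
    then show "Atom V0 C V1 \<in> M"
      using entailsD[OF that(1), of M V0 V1] entailsD[OF that(2), of M V0 V1] by (auto simp: val_sum)
  qed
  show "C \<sqsubseteq> A \<^bold>\<sqinter> B" if "C \<sqsubseteq> A" "C \<sqsubseteq> B"
  proof (rule entailsI)
    fix M assume "val M" "Atom V0 C V1 \<in> M"
    then show "Atom V0 (A \<^bold>\<sqinter> B) V1 \<in> M"
      using entailsD[OF that(1), of M V0 V1] entailsD[OF that(2), of M V0 V1]
      by (simp add: val_sum val_compl)
  qed
  show "C \<sqsubseteq> B" if "C \<^bold>\<sqinter> A \<sqsubseteq> B" "C \<^bold>\<sqinter> \<^bold>- A \<sqsubseteq> B"
  proof (rule entailsI)
    fix M assume "val M" "Atom V0 C V1 \<in> M"
    then show "Atom V0 B V1 \<in> M"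
      using entailsD[OF that(1), of M V0 V1] entailsD[OF that(2), of M V0 V1]
      by (auto simp: val_sum val_compl)
  qed
  show "A \<sqsubseteq> A' \<Longrightarrow> B \<sqsubseteq> B' \<Longrightarrow> A \<^bold>; B \<sqsubseteq> A' \<^bold>; B'"
    by (rule entails_comp_mono)
  show "(A \<^bold>; B) \<^bold>; C \<sqsubseteq> A \<^bold>; (B \<^bold>; C)"
    by (rule entails_assoc1)
  show "A \<^bold>; B \<sqsubseteq> \<^bold>\<bottom> \<Longrightarrow> A \<sqsubseteq> \<^bold>\<bottom> \<or> B \<sqsubseteq> \<^bold>\<bottom>"
    by (rule entails_integral)
  show "A \<sqsubseteq> A \<^bold>; A"
    using comp_dense by (simp add: G_ineq)
  have elim: "A \<^bold>; B \<sqsubseteq> C"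
    if hyp: "\<And>M. val M \<Longrightarrow> Atom V0 A V2 \<in> M \<Longrightarrow> Atom V2 B V1 \<in> M \<Longrightarrow> Atom V0 C V1 \<in> M" for A B C
  proof (rule entailsI)
    fix M assume "val M" "Atom V0 (A \<^bold>; B) V1 \<in> M"
    then show "Atom V0 C V1 \<in> M"
    proof (rule comp_elim[where z = V2])
      show "Atom V0 C V1 \<in> N" if "val N" "Atom V0 A V2 \<in> N" "Atom V2 B V1 \<in> N" for N
        using that by (rule hyp)
    qed simp_all
  qed
  show "(A \<^bold>+ B) \<^bold>; C \<sqsubseteq> A \<^bold>; C \<^bold>+ B \<^bold>; C" "A \<^bold>; (B \<^bold>+ C) \<sqsubseteq> A \<^bold>; B \<^bold>+ A \<^bold>; C"
    by (rule elim; use comp_intro[of _ V0 V1 V2] in \<open>auto simp: val_sum\<close>)+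
  show "\<^bold>\<bottom> \<^bold>; A \<sqsubseteq> \<^bold>\<bottom>" "A \<^bold>; \<^bold>\<bottom> \<sqsubseteq> \<^bold>\<bottom>"
    by (rule elim; simp add: val_sum val_compl)+
  show "A \<^bold>; \<^bold>1' \<sqsubseteq> A" 
    by (rule elim) (use ident_replace[of _ V2 V1 "Atom V0 A V2"] in auto)
  show "\<^bold>1' \<^bold>; A \<sqsubseteq> A"
  proof (rule elim)
    fix M assume M: "val M" "Atom V0 \<^bold>1' V2 \<in> M" "Atom V2 A V1 \<in> M"
    then show "Atom V0 A V1 \<in> M"
      using ident_replace[of M V0 V2 "Atom V2 A V1"] by simp
  qed
  show "A \<sqsubseteq> A \<^bold>; \<^bold>1'"
  proof (rule entailsI)
    fix M assume M: "val M" "Atom V0 A V1 \<in> M"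
    \<comment> \<open>The intermediate point \<open>V2\<close> is a copy of \<open>V1\<close>,
      supplied by Ax8.\<close>
    have "G (Atom V2 \<^bold>1' V1 \<^bold>\<rightarrow> Atom V0 A V1 \<^bold>\<rightarrow> Atom V0 (A \<^bold>; \<^bold>1') V1)"
    proof (rule valI)
      fix N assume N: "val N"
      have "Atom V0 (A \<^bold>; \<^bold>1') V1 \<in> N" if "Atom V2 \<^bold>1' V1 \<in> N" "Atom V0 A V1 \<in> N"
        using ident_replace[OF N that] that comp_intro[OF N, of V0 V1 V2 A "\<^bold>1'"] by simp
      then show "(Atom V2 \<^bold>1' V1 \<^bold>\<rightarrow> Atom V0 A V1 \<^bold>\<rightarrow> Atom V0 (A \<^bold>; \<^bold>1') V1) \<in> N"
        using N by simp
    qed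
    then have "G (FEx V2 (Atom V2 \<^bold>1' V1) \<^bold>\<rightarrow> Atom V0 A V1 \<^bold>\<rightarrow> Atom V0 (A \<^bold>; \<^bold>1') V1)"
      by (rule ex_elim) simp
    from val_thm[OF M(1) mp[OF this ax[OF Ax8]]] show "Atom V0 (A \<^bold>; \<^bold>1') V1 \<in> M"
      using M by simp
  qed
  show "A\<^bold>\<smile> \<sqsubseteq> B\<^bold>\<smile>" if "A \<sqsubseteq> B"
    by (rule entailsI) (use entailsD[OF that, of _ V1 V0] in \<open>simp add: val_conv\<close>)
  show "A\<^bold>\<smile>\<^bold>\<smile> \<sqsubseteq> A" "A \<sqsubseteq> A\<^bold>\<smile>\<^bold>\<smile>"
    by (rule entailsI; simp add: val_conv)+
  show "A\<^bold>\<smile> \<^bold>; \<^bold>- (A \<^bold>; B) \<sqsubseteq> \<^bold>- B"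
    by (rule elim) (use comp_intro[of _ V2 V1 V0 A B] in \<open>auto simp: val_conv val_compl\<close>)
  show "\<^bold>- (A \<^bold>; B) \<^bold>; B\<^bold>\<smile> \<sqsubseteq> \<^bold>- A"
    by (rule elim) (use comp_intro[of _ V0 V2 V1 A B] in \<open>auto simp: val_conv val_compl\<close>)
qed

end

lemma TR_refutation_frame:
  assumes "A \<notin> TR"
  shows "\<exists>F :: predicate set frame. integral_dense_frame F \<and> commutativity_cond F \<and> \<not> valid_in F A"
proof -
  let ?\<Psi> = "Equ ` (Xi_d \<union> Xi_c)"
  interpret T: theory4 "\<lambda>\<phi>. ?\<Psi> \<turnstile>\<^sub>4 full \<phi>"
    by (rule theory4_prov4)
  have "\<not> prov4 ?\<Psi> (full (Equ (\<^bold>1' \<^bold>\<le> A)))"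
    using assms prov4_full_sentence[of "Equ (\<^bold>1' \<^bold>\<le> A)" ?\<Psi>] by (simp add: TR_def)
  then obtain H where H: "theory4 H" "\<And>\<psi>. prov4 ?\<Psi> (full \<psi>) \<Longrightarrow> H \<psi>" "\<not> H (Equ (\<^bold>1' \<^bold>\<le> A))"
    "\<And>\<psi>. fv \<psi> = {} \<Longrightarrow> H \<psi> \<or> H (\<^bold>\<not> \<psi>)"
    using T.complete_extension[of "Equ (\<^bold>1' \<^bold>\<le> A)"] by auto
  have Xi: "H (Equ E)" if "E \<in> Xi_d \<union> Xi_c" for E
    using that by (intro H(2) prov4_full_sentence[THEN iffD2] prov4.hyp) auto
  interpret H: complete_commutative_dense H
    using H(1,4) Xi by (auto simp: complete_commutative_dense_def complete_commutative_dense_axioms_def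
        Xi_d_def Xi_c_def)
  interpret E: entailment H.entails
    by (rule H.entailment)
  have "\<not> H.entails \<^bold>1' A"
    using H(3) H.G_ineq by blast
  then show ?thesis
    using E.canonical_integral_dense E.canonical_not_valid E.canonical_commutative[OF H.entails_commute]
    by blast
qed

section \<open>Changing the type of a refuting frame or algebra\<close>

instance predicate :: countable
  by countable_datatype

lemma integral_dense_frameD:
  assumes "integral_dense_frame F"
  obtains e where "integral_frame F e" "density_cond F"
proof -
  obtain e where "idents F = {e}"
    using assms card_1_singletonE unfolding integral_dense_frame_def by metis
  then have "integral_frame F e"
    using assms by (simp add: integral_dense_frame_def integral_frame_def)
  then show thesis
    using that assms by (simp add: integral_dense_frame_def)
qed

lemma countable_inj_on:
  assumes "infinite (UNIV :: 'b set)" "countable (S :: 'a set)"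
  obtains g :: "'a \<Rightarrow> 'b" where "inj_on g S"
proof -
  obtain f :: "nat \<Rightarrow> 'b" where "inj f"
    using infinite_countable_subset[OF assms(1)] by blast
  moreover obtain c :: "'a \<Rightarrow> nat" where "inj_on c S"
    using assms(2) countableE by blast
  ultimately show thesis
    using that[of "f \<circ> c"] comp_inj_on inj_on_subset by blast
qed

section \<open>Countable refuting subframes\<close>

context integral_frame
begin

lemma hom_facts:
  assumes "h \<in> alg_hom \<PP> (Cm F)"
  shows "h A \<subseteq> points F" "h (A \<^bold>+ B) = h A \<union> h B" "h (\<^bold>- A) = points F - h A"
    "h (A \<^bold>; B) = {z. \<exists>x\<in>h A. \<exists>y\<in>h B. R x y z}" "h (A\<^bold>\<smile>) = star F ` h A" "h \<^bold>1' = {e}"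
  using assms by (simp_all add: alg_hom_Cm)

text \<open>Once \<open>e\<close> lies in \<open>K\<close>, the conditions other than Pasch pass to
  subsets closed under \<open>star\<close>. Pasch, and compositions under the restricted
  homomorphism, ask for witnesses in \<open>K\<close>, whence \<open>K_pasch\<close> and
  \<open>K_comp\<close>.\<close>

lemma frame_image:
  fixes g :: "'k \<Rightarrow> 'l"
  assumes inj: "inj_on g K" and K: "K \<subseteq> points F" "e \<in> K"
    and K_star: "\<And>x. x \<in> K \<Longrightarrow> star F x \<in> K"
    and K_pasch: "\<And>v w x y z. v \<in> K \<Longrightarrow> w \<in> K \<Longrightarrow> y \<in> K \<Longrightarrow> z \<in> K \<Longrightarrow> R v w x \<Longrightarrow> R x y z \<Longrightarrow>
      \<exists>u\<in>K. R v u z \<and> R w y u"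
    and h: "h \<in> alg_hom \<PP> (Cm F)"
    and K_comp: "\<And>A B z. z \<in> K \<Longrightarrow> z \<in> h (A \<^bold>; B) \<Longrightarrow> \<exists>x\<in>K. \<exists>y\<in>K. x \<in> h A \<and> y \<in> h B \<and> R x y z"
    and dense: "density_cond F" and A: "e \<notin> h A"
  shows "\<exists>F' :: 'l frame. integral_dense_frame F' \<and> \<not> valid_in F' A \<and>
    (commutativity_cond F \<longrightarrow> commutativity_cond F') \<and> (symmetry_cond F \<longrightarrow> symmetry_cond F')"
proof -
  define F' where "F' = \<lparr>points = g ` K,
    rel = {(g x, g y, g z) | x y z. x \<in> K \<and> y \<in> K \<and> z \<in> K \<and> R x y z},
    star = (\<lambda>a. g (star F (inv_into K g a))), idents = {g e}\<rparr>"
  have g_eq [simp]: "g x = g y \<longleftrightarrow> x = y" if "x \<in> K" "y \<in> K" for x y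
    using inj that by (simp add: inj_on_eq_iff)
  have points [simp]: "points F' = g ` K" and idents [simp]: "idents F' = {g e}"
    by (simp_all add: F'_def)
  have rel [simp]: "(g x, g y, g z) \<in> rel F' \<longleftrightarrow> R x y z" if "x \<in> K" "y \<in> K" "z \<in> K" for x y z
    using that g_eq unfolding F'_def by auto
  have star [simp]: "star F' (g x) = g (star F x)" if "x \<in> K" for x
    using that inj by (simp add: F'_def)
  have pt: "x \<in> points F" if "x \<in> K" for x
    using that K by blast
  have "rel F' \<subseteq> points F' \<times> points F' \<times> points F'"
    unfolding F'_def by auto
  then have "is_frame F'"
    using K(2) K_star by (auto simp: is_frame_def)
  moreover have "left_reflection F'" "right_reflection F'"
    unfolding left_reflection_def right_reflection_def
    using rel_left rel_right K_star by auto
  moreover have "identity_cond F'"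
    unfolding identity_cond_def using rel_ident_right pt K(2) by auto
  moreover have "pasch_cond F'"
    unfolding pasch_cond_def by (simp, blast intro: K_pasch)
  moreover have "density_cond F'"
    using dense pt by (simp add: density_cond_def)
  ultimately have frame: "integral_dense_frame F'"
    by (simp add: integral_dense_frame_def)
  define h' where "h' = (\<lambda>B. g ` (h B \<inter> K))"
  note hom = hom_facts[OF h]
  have comp: "h' (B \<^bold>; C) = {z. \<exists>x\<in>h' B. \<exists>y\<in>h' C. (x, y, z) \<in> rel F'}" for B C
  proof (intro equalityI subsetI)
    fix a assume "a \<in> h' (B \<^bold>; C)"
    then obtain z where z: "z \<in> h (B \<^bold>; C)" "z \<in> K" "a = g z"
      unfolding h'_def by blast
    then obtain x y where "x \<in> K" "y \<in> K" "x \<in> h B" "y \<in> h C" "R x y z"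
      using K_comp by blast
    then have "g x \<in> h' B" "g y \<in> h' C" "(g x, g y, a) \<in> rel F'"
      using z by (simp_all add: h'_def)
    then show "a \<in> {z. \<exists>x\<in>h' B. \<exists>y\<in>h' C. (x, y, z) \<in> rel F'}"
      by blast
  next
    fix a assume "a \<in> {z. \<exists>x\<in>h' B. \<exists>y\<in>h' C. (x, y, z) \<in> rel F'}"
    then obtain x y where xy: "x \<in> h B" "x \<in> K" "y \<in> h C" "y \<in> K" "(g x, g y, a) \<in> rel F'"
      unfolding h'_def by blast
    then obtain z where z: "z \<in> K" "a = g z"
      unfolding F'_def by auto
    then have "z \<in> h (B \<^bold>; C)"
      using xy unfolding hom(4) by auto
    then show "a \<in> h' (B \<^bold>; C)"
      using z by (simp add: h'_def)
  qed
  have conv: "h' (B\<^bold>\<smile>) = star F' ` h' B" for B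
  proof (intro equalityI subsetI)
    fix a assume "a \<in> h' (B\<^bold>\<smile>)"
    then obtain x where x: "x \<in> h B" "star F x \<in> K" "a = g (star F x)"
      unfolding h'_def hom(5) by blast
    then have "x \<in> K"
      using K_star[OF x(2)] hom(1)[of B] by (metis star_star subsetD)
    then show "a \<in> star F' ` h' B"
      using x unfolding h'_def by (auto intro!: image_eqI[of _ _ "g x"])
  next
    fix a assume "a \<in> star F' ` h' B"
    then obtain x where "x \<in> h B" "x \<in> K" "a = g (star F x)"
      unfolding h'_def by auto
    then show "a \<in> h' (B\<^bold>\<smile>)"
      using K_star unfolding h'_def hom(5) by blast
  qed
  have sum: "h' (B \<^bold>+ C) = h' B \<union> h' C" for B C
    unfolding h'_def hom(2) by blast
  have compl: "h' (\<^bold>- B) = g ` K - h' B" for B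
  proof -
    have "h (\<^bold>- B) \<inter> K = K - h B \<inter> K"
      unfolding hom(3) using K(1) by blast
    then show ?thesis
      unfolding h'_def using inj_on_image_set_diff[OF inj, of K "h B \<inter> K"] by auto
  qed
  have ident: "h' \<^bold>1' = {g e}"
    unfolding h'_def hom(6) using K(2) by simp
  have "h' B \<subseteq> g ` K" for B
    unfolding h'_def by blast
  then have "h' \<in> alg_hom \<PP> (Cm F')"
    unfolding alg_hom_def using sum compl conv comp ident
    by (simp add: pred_alg_def Cm_def Setcompr_eq_image)
  moreover have "g e \<notin> h' A"
    using A K(2) g_eq unfolding h'_def by blast
  ultimately have "\<not> valid_in F' A"
    unfolding valid_in_def by auto
  moreover have "commutativity_cond F'" if "commutativity_cond F"
    using that pt by (simp add: commutativity_cond_def)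
  moreover have "symmetry_cond F'" if "symmetry_cond F"
    using that pt by (simp add: symmetry_cond_def)
  ultimately show ?thesis
    using frame by blast
qed

end

text \<open>A subset of the frame closed under the Skolem functions for the Pasch condition and for membership
  in the value of a composition still refutes the predicate; it is the range of a countable type of terms.\<close>

datatype skolem =
    SIdent
  | SStar skolem
  | SPasch skolem skolem skolem skolem
  | SLeft predicate predicate skolem
  | SRight predicate predicate skolem

instance skolem :: countable
  by countable_datatype

lemma frame_refutation_frame:
  fixes F :: "'k frame"
  assumes inf: "infinite (UNIV :: 'l set)" and F: "integral_dense_frame F" and "\<not> valid_in F A"
  shows "\<exists>F' :: 'l frame. integral_dense_frame F' \<and> \<not> valid_in F' A \<and>
    (commutativity_cond F \<longrightarrow> commutativity_cond F') \<and> (symmetry_cond F \<longrightarrow> symmetry_cond F')"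
proof -
  obtain e where "integral_frame F e" and dense: "density_cond F"
    using integral_dense_frameD[OF F] .
  interpret integral_frame F e by fact
  obtain h where h: "h \<in> alg_hom \<PP> (Cm F)" and "e \<notin> h A"
    using assms(3) by (auto simp: valid_in_def idents)
  note hom = hom_facts[OF h]
  \<comment> \<open>Skolem functions, with default \<open>e\<close> where no witness exists, so that
    all values are points.\<close>
  define pa where "pa = (\<lambda>v w y z. if \<exists>x. R v w x \<and> R x y z then SOME u. R v u z \<and> R w y u else e)"
  define lf where "lf = (\<lambda>B C z. if z \<in> h (B \<^bold>; C) then SOME x. x \<in> h B \<and> (\<exists>y\<in>h C. R x y z) else e)"
  \<comment> \<open>The right factor is chosen to fit the left factor already chosen.\<close>
  define rt where "rt = (\<lambda>B C z. if z \<in> h (B \<^bold>; C) then SOME y. y \<in> h C \<and> R (lf B C z) y z else e)"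
  have pa: "R v (pa v w y z) z \<and> R w y (pa v w y z)" if "R v w x" "R x y z" for v w x y z
    using someI_ex[OF rel_pasch[OF that]] that unfolding pa_def by auto
  have lf: "lf B C z \<in> h B \<and> (\<exists>y\<in>h C. R (lf B C z) y z)" if "z \<in> h (B \<^bold>; C)" for B C z
  proof -
    have "\<exists>x. x \<in> h B \<and> (\<exists>y\<in>h C. R x y z)"
      using that unfolding hom(4) by blast
    from someI_ex[OF this] show ?thesis
      using that unfolding lf_def by simp
  qed
  have rt: "rt B C z \<in> h C \<and> R (lf B C z) (rt B C z) z" if "z \<in> h (B \<^bold>; C)" for B C z
  proof -
    have "\<exists>y. y \<in> h C \<and> R (lf B C z) y z"
      using lf[OF that] by blast
    from someI_ex[OF this] show ?thesis
      using that unfolding rt_def by simp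
  qed
  define ev where "ev = rec_skolem e (\<lambda>_. star F) (\<lambda>_ _ _ _. pa) (\<lambda>B C _. lf B C) (\<lambda>B C _. rt B C)"
  have ev [simp]: "ev SIdent = e" "ev (SStar s) = star F (ev s)"
    "ev (SPasch s t u v) = pa (ev s) (ev t) (ev u) (ev v)"
    "ev (SLeft B C s) = lf B C (ev s)" "ev (SRight B C s) = rt B C (ev s)" for s t u v B C
    by (simp_all add: ev_def)
  have pa_point: "pa v w y z \<in> points F" for v w y z
  proof (cases "\<exists>x. R v w x \<and> R x y z")
    case True
    then show ?thesis
      using pa rel_points by blast
  qed (auto simp: pa_def)
  have lf_point: "lf B C z \<in> points F" for B C z
    using lf[of z B C] rel_points by (cases "z \<in> h (B \<^bold>; C)") (auto simp: lf_def)
  have rt_point: "rt B C z \<in> points F" for B C z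
    using rt[of z B C] rel_points by (cases "z \<in> h (B \<^bold>; C)") (auto simp: rt_def)
  have "ev s \<in> points F" for s
    by (induction s) (simp_all add: pa_point lf_point rt_point)
  obtain g :: "'k \<Rightarrow> 'l" where g: "inj_on g (range ev)"
    using countable_inj_on[OF inf, of "range ev"] by auto
  show ?thesis
  proof (rule frame_image[OF g])
    show "range ev \<subseteq> points F"
      using \<open>\<And>s. ev s \<in> points F\<close> by blast
    show "e \<in> range ev"
      by (rule range_eqI[of _ _ SIdent]) simp
    show "star F x \<in> range ev" if x: "x \<in> range ev" for x
    proof -
      obtain s where "x = ev s"
        using x by blast
      then show ?thesis
        by (intro range_eqI[of _ _ "SStar s"]) simp
    qed
    show "\<exists>u\<in>range ev. R v u z \<and> R w y u"
      if K: "v \<in> range ev" "w \<in> range ev" "y \<in> range ev" "z \<in> range ev" and R: "R v w x" "R x y z"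
      for v w x y z
    proof -
      obtain a b c d where "v = ev a" "w = ev b" "y = ev c" "z = ev d"
        using K by blast
      then have "pa v w y z = ev (SPasch a b c d)"
        by simp
      then show ?thesis
        using pa[OF R] by (metis rangeI)
    qed
    show "\<exists>x\<in>range ev. \<exists>y\<in>range ev. x \<in> h B \<and> y \<in> h C \<and> R x y z"
      if z: "z \<in> range ev" "z \<in> h (B \<^bold>; C)" for B C z
    proof -
      obtain s where "z = ev s"
        using z(1) by blast
      then have "lf B C z = ev (SLeft B C s)" "rt B C z = ev (SRight B C s)"
        by simp_all
      then show ?thesis
        using lf[OF z(2)] rt[OF z(2)] by (metis rangeI)
    qed
  qed fact+
qed

text \<open>The values of \<open>h\<close> form a countable subalgebra of the complex algebra, as
  there are only countably many predicates; \<open>g\<close> copies it into the target type.\<close>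

lemma frame_refutation_algebra:
  fixes F :: "'k frame"
  assumes inf: "infinite (UNIV :: 'u set)" and F: "integral_dense_frame F" and "\<not> valid_in F A"
  shows "\<exists>\<AA> :: 'u ralg. relation_algebra \<AA> \<and> integral_alg \<AA> \<and> dense_alg \<AA> \<and>
    \<not> true_in \<AA> (\<^bold>1' \<^bold>\<le> A) \<and>
    (commutativity_cond F \<longrightarrow> commutative_alg \<AA>) \<and> (symmetry_cond F \<longrightarrow> symmetric_alg \<AA>)"
proof -
  obtain e where "integral_frame F e" and dense: "density_cond F"
    using integral_dense_frameD[OF F] .
  interpret integral_frame F e by fact
  obtain h where h: "h \<in> alg_hom \<PP> (Cm F)" and A: "e \<notin> h A"
    using assms(3) by (auto simp: valid_in_def idents)
  note hom = hom_facts[OF h]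
  obtain g :: "'k set \<Rightarrow> 'u" where g: "inj_on g (range h)"
    using countable_inj_on[OF inf, of "range h"] by auto
  define k where "k = g \<circ> h"
  have k_eq [simp]: "k B = k C \<longleftrightarrow> h B = h C" for B C
    using g by (simp add: k_def inj_on_eq_iff)
  \<comment> \<open>\<open>p\<close> picks a predicate representing an element. As \<open>h\<close>
    is a homomorphism, operations do not depend on that choice, which is what \<open>ops\<close>
    records.\<close>
  define p where "p = inv k"
  have p [simp]: "h (p (k B)) = h B" for B
  proof -
    have "k (p (k B)) = k B"
      unfolding p_def by (rule f_inv_into_f) simp
    then show ?thesis
      by simp
  qed
  define \<AA> where "\<AA> = \<lparr>univ = range k, join = (\<lambda>a b. k (p a \<^bold>+ p b)), neg = (\<lambda>a. k (\<^bold>- p a)),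
    semi = (\<lambda>a b. k (p a \<^bold>; p b)), conv = (\<lambda>a. k ((p a)\<^bold>\<smile>)), ident = k \<^bold>1'\<rparr>"
  have univ: "univ \<AA> = range k"
    by (simp add: \<AA>_def)
  have ops [simp]: "k B \<oplus>\<^bsub>\<AA>\<^esub> k C = k (B \<^bold>+ C)" "\<sim>\<^bsub>\<AA>\<^esub> k B = k (\<^bold>- B)"
    "k B \<odot>\<^bsub>\<AA>\<^esub> k C = k (B \<^bold>; C)" "(k B)\<smile>\<^bsub>\<AA>\<^esub> = k (B\<^bold>\<smile>)" "\<one>'\<^bsub>\<AA>\<^esub> = k \<^bold>1'" for B C
    by (simp_all add: \<AA>_def hom)
  have sub: "x \<in> h B \<Longrightarrow> x \<in> points F" for x B
    using hom(1) by blast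
  have assoc: "h (B \<^bold>; (C \<^bold>; D)) = h ((B \<^bold>; C) \<^bold>; D)" for B C D
    unfolding hom(4) using rel_pasch rel_pasch_converse by blast
  have ident_right: "h (B \<^bold>; \<^bold>1') = h B" for B
    using sub by (auto simp: hom(4,6) rel_ident_right)
  have conv_conv: "h (B\<^bold>\<smile>\<^bold>\<smile>) = h B" for B
    unfolding hom(5) using sub by (force simp: image_image)
  have conv_comp: "h ((B \<^bold>; C)\<^bold>\<smile>) = h (C\<^bold>\<smile> \<^bold>; B\<^bold>\<smile>)" for B C
  proof (intro equalityI subsetI)
    fix z assume "z \<in> h ((B \<^bold>; C)\<^bold>\<smile>)"
    then show "z \<in> h (C\<^bold>\<smile> \<^bold>; B\<^bold>\<smile>)"
      unfolding hom(4,5) using rel_star by blast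
  next
    fix z assume "z \<in> h (C\<^bold>\<smile> \<^bold>; B\<^bold>\<smile>)"
    then obtain x y where xy: "x \<in> h B" "y \<in> h C" "R (star F y) (star F x) z"
      unfolding hom(4,5) by blast
    then have "R x y (star F z)" "z \<in> points F"
      using rel_star[OF xy(3)] rel_points[OF xy(3)] sub by simp_all
    then show "z \<in> h ((B \<^bold>; C)\<^bold>\<smile>)"
      unfolding hom(4,5) using xy by (auto intro!: image_eqI[of _ _ "star F z"])
  qed
  have residual: "h (B\<^bold>\<smile> \<^bold>; \<^bold>- (B \<^bold>; C)) \<subseteq> h (\<^bold>- C)" for B C
  proof
    fix z assume "z \<in> h (B\<^bold>\<smile> \<^bold>; \<^bold>- (B \<^bold>; C))"
    then obtain x w where x: "x \<in> h B" "w \<notin> h (B \<^bold>; C)" "R (star F x) w z"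
      unfolding hom(3-5) by blast
    then have "R x z w"
      using rel_left[OF x(3)] sub by simp
    then show "z \<in> h (\<^bold>- C)"
      using x rel_points unfolding hom(3,4) by blast
  qed
  have "relation_algebra \<AA>"
  proof
    fix a b c assume "a \<in> univ \<AA>" "b \<in> univ \<AA>" "c \<in> univ \<AA>"
    then obtain B C D where "a = k B" "b = k C" "c = k D"
      using univ by blast
    then show "a \<oplus>\<^bsub>\<AA>\<^esub> (b \<oplus>\<^bsub>\<AA>\<^esub> c) = (a \<oplus>\<^bsub>\<AA>\<^esub> b) \<oplus>\<^bsub>\<AA>\<^esub> c"
      "a \<odot>\<^bsub>\<AA>\<^esub> (b \<odot>\<^bsub>\<AA>\<^esub> c) = (a \<odot>\<^bsub>\<AA>\<^esub> b) \<odot>\<^bsub>\<AA>\<^esub> c"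
      "(a \<oplus>\<^bsub>\<AA>\<^esub> b) \<odot>\<^bsub>\<AA>\<^esub> c = a \<odot>\<^bsub>\<AA>\<^esub> c \<oplus>\<^bsub>\<AA>\<^esub> b \<odot>\<^bsub>\<AA>\<^esub> c"
      using assoc[of B C D] hom(2)[of B "C \<^bold>+ D"] hom(2)[of "B \<^bold>+ C" D]
      by (auto simp: hom(2) hom(4)[of "B \<^bold>+ C" D] hom(4)[of B D] hom(4)[of C D])
  next
    fix a b assume "a \<in> univ \<AA>" "b \<in> univ \<AA>"
    then obtain B C where "a = k B" "b = k C"
      using univ by blast
    then show "a \<oplus>\<^bsub>\<AA>\<^esub> b \<in> univ \<AA>" "a \<odot>\<^bsub>\<AA>\<^esub> b \<in> univ \<AA>"
      "a \<oplus>\<^bsub>\<AA>\<^esub> b = b \<oplus>\<^bsub>\<AA>\<^esub> a"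
      "\<sim>\<^bsub>\<AA>\<^esub> (\<sim>\<^bsub>\<AA>\<^esub> a \<oplus>\<^bsub>\<AA>\<^esub> \<sim>\<^bsub>\<AA>\<^esub> b) \<oplus>\<^bsub>\<AA>\<^esub> \<sim>\<^bsub>\<AA>\<^esub> (\<sim>\<^bsub>\<AA>\<^esub> a \<oplus>\<^bsub>\<AA>\<^esub> b) = a"
      "(a \<oplus>\<^bsub>\<AA>\<^esub> b)\<smile>\<^bsub>\<AA>\<^esub> = a\<smile>\<^bsub>\<AA>\<^esub> \<oplus>\<^bsub>\<AA>\<^esub> b\<smile>\<^bsub>\<AA>\<^esub>"
      using sub by (auto simp: univ hom(2,3,5) image_Un)
    show "(a \<odot>\<^bsub>\<AA>\<^esub> b)\<smile>\<^bsub>\<AA>\<^esub> = b\<smile>\<^bsub>\<AA>\<^esub> \<odot>\<^bsub>\<AA>\<^esub> a\<smile>\<^bsub>\<AA>\<^esub>"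
      using conv_comp \<open>a = k B\<close> \<open>b = k C\<close> by simp
    show "a\<smile>\<^bsub>\<AA>\<^esub> \<odot>\<^bsub>\<AA>\<^esub> \<sim>\<^bsub>\<AA>\<^esub> (a \<odot>\<^bsub>\<AA>\<^esub> b) \<oplus>\<^bsub>\<AA>\<^esub> \<sim>\<^bsub>\<AA>\<^esub> b = \<sim>\<^bsub>\<AA>\<^esub> b"
      using residual \<open>a = k B\<close> \<open>b = k C\<close> by (simp add: hom(2) Un_absorb1)
  next
    fix a assume "a \<in> univ \<AA>"
    then obtain B where "a = k B"
      using univ by blast
    then show "\<sim>\<^bsub>\<AA>\<^esub> a \<in> univ \<AA>" "a\<smile>\<^bsub>\<AA>\<^esub> \<in> univ \<AA>" "a \<odot>\<^bsub>\<AA>\<^esub> \<one>'\<^bsub>\<AA>\<^esub> = a" "a\<smile>\<^bsub>\<AA>\<^esub>\<smile>\<^bsub>\<AA>\<^esub> = a"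
      using ident_right conv_conv by (simp_all add: univ)
  qed (simp add: univ)
  moreover have zero: "ra_zero \<AA> = k \<^bold>\<bottom>" and one: "ra_one \<AA> = k (\<^bold>1' \<^bold>+ \<^bold>- \<^bold>1')"
    by (simp_all add: ra_one_def ra_zero_def)
  have h_bot: "h \<^bold>\<bottom> = {}" and h_top: "h (\<^bold>1' \<^bold>+ \<^bold>- \<^bold>1') = points F"
    by (auto simp: hom(2,3,6))
  have "integral_alg \<AA>"
    unfolding integral_alg_def
  proof (intro conjI ballI impI)
    show "ra_zero \<AA> \<noteq> ra_one \<AA>"
      unfolding zero one k_eq h_bot h_top using e_point by blast
    fix a b assume "a \<in> univ \<AA>" "b \<in> univ \<AA>" "a \<odot>\<^bsub>\<AA>\<^esub> b = ra_zero \<AA>"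
    then obtain B C where BC: "a = k B" "b = k C" "h (B \<^bold>; C) = {}"
      using univ zero h_bot by auto
    then have "h B = {} \<or> h C = {}"
      using rel_serial sub unfolding hom(4) by blast
    then show "a = ra_zero \<AA> \<or> b = ra_zero \<AA>"
      using BC zero h_bot by simp
  qed
  moreover have "dense_alg \<AA>"
  proof -
    have "h B \<subseteq> h (B \<^bold>; B)" for B
      unfolding hom(4) using dense sub unfolding density_cond_def by blast
    then have "h (B \<^bold>+ B \<^bold>; B) = h (B \<^bold>; B)" for B
      unfolding hom(2) by blast
    then show ?thesis
      by (auto simp: dense_alg_def univ ra_le_def)
  qed
  moreover have "\<not> true_in \<AA> (\<^bold>1' \<^bold>\<le> A)"
  proof -
    have "k \<in> alg_hom \<PP> \<AA>"
      unfolding alg_hom_def by (simp add: pred_alg_def univ)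
    moreover have "k (\<^bold>1' \<^bold>+ A) \<noteq> k A"
      unfolding k_eq using A by (auto simp: hom(2,6))
    ultimately show ?thesis
      unfolding ineq_def true_in.simps by blast
  qed
  moreover have "commutative_alg \<AA>" if "commutativity_cond F"
  proof -
    have "R x y z \<longleftrightarrow> R y x z" for x y z
      using that rel_points unfolding commutativity_cond_def by blast
    then have "h (B \<^bold>; C) = h (C \<^bold>; B)" for B C
      unfolding hom(4) by blast
    then show ?thesis
      by (auto simp: commutative_alg_def univ)
  qed
  moreover have "symmetric_alg \<AA>" if "symmetry_cond F"
  proof -
    have "h (B\<^bold>\<smile>) = h B" for B
      using that sub by (force simp: hom(5) symmetry_cond_def)
    then show ?thesis
      by (auto simp: symmetric_alg_def univ)
  qed
  ultimately show ?thesis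
    by blast
qed

section \<open>KR-frames\<close>

text \<open>With trivial \<open>star\<close>, the last frame condition swaps the second and third
  places of a triple, and the exchange condition at the identity point swaps the first two. The
  relation is then totally symmetric, and the exchange condition and Pasch say the same.\<close>

lemma KR_frame_iff: "KR_frame F \<longleftrightarrow> integral_dense_frame F \<and> symmetry_cond F"
proof
  assume "KR_frame F"
  then have cr: "CR_star_frame F" and sym: "\<And>x. x \<in> points F \<Longrightarrow> star F x = x" and symm: "symmetry_cond F"
    by (simp_all add: KR_frame_def symmetry_cond_def)
  note conds = cr[unfolded CR_star_frame_def, THEN conjunct2]
  obtain e where e: "e \<in> points F" "idents F = {e}"
    and ident: "\<And>a b. a \<in> points F \<Longrightarrow> b \<in> points F \<Longrightarrow> (e, a, b) \<in> rel F \<longleftrightarrow> a = b"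
    using conds[THEN conjunct1] by blast
  note exch = conds[THEN conjunct2, THEN conjunct1, rule_format]
  have dense: "density_cond F"
    using conds[THEN conjunct2, THEN conjunct2, THEN conjunct1] by (simp add: density_cond_def)
  have refl: "(a, c, b) \<in> rel F"
    if "(a, b, c) \<in> rel F" "a \<in> points F" "b \<in> points F" "c \<in> points F" for a b c
    using conds[THEN conjunct2, THEN conjunct2, THEN conjunct2, THEN conjunct2] that sym by force
  have comm: "(b, a, c) \<in> rel F"
    if abc: "(a, b, c) \<in> rel F" "a \<in> points F" "b \<in> points F" "c \<in> points F" for a b c
  proof -
    \<comment> \<open>Exchange is applied with first entry \<open>e\<close>, so the inner point is
      \<open>a\<close> before and \<open>b\<close> after.\<close>
    have "\<exists>x\<in>points F. (e, a, x) \<in> rel F \<and> (x, b, c) \<in> rel F"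
      using ident[OF abc(2,2)] abc by blast
    then obtain y where y: "y \<in> points F" "(e, b, y) \<in> rel F" "(y, a, c) \<in> rel F"
      unfolding exch[OF e(1) abc(2-4)] by blast
    then show ?thesis
      using ident[OF abc(3) y(1)] by simp
  qed
  have rev: "(c, b, a) \<in> rel F"
    if "(a, b, c) \<in> rel F" "a \<in> points F" "b \<in> points F" "c \<in> points F" for a b c
    using refl[OF comm[OF refl]] that by blast
  have "left_reflection F"
    unfolding left_reflection_def
  proof (intro ballI impI)
    fix x y z assume "x \<in> points F" "y \<in> points F" "z \<in> points F" "(x, y, z) \<in> rel F"
    then show "(star F x, z, y) \<in> rel F"
      unfolding sym[OF \<open>x \<in> points F\<close>] using refl by blast
  qed
  moreover have "right_reflection F"
    unfolding right_reflection_def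
  proof (intro ballI impI)
    fix x y z assume "x \<in> points F" "y \<in> points F" "z \<in> points F" "(x, y, z) \<in> rel F"
    then show "(z, star F y, x) \<in> rel F"
      unfolding sym[OF \<open>y \<in> points F\<close>] using rev by blast
  qed
  moreover have "identity_cond F"
    unfolding identity_cond_def e(2) using ident comm e(1) by blast
  moreover have "pasch_cond F"
    unfolding pasch_cond_def
  proof (intro ballI impI)
    fix v w y z assume pts: "v \<in> points F" "w \<in> points F" "y \<in> points F" "z \<in> points F"
      and "\<exists>x\<in>points F. (v, w, x) \<in> rel F \<and> (x, y, z) \<in> rel F"
    then have "\<exists>x\<in>points F. (w, v, x) \<in> rel F \<and> (x, y, z) \<in> rel F"
      using comm by blast
    then obtain u where "u \<in> points F" "(w, y, u) \<in> rel F" "(u, v, z) \<in> rel F"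
      using exch[OF pts(2,1,3,4)] by blast
    then show "\<exists>u\<in>points F. (v, u, z) \<in> rel F \<and> (w, y, u) \<in> rel F"
      using comm pts by blast
  qed
  ultimately show "integral_dense_frame F \<and> symmetry_cond F"
    using cr e dense symm by (simp add: integral_dense_frame_def CR_star_frame_def)
next
  assume F: "integral_dense_frame F \<and> symmetry_cond F"
  then obtain e where "integral_frame F e" and dense: "density_cond F"
    using integral_dense_frameD by blast
  interpret integral_frame F e by fact
  have sym: "star F x = x" if "x \<in> points F" for x
    using F that by (simp add: symmetry_cond_def)
  have refl: "R x z y" if "R x y z" for x y z
    using rel_left[OF that] rel_points[OF that] sym by simp
  \<comment> \<open>Reversing a triple by \<open>rel_star\<close> amounts to commuting it when
    \<open>star\<close> is trivial.\<close>
  have comm: "R y x z" if "R x y z" for x y z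
    using rel_star[OF that] rel_points[OF that] sym by simp
  have exch: "\<exists>y\<in>points F. R a c y \<and> R y b d" if R: "R a b x" "R x c d" for a b c d x
  proof -
    obtain u where u: "R b u d" "R a c u"
      using rel_pasch[OF comm[OF R(1)] R(2)] by blast
    then show ?thesis
      using comm[OF u(1)] rel_points[OF u(1)] by blast
  qed
  show "KR_frame F"
    unfolding KR_frame_def CR_star_frame_def
  proof (intro conjI bexI ballI)
    show "is_frame F" "idents F = {e}" "symmetry_cond F"
      using frame idents F by simp_all
    fix a b c d assume pts: "a \<in> points F" "b \<in> points F" "c \<in> points F" "d \<in> points F"
    show "R e a b \<longleftrightarrow> a = b"
      using pts by (simp add: rel_ident_left)
    show "(\<exists>x\<in>points F. R a b x \<and> R x c d) \<longleftrightarrow> (\<exists>y\<in>points F. R a c y \<and> R y b d)"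
      using exch by blast
    show "R a a a"
      using dense pts by (simp add: density_cond_def)
    show "star F (star F a) = a"
      using pts by simp
    show "R a b c \<longleftrightarrow> R a (star F c) (star F b)"
      using refl sym pts by auto
  qed simp_all
qed

theorem theorem18:
  assumes inf_u: "infinite (UNIV :: 'u set)"
    and inf_k: "infinite (UNIV :: 'k set)"
    and inf_j: "infinite (UNIV :: 'j set)"
  shows
    "(\<forall>A.
       (A \<in> TR \<longleftrightarrow>
         (\<forall>\<AA> :: 'u ralg. relation_algebra \<AA> \<and> integral_alg \<AA> \<and> dense_alg \<AA> \<and> commutative_alg \<AA>
            \<longrightarrow> true_in \<AA> (\<^bold>1' \<^bold>\<le> A))) \<and>
       (A \<in> TR \<longleftrightarrow>
         (\<forall>F :: 'k frame. is_frame F \<and> card (idents F) = 1 \<and> left_reflection F \<and> right_reflection F \<and>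
              identity_cond F \<and> pasch_cond F \<and> density_cond F \<and> commutativity_cond F
            \<longrightarrow> valid_in F A))) \<and>
     (\<forall>A.
       (A \<in> KR TYPE('j) \<longleftrightarrow>
         (\<forall>\<AA> :: 'u ralg. relation_algebra \<AA> \<and> integral_alg \<AA> \<and> dense_alg \<AA> \<and> symmetric_alg \<AA>
            \<longrightarrow> true_in \<AA> (\<^bold>1' \<^bold>\<le> A))) \<and>
       (A \<in> KR TYPE('j) \<longleftrightarrow>
         (\<forall>F :: 'k frame. is_frame F \<and> card (idents F) = 1 \<and> left_reflection F \<and> right_reflection F \<and>
              identity_cond F \<and> pasch_cond F \<and> density_cond F \<and> symmetry_cond F
            \<longrightarrow> valid_in F A)))"
    (is "(\<forall>A. (_ \<longleftrightarrow> ?comm_alg A) \<and> (_ \<longleftrightarrow> ?comm_frame A)) \<and>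
      (\<forall>A. (_ \<longleftrightarrow> ?sym_alg A) \<and> (_ \<longleftrightarrow> ?sym_frame A))")
proof (intro conjI allI)
  fix A
  have comm_frame: "?comm_frame A \<longleftrightarrow>
      (\<forall>F :: 'k frame. integral_dense_frame F \<and> commutativity_cond F \<longrightarrow> valid_in F A)"
    unfolding integral_dense_frame_def by auto
  have sym_frame: "?sym_frame A \<longleftrightarrow>
      (\<forall>F :: 'k frame. integral_dense_frame F \<and> symmetry_cond F \<longrightarrow> valid_in F A)"
    unfolding integral_dense_frame_def by auto
  have KR: "A \<in> KR TYPE('j) \<longleftrightarrow>
      (\<forall>F :: 'j frame. integral_dense_frame F \<and> symmetry_cond F \<longrightarrow> valid_in F A)"
    by (simp add: KR_def KR_frame_iff)
  show "A \<in> TR \<longleftrightarrow> ?comm_alg A"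
  proof
    \<comment> \<open>Contrapositive: a refuting algebra would yield a refuting ultrafilter frame,
      against \<open>TR_valid\<close>.\<close>
    show "?comm_alg A" if "A \<in> TR"
      using that integral_dense_frameD integral_frame.TR_valid algebra_refutation_frame by metis
    show "A \<in> TR" if "?comm_alg A"
      using that TR_refutation_frame frame_refutation_algebra[OF inf_u] by metis
  qed
  show "A \<in> TR \<longleftrightarrow> ?comm_frame A"
    unfolding comm_frame
  proof
    show "\<forall>F :: 'k frame. integral_dense_frame F \<and> commutativity_cond F \<longrightarrow> valid_in F A" if "A \<in> TR"
      using that integral_dense_frameD integral_frame.TR_valid by metis
    show "A \<in> TR"
      if "\<forall>F :: 'k frame. integral_dense_frame F \<and> commutativity_cond F \<longrightarrow> valid_in F A"
      using that TR_refutation_frame frame_refutation_frame[OF inf_k] by metis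
  qed
  show "A \<in> KR TYPE('j) \<longleftrightarrow> ?sym_alg A"
    unfolding KR
  proof
    \<comment> \<open>The ultrafilter frame of a refuting algebra lives on
      \<open>predicate set\<close> and is moved to the type of \<open>KR\<close>.\<close>
    show "?sym_alg A"
      if "\<forall>F :: 'j frame. integral_dense_frame F \<and> symmetry_cond F \<longrightarrow> valid_in F A"
      using that algebra_refutation_frame frame_refutation_frame[OF inf_j] by metis
    show "\<forall>F :: 'j frame. integral_dense_frame F \<and> symmetry_cond F \<longrightarrow> valid_in F A" if "?sym_alg A"
      using that frame_refutation_algebra[OF inf_u] by metis
  qed
  show "A \<in> KR TYPE('j) \<longleftrightarrow> ?sym_frame A"
    unfolding KR sym_frame
    using frame_refutation_frame[OF inf_k, where 'k = 'j] frame_refutation_frame[OF inf_j, where 'k = 'k]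
    by metis
qed

end
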